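(* Let $\beta>1$ and $L>0$. Let $(\theta_i,s_i)$ be i.i.d. random variables uniformly distributed on $Z=\mathrm{S}^1\times[-1,1]$, independent of the errors $\epsilon_i$, and let $Y_i=T_\mu f(\theta_i,s_i)+\epsilon_i$. Let $\rho_n=\alpha_2 n^{-1/(2\beta+3)}$ for a constant $\alpha_2>0$, and let $$f_n^*(x)=\frac1n\sum_{i=1}^n e^{-\mu x\cdot\theta_i^\perp}K_{\rho_n}(x\cdot\theta_i-s_i)\,Y_i .$$ Put $\Psi_n=n^{-\beta/(2\beta+3)}$. Then there is a constant $0<C_1<\infty$, not depending on $n$, such that for all $n$ with $|\mu|<1/\rho_n$, $$\sup_{f\in H(\beta,L)}\Psi_n^{-2}\,\mathrm{MISE}(f_n^*,f)\le C_1,\qquad \mathrm{MISE}(f_n^*,f)=E_f\Big[\int_{B_1}|f_n^*(x)-f(x)|^2dx\Big],$$ where $B_1=\{x\in\mathbb{R}^2:\|x\|\le1\}$.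
   Context: Function class: for $\beta>1$ and $L>0$, $H(\beta,L)$ is the class of functions $f:\mathbb{R}^2\to\mathbb{R}$ supported in the closed unit ball $B_1$ whose Fourier transform $\widetilde f(\xi)=\int_{\mathbb{R}^2}f(x)e^{-i\xi\cdot x}dx$ satisfies $\int_{\mathbb{R}^2}(1+\|\xi\|^2)^\beta|\widetilde f(\xi)|^2d\xi\le L$; since $\beta>1$, $f$ is taken to be its continuous representative. Exponential Radon transform: $\mu\in\mathbb{R}$ is a fixed constant (here $\mu\ne0$). For $\theta\in\mathrm{S}^1$ (the unit circle in $\mathbb{R}^2$), $\theta^\perp$ is the unit vector perpendicular to $\theta$ obtained by rotating $\theta$ by $\pi/2$ (a fixed orientation). For $(\theta,s)\in Z=\mathrm{S}^1\times[-1,1]$, $$T_\mu f(\theta,s)=\int_{x\cdot\theta=s}e^{\mu x\cdot\theta^\perp}f(x)\,dx,$$ with $dx$ arc length on the line $\{x: x\cdot\theta=s\}$. Kernel: for $\rho>0$ with $0<|\mu|<1/\rho$, $$K_\rho(s)=\frac1\pi\int_{|\mu|}^{\sqrt{(1/\rho^2)+\mu^2}}r\cos(sr)\,dr .$$ Errors: $\epsilon_i$ are i.i.d. real random variables with mean $0$ and finite variance $\sigma^2>0$. $E_f$ denotes expectation with respect to the joint distribution of $(\theta_i,s_i,Y_i)$, $i=1,\dots,n$, when the true function is $f$. *)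

theory Defs
  imports "HOL-Probability.Probability"
begin

definition fourier2 :: "(real^2 \<Rightarrow> real) \<Rightarrow> real^2 \<Rightarrow> complex" where
  "fourier2 f \<xi> =
     (\<integral>x. complex_of_real (f x) * exp (- (\<i> * complex_of_real (\<xi> \<bullet> x))) \<partial>lborel)"

text \<open>
  A continuous function vanishing off the unit ball is integrable, so the integral defining its
  Fourier transform is a genuine one. The weighted energy is a nonnegative integral: a divergent
  energy is infinite, hence excluded by the bound.
\<close>

definition H_class :: "real \<Rightarrow> real \<Rightarrow> (real^2 \<Rightarrow> real) set" where
  "H_class \<beta> L = {f.
     continuous_on UNIV f \<and>
     (\<forall>x. x \<notin> cball 0 1 \<longrightarrow> f x = 0) \<and>
     (\<integral>\<^sup>+ \<xi>. ennreal ((1 + (norm \<xi>)\<^sup>2) powr \<beta> * (cmod (fourier2 f \<xi>))\<^sup>2) \<partial>lborel) \<le> ennreal L}"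

definition perp :: "real^2 \<Rightarrow> real^2" where
  "perp \<theta> = vector [- \<theta>$2, \<theta>$1]"

text \<open>
  For a unit vector \<open>\<theta>\<close>, the map \<open>t \<mapsto> s \<theta> + t \<theta>\<^sup>\<bottom>\<close> is the unit speed parametrization of the line
  \<open>x \<bullet> \<theta> = s\<close>, so the integral below is the integral with respect to arc length.
\<close>

definition exp_radon :: "real \<Rightarrow> (real^2 \<Rightarrow> real) \<Rightarrow> real^2 \<Rightarrow> real \<Rightarrow> real" where
  "exp_radon \<mu> f \<theta> s =
     (\<integral>t. (let x = s *\<^sub>R \<theta> + t *\<^sub>R perp \<theta> in exp (\<mu> * (x \<bullet> perp \<theta>)) * f x) \<partial>lborel)"

definition kernel :: "real \<Rightarrow> real \<Rightarrow> real \<Rightarrow> real" where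
  "kernel \<mu> \<rho> s =
     1 / pi * (LBINT r:{\<bar>\<mu>\<bar>..sqrt (1 / \<rho>\<^sup>2 + \<mu>\<^sup>2)}. r * cos (s * r))"

text \<open>The uniform law on the circle is the image of the uniform law of the angle.\<close>

definition uniform_circle :: "(real^2) measure" where
  "uniform_circle =
     distr (uniform_measure lborel {0..<2 * pi}) borel (\<lambda>t. vector [cos t, sin t])"

definition uniform_Z :: "((real^2) \<times> real) measure" where
  "uniform_Z = uniform_circle \<Otimes>\<^sub>M uniform_measure lborel {-1..1}"

text \<open>A sample of size \<open>n\<close> is indexed by \<open>0, \<dots>, n - 1\<close>.\<close>

definition estimator ::
  "real \<Rightarrow> real \<Rightarrow> nat \<Rightarrow> (nat \<Rightarrow> real^2) \<Rightarrow> (nat \<Rightarrow> real) \<Rightarrow> (nat \<Rightarrow> real) \<Rightarrow> real^2 \<Rightarrow> real" where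
  "estimator \<mu> \<rho> n \<theta> s Y x =
     1 / real n *
       (\<Sum>i<n. exp (- \<mu> * (x \<bullet> perp (\<theta> i))) * kernel \<mu> \<rho> (x \<bullet> \<theta> i - s i) * Y i)"

definition bandwidth :: "real \<Rightarrow> real \<Rightarrow> nat \<Rightarrow> real" where
  "bandwidth \<alpha> \<beta> n = \<alpha> * real n powr (- 1 / (2 * \<beta> + 3))"

definition rate :: "real \<Rightarrow> nat \<Rightarrow> real" where
  "rate \<beta> n = real n powr (- \<beta> / (2 * \<beta> + 3))"

definition MISE :: "'a measure \<Rightarrow> ('a \<Rightarrow> real^2 \<Rightarrow> real) \<Rightarrow> (real^2 \<Rightarrow> real) \<Rightarrow> ennreal" where
  "MISE M g f =
     (\<integral>\<^sup>+ \<omega>. (\<integral>\<^sup>+ x \<in> cball 0 1. ennreal (\<bar>g \<omega> x - f x\<bar>\<^sup>2) \<partial>lborel) \<partial>M)"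

end

theory Submission imports Defs begin

text \<open>
  For a fixed point \<open>z\<close> the angular integral of \<open>exp (- \<mu> z\<sqdot>\<theta>\<^sup>\<bottom>) cos (r z\<sqdot>\<theta>)\<close> depends on \<open>r\<close> only through
  \<open>r\<^sup>2 - \<mu>\<^sup>2\<close>, because the integral of an entire periodic function over a period is invariant under
  imaginary shifts. Polar coordinates then show that backprojecting the kernel produces
  the indicator of the disc of radius \<open>1/\<rho>\<close> on the Fourier side, so the mean of the estimator is a
  sharp spectral cutoff of \<open>f\<close>. Its squared bias on the unit ball is controlled by the Sobolev tail
  \<open>\<rho>\<close> to the power \<open>2\<beta>\<close>; here a Bessel inequality with a constant suffices, and it follows from a
  Gaussian weight and Schur's test without Plancherel's theorem. The variance is at most of order
  \<open>1/(n \<rho>\<^sup>3)\<close>, since the squared kernel has integral of order \<open>1/\<rho>\<^sup>3\<close> and \<open>exp_radon\<close> is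
  bounded uniformly over the class. The bandwidth balances the two.
\<close>

section \<open>Lebesgue measure on the plane\<close>

text \<open>The lower limit \<open>\<bar>\<mu>\<bar>\<close> of the kernel is what makes the cutoff
  exact: r = sqrt (\<tau>^2 + \<mu>^2) carries [0, 1/\<rho>] onto the range of integration and turns
  r dr into \<tau> d\<tau>, the radial part of the area element in the frequency plane. The factor
  1/(4 pi) in the density of the design cancels the constants of inversion, so the mean of the
  estimator is the cutoff without any normalization. The obstacle is uniformity over the class. The
  variance contains the size of \<open>exp_radon \<mu> f\<close>, so a bound on f in terms of
  \<beta> and L alone is required. Here \<beta> > 1 enters: (1 + |\<xi>|^2)^(-\<beta>) is then
  integrable over the plane, hence the Fourier transform of f is integrable with a uniform bound,
  and inversion bounds f. The Gaussian has two jobs: it is bounded below on the unit ball, where the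
  error is measured, and it regularizes the inversion integral. Equating the orders
  \<rho>^(2\<beta>) and 1/(n \<rho>^3) gives \<rho> of order n^(-1/(2\<beta>+3)).\<close>

lemma Basis_real2: "(Basis :: (real^2) set) = {axis 1 1, axis 2 1}"
  by (auto simp: Basis_vec_def UNIV_2)

lemma prod_Basis_real2: "(\<Prod>b\<in>(Basis :: (real^2) set). x \<bullet> b) = x$1 * x$2"
  by (simp add: Basis_real2 axis_eq_axis inner_axis)

lemma vector2_eq: "(vector [a, b] :: real^2) = a *\<^sub>R axis 1 1 + b *\<^sub>R axis 2 1"
  by (simp add: vec_eq_iff forall_2 axis_def)

lemma measurable_vector2[measurable (raw)]:
  assumes [measurable]: "f \<in> borel_measurable M" "g \<in> borel_measurable M"
  shows "(\<lambda>x. vector [f x, g x] :: real^2) \<in> borel_measurable M"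
  unfolding vector2_eq by measurable

lemma continuous_on_vector2[continuous_intros]:
  assumes "continuous_on S f" "continuous_on S g"
  shows "continuous_on S (\<lambda>x. vector [f x, g x] :: real^2)"
  unfolding vector2_eq by (intro continuous_intros assms)

lemma mem_box_real2: "x \<in> box l u \<longleftrightarrow> l$1 < x$1 \<and> x$1 < u$1 \<and> l$2 < x$2 \<and> x$2 < (u::real^2)$2"
  by (simp add: mem_box Basis_real2 inner_axis conj_ac)

text \<open>Lebesgue measure is determined by its values on boxes, and a box pulls back to a
  rectangle. This is the passage from the plane to iterated integrals over two real
  variables.\<close>

lemma lborel_eq_distr_vector2:
  "lborel = distr (lborel \<Otimes>\<^sub>M lborel) borel (\<lambda>p. vector [fst p, snd p] :: real^2)"
proof (rule lborel_eqI)
  fix l u :: "real^2" assume le: "\<And>b. b \<in> Basis \<Longrightarrow> l \<bullet> b \<le> u \<bullet> b"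
  have le': "l$1 \<le> u$1" "l$2 \<le> u$2"
    using le[of "axis 1 1"] le[of "axis 2 1"] by (auto simp: Basis_real2 inner_axis)
  have "emeasure (distr (lborel \<Otimes>\<^sub>M lborel) borel (\<lambda>p. vector [fst p, snd p] :: real^2)) (box l u)
     = emeasure (lborel \<Otimes>\<^sub>M lborel) ({l$1<..<u$1} \<times> {l$2<..<u$2})"
    by (subst emeasure_distr) (auto simp: mem_box_real2 space_pair_measure intro!: arg_cong[where f="emeasure _"])
  also have "\<dots> = ennreal (u$1 - l$1) * ennreal (u$2 - l$2)"
    using le' by (subst lborel.emeasure_pair_measure_Times) auto
  finally show "emeasure (distr (lborel \<Otimes>\<^sub>M lborel) borel (\<lambda>p. vector [fst p, snd p] :: real^2)) (box l u)
      = ennreal (\<Prod>b\<in>Basis. (u - l) \<bullet> b)"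
    unfolding prod_Basis_real2 using le' by (simp add: ennreal_mult)
qed simp

lemma perp_inner [simp]: "perp \<theta> \<bullet> perp \<theta> = \<theta> \<bullet> \<theta>" "\<theta> \<bullet> perp \<theta> = 0" "perp \<theta> \<bullet> \<theta> = 0"
  by (auto simp: perp_def inner_vec_def sum_2)

lemma norm_perp [simp]: "norm (perp \<theta>) = norm \<theta>"
  by (simp add: norm_eq_sqrt_inner)

lemma continuous_on_perp[continuous_intros]:
  assumes "continuous_on S f" shows "continuous_on S (\<lambda>x. perp (f x))"
  unfolding perp_def by (intro continuous_intros assms)

lemma measurable_perp[measurable]: "perp \<in> borel_measurable borel"
  unfolding perp_def[abs_def] by measurable

lemma perp_decomp: "norm \<theta> = 1 \<Longrightarrow> (x \<bullet> \<theta>) *\<^sub>R \<theta> + (x \<bullet> perp \<theta>) *\<^sub>R perp \<theta> = x"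
proof -
  assume "norm \<theta> = 1"
  then have 1: "\<theta>$1 * \<theta>$1 + \<theta>$2 * \<theta>$2 = 1"
    by (simp add: norm_eq_sqrt_inner inner_vec_def sum_2)
  have "(x$1 * \<theta>$1 + x$2 * \<theta>$2) * \<theta>$1 + (- (x$1 * \<theta>$2) + x$2 * \<theta>$1) * - \<theta>$2 = x$1 * (\<theta>$1 * \<theta>$1 + \<theta>$2 * \<theta>$2)"
    "(x$1 * \<theta>$1 + x$2 * \<theta>$2) * \<theta>$2 + (- (x$1 * \<theta>$2) + x$2 * \<theta>$1) * \<theta>$1 = x$2 * (\<theta>$1 * \<theta>$1 + \<theta>$2 * \<theta>$2)"
    by (auto simp: algebra_simps)
  then show ?thesis
    using 1 by (simp add: vec_eq_iff forall_2 perp_def inner_vec_def sum_2)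
qed

text \<open>For a unit vector the map is a rotation, whose inverse \<open>g\<close> has determinant
  \<theta> \<bullet> \<theta> = 1. It supplies the coordinates in which integration along the lines
  x \<bullet> \<theta> = s becomes Fubini.\<close>

lemma lborel_eq_distr_rotation:
  assumes "norm \<theta> = 1"
  shows "lborel = distr (lborel \<Otimes>\<^sub>M lborel) borel (\<lambda>p. fst p *\<^sub>R \<theta> + snd p *\<^sub>R perp \<theta>)"
proof -
  define R where "R x = x$1 *\<^sub>R \<theta> + x$2 *\<^sub>R perp \<theta>" for x :: "real^2"
  define g where "g x = (vector [x \<bullet> \<theta>, x \<bullet> perp \<theta>] :: real^2)" for x
  have \<theta>\<theta>: "\<theta> \<bullet> \<theta> = 1" using assms by (simp add: norm_eq_sqrt_inner)
  have Rg: "R (g x) = x" for x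
    using perp_decomp[OF assms, of x] by (simp add: R_def g_def)
  have gR: "g (R x) = x" for x
    by (simp add: R_def g_def vec_eq_iff forall_2 inner_add_left \<theta>\<theta>)
  have lin: "linear g"
    by (rule linearI) (auto simp: g_def vec_eq_iff forall_2 inner_add_left)
  have det: "\<bar>det (matrix g)\<bar> = 1"
  proof -
    have "det (matrix g) = \<theta> \<bullet> \<theta>"
      by (simp add: det_2 matrix_def g_def perp_def inner_axis' inner_vec_def[of \<theta> \<theta>] sum_2)
    then show ?thesis using \<theta>\<theta> by simp
  qed
  have [measurable]: "R \<in> borel_measurable borel" unfolding R_def[abs_def]
    by (intro borel_measurable_continuous_onI continuous_intros)
  have "lborel = distr lborel borel R"
  proof (rule lborel_eqI)
    fix l u :: "real^2" assume le: "\<And>b. b \<in> Basis \<Longrightarrow> l \<bullet> b \<le> u \<bullet> b"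
    \<comment> \<open>The measure of a distribution asks for a preimage under \<open>R\<close>,
      while the determinant formula is about images; hence the detour through the inverse
      map.\<close>
    have eq: "R -` box l u = g ` box l u" using Rg gR by (auto simp: image_iff) metis
    have m: "g ` box l u \<in> lmeasurable" "measure lebesgue (g ` box l u) = \<bar>det (matrix g)\<bar> * measure lebesgue (box l u)"
      using measurable_linear_image[OF lin, of "box l u"] measure_linear_image[OF lin, of "box l u"] by auto
    have [measurable]: "g ` box l u \<in> sets borel"
      unfolding eq[symmetric] using measurable_sets[of R borel borel "box l u"] by simp
    have "emeasure (distr lborel borel R) (box l u) = emeasure lborel (g ` box l u)"
      by (subst emeasure_distr) (auto simp: eq)
    also have "\<dots> = emeasure lebesgue (g ` box l u)" by simp
    also have "\<dots> = ennreal (measure lebesgue (box l u))"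
      using m det emeasure_eq_measure2[OF m(1)] by simp
    also have "\<dots> = ennreal (\<Prod>b\<in>Basis. (u - l) \<bullet> b)"
      using le by (simp add: measure_lborel_box_eq)
    finally show "emeasure (distr lborel borel R) (box l u) = ennreal (\<Prod>b\<in>Basis. (u - l) \<bullet> b)" .
  qed simp
  also have "\<dots> = distr (lborel \<Otimes>\<^sub>M lborel) borel (\<lambda>p. R (vector [fst p, snd p]))"
    by (subst lborel_eq_distr_vector2, subst distr_distr) (auto simp: comp_def)
  finally show ?thesis by (simp add: R_def)
qed

lemma norm_unit_vector2 [simp]: "norm (vector [cos t, sin t] :: real^2) = 1"
  by (simp add: norm_eq_sqrt_inner inner_vec_def sum_2 flip: power2_eq_square)

lemma set_integrable_compact:
  fixes f :: "'a::euclidean_space \<Rightarrow> 'b::{banach, second_countable_topology}"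
  assumes "compact S" "continuous_on S f" shows "set_integrable lborel S f"
  unfolding set_integrable_def by (rule borel_integrable_compact[OF assms])

text \<open>Change of variables on the open rectangle 0 < r < R, 0 < t < 2 pi, where polar
  coordinates are injective and the Jacobian is r. The part of the disc that is missed is a null
  set, and closing the rectangle changes nothing, so Fubini can finish on a compact box.\<close>

lemma integral_cball_polar:
  fixes g :: "real^2 \<Rightarrow> real"
  assumes g: "continuous_on UNIV g" and R: "R > 0"
  shows "(LINT x:cball 0 R|lborel. g x) =
    (LINT r:{0..R}|lborel. r * (LINT t:{0..2*pi}|lborel. g (r *\<^sub>R vector [cos t, sin t])))"
proof -
  define h where "h v = v$1 *\<^sub>R (vector [cos (v$2), sin (v$2)] :: real^2)" for v :: "real^2"
  define h' where "h' v w = w$1 *\<^sub>R (vector [cos (v$2), sin (v$2)] :: real^2)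
      + (v$1 * w$2) *\<^sub>R vector [- sin (v$2), cos (v$2)]" for v w :: "real^2"
  define S where "S = box (vector [0, 0]) (vector [R, 2 * pi] :: real^2)"
  \<comment> \<open>The change of variables rule applied below speaks of functions with values in a
    \<open>real^'n\<close>, so the real function is wrapped as a vector with one component and
    unwrapped afterwards.\<close>
  define f where "f x = (vec (g x) :: real^1)" for x
  have gm [measurable]: "g \<in> borel_measurable borel" using g by (rule borel_measurable_continuous_onI)
  have S: "v \<in> S \<longleftrightarrow> 0 < v$1 \<and> v$1 < R \<and> 0 < v$2 \<and> v$2 < 2 * pi" for v
    by (simp add: S_def mem_box_real2)
  have conth: "continuous_on UNIV h" unfolding h_def by (intro continuous_intros)
  have nh: "norm (h v) = \<bar>v$1\<bar>" for v by (simp add: h_def)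
  have der: "(h has_derivative h' v) (at v within S)" for v
  proof -
    have "((\<lambda>v. v$1 * cos (v$2)) has_derivative (\<lambda>w. w$1 * cos (v$2) - v$1 * w$2 * sin (v$2))) (at v within S)"
      "((\<lambda>v. v$1 * sin (v$2)) has_derivative (\<lambda>w. w$1 * sin (v$2) + v$1 * w$2 * cos (v$2))) (at v within S)"
      by (auto intro!: derivative_eq_intros bounded_linear.has_derivative[OF bounded_linear_vec_nth]
          simp: algebra_simps)
    from this[THEN has_derivative_scaleR_left, of "axis 1 1"] this[THEN has_derivative_scaleR_left, of "axis 2 1"]
    have "((\<lambda>v. (v$1 * cos (v$2)) *\<^sub>R axis 1 1 + (v$1 * sin (v$2)) *\<^sub>R axis 2 1) has_derivative
       (\<lambda>w. (w$1 * cos (v$2) - v$1 * w$2 * sin (v$2)) *\<^sub>R axis 1 1 + (w$1 * sin (v$2) + v$1 * w$2 * cos (v$2)) *\<^sub>R (axis 2 1 :: real^2))) (at v within S)"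
      by (intro has_derivative_add)
    moreover have "(\<lambda>v. (v$1 * cos (v$2)) *\<^sub>R axis 1 1 + (v$1 * sin (v$2)) *\<^sub>R axis 2 1) = h"
      by (auto simp: h_def vector2_eq scaleR_add_right)
    moreover have "(\<lambda>w. (w$1 * cos (v$2) - v$1 * w$2 * sin (v$2)) *\<^sub>R axis 1 1 + (w$1 * sin (v$2) + v$1 * w$2 * cos (v$2)) *\<^sub>R (axis 2 1 :: real^2)) = h' v"
      by (auto simp: h'_def vector2_eq scaleR_add_right vec_eq_iff forall_2 axis_def)
    ultimately show ?thesis by simp
  qed
  have inj: "inj_on h S"
  proof (rule inj_onI)
    fix v w assume vw: "v \<in> S" "w \<in> S" "h v = h w"
    then have 1: "v$1 = w$1" using nh[of v] nh[of w] by (simp add: S)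
    with vw have "cos (v$2) = cos (w$2)" "sin (v$2) = sin (w$2)"
      by (auto simp: h_def S vec_eq_iff forall_2)
    then obtain n :: int where n: "v$2 = w$2 + 2 * pi * n"
      using sin_cos_eq_iff[of "v$2" "w$2"] by auto
    have "\<bar>2 * pi * n\<bar> < 2 * pi * 1" using n vw by (auto simp: S)
    then have "\<bar>real_of_int n\<bar> < 1" by (simp add: abs_mult)
    then have "n = 0" by simp
    then show "v = w" using n 1 by (simp add: vec_eq_iff forall_2)
  qed
  have det: "\<bar>det (matrix (h' v))\<bar> = v$1" if "v \<in> S" for v
  proof -
    have *: "v$1 * (cos (v$2) * cos (v$2)) + v$1 * (sin (v$2) * sin (v$2)) = v$1"
      unfolding distrib_left[symmetric] by (simp flip: power2_eq_square)
    have "det (matrix (h' v)) = v$1 * (cos (v$2) * cos (v$2)) + v$1 * (sin (v$2) * sin (v$2))"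
      unfolding * by (simp add: det_2 matrix_def h'_def axis_def algebra_simps *)
    then show ?thesis using that * by (simp add: S)
  qed
  have img: "h ` S \<subseteq> cball 0 R" using nh by (auto simp: S)
  \<comment> \<open>The whole first axis is a generous cover of the missed ray t = 0 and of the
    origin. A point off the axis and inside the circle has an angle strictly between 0 and 2 pi, so
    it is in the image.\<close>
  have "cball 0 R - h ` S \<subseteq> sphere 0 R \<union> {x. x$2 = 0}"
  proof (intro subsetI UnCI)
    fix x :: "real^2" assume x: "x \<in> cball 0 R - h ` S" "x \<notin> {x. x$2 = 0}"
    show "x \<in> sphere 0 R"
    proof (rule ccontr)
      assume "x \<notin> sphere 0 R"
      then have nR: "norm x < R" "x$2 \<noteq> 0" using x by auto
      then have n0: "norm x > 0" by auto
      have "(norm x)\<^sup>2 = (x$1)\<^sup>2 + (x$2)\<^sup>2"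
          by (subst power2_norm_eq_inner) (simp add: inner_vec_def sum_2 power2_eq_square)
      then have "(x$1 / norm x)\<^sup>2 + (x$2 / norm x)\<^sup>2 = 1"
        using nR n0 by (simp add: power_divide flip: add_divide_distrib)
      then obtain t where t: "0 \<le> t" "t < 2 * pi" "x$1 / norm x = cos t" "x$2 / norm x = sin t"
        using sincos_total_2pi[of "x$1 / norm x" "x$2 / norm x"] by blast
      have "t \<noteq> 0"
      proof
        assume "t = 0"
        then have "x$2 / norm x = 0" using t(4) by simp
        then show False using nR n0 by simp
      qed
      then have "vector [norm x, t] \<in> S" using nR n0 t(1,2) by (simp add: S)
      moreover have "x$1 = norm x * cos t" "x$2 = norm x * sin t"
        unfolding t(3,4)[symmetric] using n0 by auto
      then have "h (vector [norm x, t]) = x"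
        by (simp only: h_def vec_eq_iff forall_2 vector_2 vector_scaleR_component real_scaleR_def)
      ultimately show False using x by (metis DiffD2 imageI)
    qed
  qed
  then have neg: "negligible (cball 0 R - h ` S)"
    by (rule negligible_subset[rotated])
       (auto intro!: negligible_Un negligible_standard_hyperplane_cart simp: negligible_sphere)
  have fint: "f absolutely_integrable_on cball 0 R"
  proof -
    have "continuous_on (cball 0 R) f"
      unfolding f_def vec_def
      using continuous_on_subset[OF g subset_UNIV] by (intro continuous_on_vec_lambda)
    then have "integrable lborel (\<lambda>x. indicat_real (cball 0 R) x *\<^sub>R f x)"
      by (intro borel_integrable_compact) auto
    then show ?thesis
      unfolding set_integrable_def by (subst integrable_completion) auto
  qed
  have neg': "negligible {x \<in> cball 0 R - h ` S. k x \<noteq> 0}" "negligible {x \<in> h ` S - cball 0 R. k x \<noteq> 0}"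
    for k :: "real^2 \<Rightarrow> 'z::zero"
  proof -
    show "negligible {x \<in> cball 0 R - h ` S. k x \<noteq> 0}" by (rule negligible_subset[OF neg]) auto
    have "{x \<in> h ` S - cball 0 R. k x \<noteq> 0} = {}" using img by blast
    then show "negligible {x \<in> h ` S - cball 0 R. k x \<noteq> 0}" by (simp only: negligible_empty)
  qed
  have "f absolutely_integrable_on (h ` S)"
    using fint absolutely_integrable_spike_set_eq[OF neg'(2,1)[of f]] by simp
  then have "(\<lambda>x. \<bar>det (matrix (h' x))\<bar> *\<^sub>R f (h x)) absolutely_integrable_on S"
    and 1: "integral S (\<lambda>x. \<bar>det (matrix (h' x))\<bar> *\<^sub>R f (h x)) = integral (h ` S) f"
    using has_absolute_integral_change_of_variables[OF _ der inj, of f "integral (h ` S) f"]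
    by (auto simp: S_def)
  then have int: "(\<lambda>x. \<bar>det (matrix (h' x))\<bar> *\<^sub>R f (h x)) integrable_on S"
    by (simp add: absolutely_integrable_on_def)
  have "integral S (\<lambda>v. v$1 * g (h v)) = integral S (\<lambda>x. (\<bar>det (matrix (h' x))\<bar> *\<^sub>R f (h x)) $ 1)"
    by (intro integral_cong) (simp add: det f_def)
  also have "\<dots> = integral S (\<lambda>x. (\<bar>det (matrix (h' x))\<bar> *\<^sub>R f (h x))) $ 1"
    by (intro integral_component_eq_cart int)
  also have "\<dots> = integral (h ` S) f $ 1" by (simp add: 1)
  also have "integral (h ` S) f = integral (cball 0 R) f"
    using neg'[of f] by (intro integral_spike_set)
  also have "integral (cball 0 R) f $ 1 = integral (cball 0 R) g"
    using fint by (subst integral_component_eq_cart[symmetric]) (auto simp: f_def absolutely_integrable_on_def)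
  also have "\<dots> = (LINT x:cball 0 R|lborel. g x)"
    using continuous_on_subset[OF g subset_UNIV]
    by (subst set_borel_integral_eq_integral(2)) (auto intro!: set_integrable_compact)
  finally have "(LINT x:cball 0 R|lborel. g x) = integral S (\<lambda>v. v$1 * g (h v))" ..
  also have "\<dots> = integral (cbox (vector [0, 0]) (vector [R, 2 * pi])) (\<lambda>v. v$1 * g (h v))"
    unfolding S_def by (rule integral_open_interval)
  also have "\<dots> = (LINT v:cbox (vector [0, 0]) (vector [R, 2 * pi])|lborel. v$1 * g (h v))"
    by (subst set_borel_integral_eq_integral(2))
       (auto intro!: set_integrable_compact continuous_intros
          continuous_on_compose2[OF g] continuous_on_subset[OF conth])
  also have "\<dots> = (LINT p|(lborel \<Otimes>\<^sub>M lborel). indicator {0..R} (fst p) * indicator {0..2*pi} (snd p) *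
       (fst p * g (h (vector [fst p, snd p]))))"
    unfolding set_lebesgue_integral_def
    apply (subst lborel_eq_distr_vector2)
    apply (subst integral_distr)
    subgoal by measurable
    subgoal using conth by (intro borel_measurable_scaleR borel_measurable_times) (auto intro!: borel_measurable_continuous_onI continuous_intros continuous_on_compose2[OF g])
    apply (intro Bochner_Integration.integral_cong refl)
    by (auto simp: mem_box_cart forall_2 indicator_def)
  also have "\<dots> = (LINT r|lborel. LINT t|lborel. indicator {0..R} r * indicator {0..2*pi} t *
       (r * g (h (vector [r, t]))))"
  proof (subst lborel_pair.integral_fst'[symmetric], goal_cases)
    case 1
    have "integrable lborel (\<lambda>p. indicator ({0..R} \<times> {0..2*pi}) p *\<^sub>R (fst p * g (h (vector [fst p, snd p]))))"
      by (intro borel_integrable_compact continuous_intros continuous_on_compose2[OF g] continuous_on_compose2[OF conth])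
        (auto intro!: compact_Times)
    then show ?case
      by (simp add: lborel_prod indicator_times)
  qed simp
  also have "\<dots> = (LINT r:{0..R}|lborel. r * (LINT t:{0..2*pi}|lborel. g (r *\<^sub>R vector [cos t, sin t])))"
    by (simp add: set_lebesgue_integral_def h_def mult_ac)
  finally show ?thesis .
qed

section \<open>Angular averages of the kernel\<close>

text \<open>The integrand is the real part of \<open>exp (i \<tau> cos (u - iv))\<close> up to a rotation, and integrating
  a periodic holomorphic function over a horizontal period does not depend on the height.\<close>

lemma circle_integral_hyperbolic_shift:
  fixes z :: "real^2" and \<tau> v :: real
  defines "X \<equiv> \<lambda>t. z \<bullet> vector [cos t, sin t]" and "Y \<equiv> \<lambda>t. z \<bullet> perp (vector [cos t, sin t])"
  shows "integral {0..2*pi} (\<lambda>t. exp (- \<tau> * sinh v * Y t) * cos (\<tau> * cosh v * X t))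
       = integral {0..2*pi} (\<lambda>t. cos (\<tau> * X t))"
proof -
  define F where "F v t = exp (- \<tau> * sinh v * Y t) * cos (\<tau> * cosh v * X t)" for v t
  \<comment> \<open>Extend \<open>X\<close> to complex arguments; then X (t + i v) = cosh v X t + i
    sinh v Y t, and \<open>F v t\<close>, \<open>E v t\<close> are the real and imaginary parts of
    exp (i \<tau> X (t + i v)). The Cauchy-Riemann equation says that the v-derivative
    \<open>F'\<close> of \<open>F\<close> is minus the t-derivative of \<open>E\<close>, so over a
    period its integral vanishes.\<close>
  define E where "E v t = exp (- \<tau> * sinh v * Y t) * sin (\<tau> * cosh v * X t)" for v t
  define F' where "F' v t = - (exp (- \<tau> * sinh v * Y t) *
     (\<tau> * cosh v * Y t * cos (\<tau> * cosh v * X t) + \<tau> * sinh v * X t * sin (\<tau> * cosh v * X t)))" for v t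
  have X: "X t = z$1 * cos t + z$2 * sin t" and Y: "Y t = - z$1 * sin t + z$2 * cos t" for t
    by (simp_all add: X_def Y_def inner_vec_def sum_2 perp_def)
  have dX: "(X has_real_derivative Y t) (at t within A)" and dY: "(Y has_real_derivative - X t) (at t within A)" for t A
    unfolding X[abs_def] Y[abs_def] by (auto intro!: derivative_eq_intros)
  have [continuous_intros]: "continuous_on A (\<lambda>x. X (f x))" "continuous_on A (\<lambda>x. Y (f x))"
    if "continuous_on A f" for A :: "'z::t2_space set" and f
    unfolding X Y using that by (auto intro!: continuous_intros)
  have dF: "((\<lambda>v. integral (cbox 0 (2*pi)) (F v)) has_field_derivative integral (cbox 0 (2*pi)) (F' v)) (at v within UNIV)" for v
  proof (rule leibniz_rule_field_derivative)
    show "((\<lambda>v. F v t) has_real_derivative F' v t) (at v within UNIV)" for v t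
      unfolding F_def F'_def by (auto intro!: derivative_eq_intros simp: algebra_simps)
    show "F v integrable_on cbox 0 (2*pi)" for v
      unfolding F_def by (intro integrable_continuous continuous_intros)
    show "continuous_on (UNIV \<times> cbox 0 (2*pi)) (\<lambda>(v, t). F' v t)"
      unfolding F'_def split_beta by (intro continuous_intros)
  qed auto
  have "integral (cbox 0 (2*pi)) (F' v) = 0" for v
  proof -
    have "((\<lambda>t. - F' v t) has_integral (E v (2*pi) - E v 0)) {0..2*pi}"
    proof (rule fundamental_theorem_of_calculus)
      show "(E v has_vector_derivative - F' v t) (at t within {0..2*pi})" for t
        unfolding E_def F'_def has_real_derivative_iff_has_vector_derivative[symmetric]
        by (auto intro!: derivative_eq_intros dX dY simp: algebra_simps)
    qed simp
    then have "((\<lambda>t. - F' v t) has_integral 0) {0..2*pi}" by (simp add: E_def X Y)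
    from has_integral_neg[OF this] show ?thesis by (simp add: integral_unique)
  qed
  with dF have "((\<lambda>v. integral (cbox 0 (2*pi)) (F v)) has_field_derivative 0) (at v within UNIV)" for v by simp
  then have "integral (cbox 0 (2*pi)) (F v) = integral (cbox 0 (2*pi)) (F 0)"
    by (intro DERIV_isconst_all) auto
  then show ?thesis by (simp add: F_def[abs_def])
qed

text \<open>The height v is chosen with \<tau> sinh v = \<mu>; then cosh^2 - sinh^2 = 1 forces
  \<tau> cosh v = sqrt (\<tau>^2 + \<mu>^2). The exponential weight is thus exactly compensated by
  the change of frequency.\<close>

lemma circle_integral_exp_cos:
  assumes "\<mu> \<noteq> 0" "\<tau> > 0"
  shows "integral {0..2*pi} (\<lambda>t. exp (- \<mu> * (z \<bullet> perp (vector [cos t, sin t]))) * cos ((z \<bullet> vector [cos t, sin t]) * sqrt (\<tau>\<^sup>2 + \<mu>\<^sup>2)))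
       = integral {0..2*pi} (\<lambda>t. cos (\<tau> * (z \<bullet> vector [cos t, sin t])))"
proof -
  define v where "v = arsinh (\<mu> / \<tau>)"
  have 1: "\<tau> * sinh v = \<mu>" using assms by (simp add: v_def)
  have "\<tau> * cosh v = sqrt (\<tau>\<^sup>2) * sqrt (1 + (\<mu>/\<tau>)\<^sup>2)"
    using assms by (simp add: v_def cosh_arsinh_real add.commute)
  also have "\<dots> = sqrt (\<tau>\<^sup>2 + \<mu>\<^sup>2)"
    unfolding real_sqrt_mult[symmetric] using assms by (simp add: field_simps)
  finally have 2: "\<tau> * cosh v = sqrt (\<tau>\<^sup>2 + \<mu>\<^sup>2)" .
  show ?thesis
    using circle_integral_hyperbolic_shift[of \<tau> v z] by (simp add: 1 2 mult.commute)
qed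

lemma continuous_on_integral_param:
  fixes f :: "real \<Rightarrow> real \<Rightarrow> real"
  assumes "continuous_on UNIV (\<lambda>p. f (fst p) (snd p))"
  shows "continuous_on A (\<lambda>x. integral {a..b} (f x))"
proof -
  have "continuous_on (UNIV \<times> cbox a b) (\<lambda>(x, t). f x t)"
    unfolding split_beta by (rule continuous_on_subset[OF assms]) simp
  from integral_continuous_on_param[OF this] show ?thesis
    by (auto intro: continuous_on_subset)
qed

text \<open>With \<open>r = sqrt (\<tau>\<^sup>2 + \<mu>\<^sup>2)\<close> the angular average of the kernel against the exponential weight
  becomes an integral of plane waves over the disc of radius \<open>1 / \<rho>\<close>: this is what makes the
  filtered backprojection a spectral cutoff.\<close>

lemma circle_integral_kernel:
  assumes \<mu>: "\<mu> \<noteq> 0" and \<rho>: "\<rho> > 0"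
  shows "(LINT t:{0..2*pi}|lborel. exp (- \<mu> * (z \<bullet> perp (vector [cos t, sin t]))) * kernel \<mu> \<rho> (z \<bullet> vector [cos t, sin t]))
     = 1 / pi * (LINT \<xi>:cball 0 (1/\<rho>)|lborel. cos (\<xi> \<bullet> z))"
proof -
  define X where "X t = z \<bullet> vector [cos t, sin t]" for t
  define Y where "Y t = z \<bullet> perp (vector [cos t, sin t])" for t
  have [continuous_intros]: "continuous_on A (\<lambda>x. X (f x))" "continuous_on A (\<lambda>x. Y (f x))"
    if "continuous_on A f" for A :: "'z::t2_space set" and f
    unfolding X_def Y_def by (intro continuous_intros that)+
  define b where "b = sqrt (1 / \<rho>\<^sup>2 + \<mu>\<^sup>2)"
  define q where "q r t = r * (exp (- \<mu> * Y t) * cos (X t * r))" for r t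
  \<comment> \<open>The substitution r = g \<tau> maps 0 and 1/\<rho> to the two limits of the
    kernel integral, and g' \<tau> = \<tau> / g \<tau> replaces the factor r by \<tau>. Since \<mu>
    is not 0, \<open>g\<close> stays positive and is differentiable at 0 as well.\<close>
  define g where "g \<tau> = sqrt (\<tau>\<^sup>2 + \<mu>\<^sup>2)" for \<tau>
  have qc [continuous_intros]: "continuous_on A (\<lambda>x. q (h x) (k x))" if "continuous_on A h" "continuous_on A k"
     for A :: "'z::t2_space set" and h k
    unfolding q_def by (intro continuous_intros that)
  have g0: "g 0 = \<bar>\<mu>\<bar>" and gb: "g (1/\<rho>) = b" by (simp_all add: g_def b_def power_divide)
  have gp: "g \<tau> > 0" for \<tau> unfolding g_def using \<mu> by (simp add: add_nonneg_pos)
  have dg: "(g has_field_derivative \<tau> / g \<tau>) (at \<tau> within A)" for \<tau> A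
  proof -
    have "\<tau>\<^sup>2 + \<mu>\<^sup>2 > 0" using \<mu> by (simp add: add_nonneg_pos)
    then show ?thesis unfolding g_def[abs_def] by (auto intro!: derivative_eq_intros simp: field_simps)
  qed
  have cg: "continuous_on UNIV g" unfolding g_def by (intro continuous_intros)
  have le: "\<bar>\<mu>\<bar> \<le> b" unfolding b_def by (rule real_le_rsqrt) auto
  have "(LINT t:{0..2*pi}|lborel. exp (- \<mu> * Y t) * kernel \<mu> \<rho> (X t))
     = (LINT t:{0..2*pi}|lborel. 1 / pi * (LINT r:{\<bar>\<mu>\<bar>..b}|lborel. q r t))"
  proof -
    have "exp (- \<mu> * Y t) * kernel \<mu> \<rho> (X t) = 1/pi * (LINT r:{\<bar>\<mu>\<bar>..b}|lborel. q r t)" for t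
    proof -
      have "(LINT r:{\<bar>\<mu>\<bar>..b}|lborel. q r t) = (LINT r:{\<bar>\<mu>\<bar>..b}|lborel. exp (- \<mu> * Y t) * (r * cos (X t * r)))"
        by (simp add: q_def mult_ac)
      also have "\<dots> = exp (- \<mu> * Y t) * (LINT r:{\<bar>\<mu>\<bar>..b}|lborel. r * cos (X t * r))"
        by (rule set_integral_mult_right)
      finally show ?thesis by (simp add: kernel_def b_def)
    qed
    then show ?thesis by simp
  qed
  also have "\<dots> = 1/pi * (LINT t:{0..2*pi}|lborel. (LINT r:{\<bar>\<mu>\<bar>..b}|lborel. q r t))"
    by (rule set_integral_mult_right)
  also have "(LINT t:{0..2*pi}|lborel. (LINT r:{\<bar>\<mu>\<bar>..b}|lborel. q r t))
     = integral (cbox 0 (2*pi)) (\<lambda>t. integral (cbox \<bar>\<mu>\<bar> b) (\<lambda>r. q r t))"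
  proof -
    have "(LINT r:{\<bar>\<mu>\<bar>..b}|lborel. q r t) = integral (cbox \<bar>\<mu>\<bar> b) (\<lambda>r. q r t)" for t
      by (subst set_borel_integral_eq_integral(2)) (auto intro!: set_integrable_compact continuous_intros)
    then show ?thesis
      by (subst set_borel_integral_eq_integral(2))
        (auto intro!: set_integrable_compact continuous_intros continuous_on_integral_param)
  qed
  also have "\<dots> = integral (cbox \<bar>\<mu>\<bar> b) (\<lambda>r. integral (cbox 0 (2*pi)) (q r))"
    by (rule integral_swap_continuous[symmetric]) (auto intro!: continuous_intros simp: split_beta)
  also have "\<dots> = integral {0..1/\<rho>} (\<lambda>\<tau>. (\<tau> / g \<tau>) *\<^sub>R integral (cbox 0 (2*pi)) (q (g \<tau>)))"
  proof -
    have sub: "g ` {0..1/\<rho>} \<subseteq> {\<bar>\<mu>\<bar>..b}"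
      unfolding g0[symmetric] gb[symmetric] by (auto simp: g_def intro!: power_mono)
    have "continuous_on {\<bar>\<mu>\<bar>..b} (\<lambda>r. integral (cbox 0 (2*pi)) (q r))"
      by (intro integral_continuous_on_param) (auto intro!: continuous_intros simp: split_beta)
    from has_integral_substitution[OF _ _ sub this dg] \<rho> le show ?thesis
      by (simp add: g0 gb integral_unique)
  qed
  also have "\<dots> = integral {0..1/\<rho>} (\<lambda>\<tau>. \<tau> * integral {0..2*pi} (\<lambda>t. cos (\<tau> * X t)))"
  proof (rule integral_cong)
    fix \<tau> assume "\<tau> \<in> {0..1/\<rho>}"
    show "(\<tau> / g \<tau>) *\<^sub>R integral (cbox 0 (2*pi)) (q (g \<tau>)) = \<tau> * integral {0..2*pi} (\<lambda>t. cos (\<tau> * X t))"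
    \<comment> \<open>At \<tau> = 0 no height v with \<tau> sinh v = \<mu> exists, but there both
      sides carry the factor 0.\<close>
    proof (cases "\<tau> = 0")
      case False
      then have "\<tau> > 0" using \<open>\<tau> \<in> _\<close> by simp
      from circle_integral_exp_cos[OF \<mu> this, of z]
      have "integral {0..2*pi} (\<lambda>t. exp (- \<mu> * Y t) * cos (X t * g \<tau>)) = integral {0..2*pi} (\<lambda>t. cos (\<tau> * X t))"
        by (simp only: g_def X_def Y_def)
      then have "integral (cbox 0 (2*pi)) (q (g \<tau>)) = g \<tau> * integral {0..2*pi} (\<lambda>t. cos (\<tau> * X t))"
        by (simp add: q_def[abs_def])
      then show ?thesis using gp[of \<tau>] by simp
    qed simp
  qed
  also have "\<dots> = (LINT \<tau>:{0..1/\<rho>}|lborel. \<tau> * (LINT t:{0..2*pi}|lborel. cos ((\<tau> *\<^sub>R vector [cos t, sin t]) \<bullet> z)))"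
  proof -
    have "(LINT t:{0..2*pi}|lborel. cos ((\<tau> *\<^sub>R vector [cos t, sin t]) \<bullet> z)) = integral (cbox 0 (2*pi)) (\<lambda>t. cos (\<tau> * X t))" for \<tau>
      by (subst set_borel_integral_eq_integral(2)) (auto intro!: set_integrable_compact continuous_intros simp: X_def inner_commute)
    then show ?thesis
      by (subst set_borel_integral_eq_integral(2))
        (auto intro!: set_integrable_compact continuous_intros continuous_on_integral_param)
  qed
  also have "\<dots> = (LINT \<xi>:cball 0 (1/\<rho>)|lborel. cos (\<xi> \<bullet> z))"
    using \<rho> by (intro integral_cball_polar[symmetric] continuous_intros) auto
  finally show ?thesis by (simp add: X_def Y_def)
qed

section \<open>Decay of the kernel\<close>

text \<open>Integration by parts: r sin (s r) / s + cos (s r) / s^2 is an antiderivative of r cos (s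
  r). The closed form displays the decay in s that the integral hides.\<close>

lemma kernel_eq:
  fixes \<mu> \<rho> s :: real
  assumes "s \<noteq> 0"
  defines "b \<equiv> sqrt (1 / \<rho>\<^sup>2 + \<mu>\<^sup>2)"
  shows "kernel \<mu> \<rho> s = 1 / pi * ((b * sin (s * b) / s + cos (s * b) / s\<^sup>2) - (\<bar>\<mu>\<bar> * sin (s * \<bar>\<mu>\<bar>) / s + cos (s * \<bar>\<mu>\<bar>) / s\<^sup>2))"
proof -
  have le: "\<bar>\<mu>\<bar> \<le> b" unfolding b_def by (rule real_le_rsqrt) auto
  have "((\<lambda>r. r * cos (s * r)) has_integral ((b * sin (s * b) / s + cos (s * b) / s\<^sup>2) - (\<bar>\<mu>\<bar> * sin (s * \<bar>\<mu>\<bar>) / s + cos (s * \<bar>\<mu>\<bar>) / s\<^sup>2))) {\<bar>\<mu>\<bar>..b}"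
    using le assms(1)
    by (intro fundamental_theorem_of_calculus)
       (auto intro!: derivative_eq_intros simp: has_real_derivative_iff_has_vector_derivative[symmetric] field_simps power2_eq_square)
  moreover have "(LINT r:{\<bar>\<mu>\<bar>..b}|lborel. r * cos (s * r)) = integral {\<bar>\<mu>\<bar>..b} (\<lambda>r. r * cos (s * r))"
    by (intro set_borel_integral_eq_integral(2) borel_integrable_atLeastAtMost' continuous_intros)
  ultimately show ?thesis
    unfolding kernel_def b_def[symmetric] by (simp add: integral_unique)
qed

text \<open>The integrand is at most \<open>b\<close> on an interval of length at most
  \<open>b\<close>. This bound is the good one for |s| below 1/b.\<close>

lemma abs_kernel_le:
  fixes \<mu> \<rho> s :: real
  defines "b \<equiv> sqrt (1 / \<rho>\<^sup>2 + \<mu>\<^sup>2)"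
  shows "\<bar>kernel \<mu> \<rho> s\<bar> \<le> b\<^sup>2"
proof -
  have le: "\<bar>\<mu>\<bar> \<le> b" unfolding b_def by (rule real_le_rsqrt) auto
  then have b0: "b \<ge> 0" by simp
  have 1: "(LINT r:{\<bar>\<mu>\<bar>..b}|lborel. r * cos (s * r)) = integral {\<bar>\<mu>\<bar>..b} (\<lambda>r. r * cos (s * r))"
    by (intro set_borel_integral_eq_integral(2) borel_integrable_atLeastAtMost' continuous_intros)
  have "\<bar>integral {\<bar>\<mu>\<bar>..b} (\<lambda>r. r * cos (s * r))\<bar> \<le> b * (b - \<bar>\<mu>\<bar>)"
  proof -
    have "norm (integral {\<bar>\<mu>\<bar>..b} (\<lambda>r. r * cos (s * r))) \<le> b * (b - \<bar>\<mu>\<bar>)"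
    proof (rule integral_bound[OF le])
      show "continuous_on {\<bar>\<mu>\<bar>..b} (\<lambda>r. r * cos (s * r))" by (intro continuous_intros)
      fix r assume r: "r \<in> {\<bar>\<mu>\<bar>..b}"
      then have "\<bar>r\<bar> * \<bar>cos (s * r)\<bar> \<le> b * 1" by (intro mult_mono) auto
      then show "norm (r * cos (s * r)) \<le> b" by (simp add: abs_mult)
    qed
    then show ?thesis by simp
  qed
  also have "\<dots> \<le> b * b" using b0 by (intro mult_left_mono) auto
  finally have "\<bar>kernel \<mu> \<rho> s\<bar> \<le> 1 / pi * (b * b)"
    unfolding kernel_def b_def[symmetric] 1 by (simp add: abs_mult divide_right_mono)
  also have "\<dots> \<le> 1 * (b * b)" using pi_gt3 by (intro mult_right_mono) auto
  finally show ?thesis by (simp add: power2_eq_square)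
qed

text \<open>Three boundary contributions, each at most b / |s|, and the factor 1/pi absorbs the
  count because 3 < pi.\<close>

lemma abs_kernel_le_divide:
  fixes \<mu> \<rho> s :: real
  assumes "s \<noteq> 0"
  defines "b \<equiv> sqrt (1 / \<rho>\<^sup>2 + \<mu>\<^sup>2)"
  shows "\<bar>kernel \<mu> \<rho> s\<bar> \<le> b / \<bar>s\<bar>"
proof -
  have le: "\<bar>\<mu>\<bar> \<le> b" unfolding b_def by (rule real_le_rsqrt) auto
  have 1: "\<bar>x * sin y / s\<bar> \<le> b / \<bar>s\<bar>" if "\<bar>x\<bar> \<le> b" for x y
  proof -
    have "\<bar>x\<bar> * \<bar>sin y\<bar> \<le> b * 1" using that by (intro mult_mono) auto
    then show ?thesis by (simp add: abs_mult divide_right_mono)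
  qed
  \<comment> \<open>Separately the two cosine terms are as large as 1/s^2, which is too much near 0.
    Their difference is a product of sines and gains a factor |s| (b - \<bar>\<mu>\<bar>).\<close>
  have 2: "\<bar>cos (s * b) / s\<^sup>2 - cos (s * \<bar>\<mu>\<bar>) / s\<^sup>2\<bar> \<le> b / \<bar>s\<bar>"
  proof -
    have "\<bar>cos (s * b) - cos (s * \<bar>\<mu>\<bar>)\<bar> = 2 * \<bar>sin ((s * b + s * \<bar>\<mu>\<bar>) / 2)\<bar> * \<bar>sin ((s * \<bar>\<mu>\<bar> - s * b) / 2)\<bar>"
      by (simp add: cos_diff_cos abs_mult)
    also have "\<dots> \<le> 2 * 1 * \<bar>(s * \<bar>\<mu>\<bar> - s * b) / 2\<bar>"
      by (intro mult_mono abs_sin_x_le_abs_x) auto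
    also have "\<dots> = \<bar>s\<bar> * (b - \<bar>\<mu>\<bar>)"
      using le by (simp add: right_diff_distrib[symmetric] abs_mult)
    also have "\<dots> \<le> \<bar>s\<bar> * b" by (intro mult_left_mono) auto
    finally have "\<bar>cos (s * b) - cos (s * \<bar>\<mu>\<bar>)\<bar> / s\<^sup>2 \<le> \<bar>s\<bar> * b / s\<^sup>2"
      by (rule divide_right_mono) auto
    also have "\<bar>s\<bar> * b / s\<^sup>2 = b / \<bar>s\<bar>"
      using assms(1) by (simp add: field_simps power2_eq_square)
    finally show ?thesis by (simp add: diff_divide_distrib[symmetric])
  qed
  have K: "kernel \<mu> \<rho> s = 1 / pi * (b * sin (s * b) / s - \<bar>\<mu>\<bar> * sin (s * \<bar>\<mu>\<bar>) / s + (cos (s * b) / s\<^sup>2 - cos (s * \<bar>\<mu>\<bar>) / s\<^sup>2))"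
    unfolding kernel_eq[OF assms(1)] b_def[symmetric] by (rule arg_cong[where f="\<lambda>x. 1 / pi * x"]) simp
  have "\<bar>kernel \<mu> \<rho> s\<bar> = \<bar>1 / pi\<bar> * \<bar>b * sin (s * b) / s - \<bar>\<mu>\<bar> * sin (s * \<bar>\<mu>\<bar>) / s + (cos (s * b) / s\<^sup>2 - cos (s * \<bar>\<mu>\<bar>) / s\<^sup>2)\<bar>"
    unfolding K by (rule abs_mult)
  also have "\<bar>1 / pi\<bar> = 1 / pi" by simp
  also have "1 / pi * \<bar>b * sin (s * b) / s - \<bar>\<mu>\<bar> * sin (s * \<bar>\<mu>\<bar>) / s + (cos (s * b) / s\<^sup>2 - cos (s * \<bar>\<mu>\<bar>) / s\<^sup>2)\<bar> \<le> 1 / pi * (b / \<bar>s\<bar> + b / \<bar>s\<bar> + b / \<bar>s\<bar>)"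
  proof (intro mult_left_mono)
    have "\<bar>b\<bar> \<le> b" "\<bar>\<bar>\<mu>\<bar>\<bar> \<le> b" using le by auto
    note a = 1[OF this(1), of "s * b"] 1[OF this(2), of "s * \<bar>\<mu>\<bar>"] 2
    have "\<bar>x - y + z\<bar> \<le> B + B + B" if "\<bar>x\<bar> \<le> B" "\<bar>y\<bar> \<le> B" "\<bar>z\<bar> \<le> B" for x y z B :: real
      using that by linarith
    from this[OF a] show "\<bar>b * sin (s * b) / s - \<bar>\<mu>\<bar> * sin (s * \<bar>\<mu>\<bar>) / s + (cos (s * b) / s\<^sup>2 - cos (s * \<bar>\<mu>\<bar>) / s\<^sup>2)\<bar>
      \<le> b / \<bar>s\<bar> + b / \<bar>s\<bar> + b / \<bar>s\<bar>" .
  qed simp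
  also have "\<dots> = (3 / pi) * (b / \<bar>s\<bar>)" by simp
  also have "\<dots> \<le> 1 * (b / \<bar>s\<bar>)"
    using pi_gt3 le by (intro mult_right_mono) auto
  finally show ?thesis by simp
qed

lemma continuous_on_kernel: "continuous_on UNIV (kernel \<mu> \<rho>)"
proof -
  define b where "b = sqrt (1 / \<rho>\<^sup>2 + \<mu>\<^sup>2)"
  have "(LINT r:{\<bar>\<mu>\<bar>..b}|lborel. r * cos (s * r)) = integral (cbox \<bar>\<mu>\<bar> b) (\<lambda>r. r * cos (s * r))" for s
    unfolding cbox_interval by (intro set_borel_integral_eq_integral(2) borel_integrable_atLeastAtMost' continuous_intros)
  moreover have "continuous_on UNIV (\<lambda>s. integral (cbox \<bar>\<mu>\<bar> b) (\<lambda>r. r * cos (s * r)))"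
    by (rule integral_continuous_on_param) (auto intro!: continuous_intros simp: split_beta)
  ultimately show ?thesis
    unfolding kernel_def[abs_def] b_def by (auto intro!: continuous_intros)
qed

lemma measurable_kernel [measurable]: "kernel \<mu> \<rho> \<in> borel_measurable borel"
  by (intro borel_measurable_continuous_onI continuous_on_kernel)

lemma nn_integral_powr_tail:
  fixes e :: real
  assumes "e < -1" "a > 0"
  shows "(\<integral>\<^sup>+x\<in>{a..}. ennreal (x powr e) \<partial>lborel) = ennreal (- (a powr (e + 1)) / (e + 1))"
  using has_integral_powr_to_inf[OF assms]
  by (intro nn_integral_has_integral_lebesgue') auto

lemma nn_integral_even:
  fixes f :: "real \<Rightarrow> ennreal"
  assumes [measurable]: "f \<in> borel_measurable borel" and even: "\<And>x. f (- x) = f x"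
  shows "(\<integral>\<^sup>+x. f x \<partial>lborel) \<le> 2 * (\<integral>\<^sup>+x\<in>{0..}. f x \<partial>lborel)"
proof -
  have "(\<integral>\<^sup>+x. f x \<partial>lborel) \<le> (\<integral>\<^sup>+x. f x * indicator {0..} x + f (- x) * indicator {0..} (- x) \<partial>lborel)"
    by (intro nn_integral_mono) (auto simp: indicator_def even)
  also have "\<dots> = (\<integral>\<^sup>+x\<in>{0..}. f x \<partial>lborel) + (\<integral>\<^sup>+x. f (- x) * indicator {0..} (- x) \<partial>lborel)"
    by (rule nn_integral_add) auto
  also have "(\<integral>\<^sup>+x. f (- x) * indicator {0..} (- x) \<partial>lborel) = (\<integral>\<^sup>+x\<in>{0..}. f x \<partial>lborel)"
    using nn_integral_real_affine[of "\<lambda>x. f x * indicator {0..} x" "-1" 0] by simp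
  finally show ?thesis by (simp add: mult_2)
qed

text \<open>The two kernel bounds cross at |u| = 1/b. On the positive half-line the constant b^4 on
  [0, 1/b] and the tail b^2 / u^2 contribute b^3 each; evenness doubles this to 4 b^3.\<close>

lemma nn_integral_kernel_sq_le:
  fixes \<mu> \<rho> :: real
  assumes "\<rho> > 0"
  defines "b \<equiv> sqrt (1 / \<rho>\<^sup>2 + \<mu>\<^sup>2)"
  shows "(\<integral>\<^sup>+u. ennreal ((kernel \<mu> \<rho> u)\<^sup>2) \<partial>lborel) \<le> ennreal (4 * b ^ 3)"
proof -
  have b: "b > 0" unfolding b_def using assms by (simp add: add_pos_nonneg)
  define h where "h u = (if \<bar>u\<bar> \<le> 1 / b then b ^ 4 else b\<^sup>2 * \<bar>u\<bar> powr (-2))" for u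
  have [measurable]: "h \<in> borel_measurable borel" unfolding h_def by measurable
  have "(\<integral>\<^sup>+u. ennreal ((kernel \<mu> \<rho> u)\<^sup>2) \<partial>lborel) \<le> (\<integral>\<^sup>+u. ennreal (h u) \<partial>lborel)"
  proof (intro nn_integral_mono ennreal_leI)
    fix u
    have "\<bar>kernel \<mu> \<rho> u\<bar>\<^sup>2 \<le> (b\<^sup>2)\<^sup>2"
      using abs_kernel_le[of \<mu> \<rho> u] by (intro power_mono) (auto simp: b_def)
    moreover have "\<bar>kernel \<mu> \<rho> u\<bar>\<^sup>2 \<le> (b / \<bar>u\<bar>)\<^sup>2" if "u \<noteq> 0"
      using abs_kernel_le_divide[OF that, of \<mu> \<rho>] by (intro power_mono) (auto simp: b_def)
    moreover have "(b / \<bar>u\<bar>)\<^sup>2 = b\<^sup>2 * \<bar>u\<bar> powr (-2)" if "u \<noteq> 0"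
      using that by (simp add: powr_minus powr_numeral power_mult_distrib power_inverse divide_inverse)
    moreover have "u \<noteq> 0" if "\<not> \<bar>u\<bar> \<le> 1 / b" using that b by auto
    ultimately show "(kernel \<mu> \<rho> u)\<^sup>2 \<le> h u"
      unfolding h_def by (auto simp flip: power_mult)
  qed
  also have "\<dots> \<le> 2 * (\<integral>\<^sup>+u\<in>{0..}. ennreal (h u) \<partial>lborel)"
    by (rule nn_integral_even) (auto simp: h_def)
  also have "(\<integral>\<^sup>+u\<in>{0..}. ennreal (h u) \<partial>lborel)
    \<le> (\<integral>\<^sup>+u. ennreal (b ^ 4) * indicator {0..1/b} u + ennreal (b\<^sup>2) * (ennreal (u powr (-2)) * indicator {1/b..} u) \<partial>lborel)"
    by (intro nn_integral_mono) (auto simp: h_def indicator_def ennreal_mult)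
  also have "\<dots> = ennreal (b ^ 4) * ennreal (1/b) + ennreal (b\<^sup>2) * (\<integral>\<^sup>+u\<in>{1/b..}. ennreal (u powr (-2)) \<partial>lborel)"
    using b by (subst nn_integral_add) (auto simp: nn_integral_cmult)
  also have "(\<integral>\<^sup>+u\<in>{1/b..}. ennreal (u powr (-2)) \<partial>lborel) = ennreal b"
    using b by (subst nn_integral_powr_tail) (auto simp: powr_minus)
  also have "ennreal (b ^ 4) * ennreal (1/b) + ennreal (b\<^sup>2) * ennreal b = ennreal (2 * b ^ 3)"
    using b by (simp add: ennreal_mult[symmetric] ennreal_plus[symmetric] del: ennreal_plus) (simp add: power_def numeral_eq_Suc)
  finally show ?thesis
    using b by (simp add: mult_left_mono ennreal_mult[symmetric] flip: ennreal_numeral)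
qed

section \<open>Gaussian weights and Fourier inversion\<close>

lemma
  fixes f g :: "real \<Rightarrow> 'a::{real_normed_field, banach, second_countable_topology}"
  assumes f: "integrable lborel f" and g: "integrable lborel g"
  shows integrable_pair_mult: "integrable (lborel \<Otimes>\<^sub>M lborel) (\<lambda>p. f (fst p) * g (snd p))"
    and integral_pair_mult: "(\<integral>p. f (fst p) * g (snd p) \<partial>(lborel \<Otimes>\<^sub>M lborel)) = (\<integral>x. f x \<partial>lborel) * (\<integral>x. g x \<partial>lborel)"
proof -
  have [measurable]: "f \<in> borel_measurable borel" "g \<in> borel_measurable borel"
    using f g by (auto dest: borel_measurable_integrable)
  show int: "integrable (lborel \<Otimes>\<^sub>M lborel) (\<lambda>p. f (fst p) * g (snd p))"
    by (rule lborel_pair.Fubini_integrable) (use f g in \<open>auto simp: norm_mult\<close>)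
  show "(\<integral>p. f (fst p) * g (snd p) \<partial>(lborel \<Otimes>\<^sub>M lborel)) = (\<integral>x. f x \<partial>lborel) * (\<integral>x. g x \<partial>lborel)"
    using f g by (subst lborel_pair.integral_fst'[OF int, symmetric]) simp
qed

text \<open>Of unit variance and not normalized: its Fourier transform is then \<open>2 * pi\<close>
  times the function itself, so the same symbol serves on both sides of the transform.\<close>

definition gauss :: "real^2 \<Rightarrow> real" where
  "gauss x = exp (- (norm x)\<^sup>2 / 2)"

lemma gauss_nonneg [simp]: "gauss x \<ge> 0" and gauss_le_1: "gauss x \<le> 1"
  by (auto simp: gauss_def)

lemma gauss_minus [simp]: "gauss (- x) = gauss x"
  by (simp add: gauss_def)

lemma gauss_minus_commute: "gauss (x - y) = gauss (y - x)"
  by (simp add: gauss_def norm_minus_commute)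

lemma continuous_on_gauss [continuous_intros]: "continuous_on A f \<Longrightarrow> continuous_on A (\<lambda>x. gauss (f x))"
  unfolding gauss_def by (intro continuous_intros) auto

lemma measurable_gauss [measurable]: "gauss \<in> borel_measurable borel"
  by (intro borel_measurable_continuous_onI continuous_intros)

lemma norm2_sq: "(norm (x :: real^2))\<^sup>2 = (x$1)\<^sup>2 + (x$2)\<^sup>2"
  by (subst power2_norm_eq_inner) (simp add: inner_vec_def sum_2 power2_eq_square)

lemma gauss_eq: "gauss x = exp (- (x$1)\<^sup>2 / 2) * exp (- (x$2)\<^sup>2 / 2)"
  by (simp add: gauss_def norm2_sq add_divide_distrib flip: exp_add)

text \<open>Read off from the characteristic function of the standard normal law, whose density is
  this Gaussian divided by sqrt (2 pi).\<close>

lemma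
  shows integrable_iexp_gauss_real: "integrable lborel (\<lambda>a. iexp (t * a) * complex_of_real (exp (- a\<^sup>2 / 2)))"
    and integral_iexp_gauss_real: "(\<integral>a. iexp (t * a) * complex_of_real (exp (- a\<^sup>2 / 2)) \<partial>lborel)
      = complex_of_real (sqrt (2 * pi) * exp (- t\<^sup>2 / 2))"
proof -
  have eq: "iexp (t * a) * complex_of_real (exp (- a\<^sup>2 / 2)) = sqrt (2 * pi) *\<^sub>R (std_normal_density a *\<^sub>R iexp (t * a))" for a
    by (simp add: std_normal_density_def scaleR_conv_of_real)
  interpret real_distribution std_normal_distribution by (rule real_dist_normal_dist)
  have "integrable std_normal_distribution (\<lambda>a. iexp (t * a))" by (rule integrable_iexp) auto
  then have 1: "integrable lborel (\<lambda>a. std_normal_density a *\<^sub>R iexp (t * a))"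
    by (subst (asm) integrable_density) auto
  then show "integrable lborel (\<lambda>a. iexp (t * a) * complex_of_real (exp (- a\<^sup>2 / 2)))"
    unfolding eq by (rule integrable_scaleR_right)
  have "(\<integral>a. std_normal_density a *\<^sub>R iexp (t * a) \<partial>lborel) = complex_of_real (exp (- t\<^sup>2 / 2))"
    using fun_cong[OF char_std_normal_distribution, of t] unfolding char_def
    by (subst (asm) integral_density) auto
  then show "(\<integral>a. iexp (t * a) * complex_of_real (exp (- a\<^sup>2 / 2)) \<partial>lborel)
      = complex_of_real (sqrt (2 * pi) * exp (- t\<^sup>2 / 2))"
    unfolding eq by (simp add: scaleR_conv_of_real)
qed

text \<open>Both the plane wave and the Gaussian factor over the coordinates, so the claim is the
  product of two one-dimensional ones.\<close>

lemma
  shows integrable_iexp_gauss: "integrable lborel (\<lambda>x. iexp (\<xi> \<bullet> x) * complex_of_real (gauss x))"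
    and integral_iexp_gauss: "(\<integral>x. iexp (\<xi> \<bullet> x) * complex_of_real (gauss x) \<partial>lborel) = complex_of_real (2 * pi * gauss \<xi>)"
proof -
  let ?f = "\<lambda>t a. iexp (t * a) * complex_of_real (exp (- a\<^sup>2 / 2))"
  have [measurable]: "(\<lambda>x. iexp (\<xi> \<bullet> x) * complex_of_real (gauss x)) \<in> borel_measurable borel"
    by measurable
  have eq: "iexp (\<xi> \<bullet> vector [a, b]) * complex_of_real (gauss (vector [a, b])) = ?f (\<xi>$1) a * ?f (\<xi>$2) b" for a b
  proof -
    have "iexp (\<xi> \<bullet> vector [a, b]) = iexp (\<xi>$1 * a) * iexp (\<xi>$2 * b)"
      by (simp add: inner_vec_def sum_2 distrib_left exp_add)
    then show ?thesis by (simp add: gauss_eq)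
  qed
  show "integrable lborel (\<lambda>x. iexp (\<xi> \<bullet> x) * complex_of_real (gauss x))"
    apply (subst lborel_eq_distr_vector2)
    apply (subst integrable_distr_eq)
      apply measurable
    unfolding eq by (intro integrable_pair_mult integrable_iexp_gauss_real)
  show "(\<integral>x. iexp (\<xi> \<bullet> x) * complex_of_real (gauss x) \<partial>lborel) = complex_of_real (2 * pi * gauss \<xi>)"
    apply (subst lborel_eq_distr_vector2)
    apply (subst integral_distr)
      apply measurable
    unfolding eq
    apply (subst integral_pair_mult)
    apply (intro integrable_iexp_gauss_real)+
    unfolding integral_iexp_gauss_real of_real_mult[symmetric] of_real_eq_iff
    by (simp add: gauss_eq)
qed

lemma integrable_gauss [simp]: "integrable lborel gauss"
  using integrable_norm[OF integrable_iexp_gauss[of 0]] by (simp add: gauss_nonneg)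

lemma integral_gauss: "(\<integral>x. gauss x \<partial>lborel) = 2 * pi"
proof -
  have "complex_of_real (\<integral>x. gauss x \<partial>lborel) = complex_of_real (2 * pi)"
    using integral_iexp_gauss[of 0] by (simp add: gauss_def)
  then show ?thesis unfolding of_real_eq_iff .
qed

lemma lborel_integral_affine:
  fixes g :: "'a::euclidean_space \<Rightarrow> 'b::{banach, second_countable_topology}"
  assumes [measurable]: "g \<in> borel_measurable borel" and c: "c \<noteq> 0"
  shows "(\<integral>x. g x \<partial>lborel) = \<bar>c\<bar> ^ DIM('a) *\<^sub>R (\<integral>x. g (t + c *\<^sub>R x) \<partial>lborel)"
  by (subst lborel_affine[OF c, of t]) (simp add: integral_density integral_distr)

lemma lborel_nn_integral_shift:
  fixes g :: "'a::euclidean_space \<Rightarrow> ennreal"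
  assumes [measurable]: "g \<in> borel_measurable borel"
  shows "(\<integral>\<^sup>+x. g (t + x) \<partial>lborel) = (\<integral>\<^sup>+x. g x \<partial>lborel)"
  by (subst (2) lborel_distr_plus[of t, symmetric], subst nn_integral_distr) auto

lemma nn_integral_gauss_shift: "(\<integral>\<^sup>+x. ennreal (gauss (x - y)) \<partial>lborel) = ennreal (2 * pi)"
proof -
  have "(\<integral>\<^sup>+x. ennreal (gauss (x - y)) \<partial>lborel) = (\<integral>\<^sup>+x. ennreal (gauss x) \<partial>lborel)"
    using lborel_nn_integral_shift[of "\<lambda>x. ennreal (gauss x)" "- y"] by simp
  also have "\<dots> = ennreal (2 * pi)"
    by (simp add: nn_integral_eq_integral integral_gauss)
  finally show ?thesis .
qed

section \<open>A Bessel inequality on the unit ball\<close>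

lemma measurable_cnj [measurable]: "cnj \<in> borel_measurable borel"
  by (intro borel_measurable_continuous_onI continuous_intros)

text \<open>For a function that is not integrable the Bochner integral is 0 by convention, so the
  bound holds there too.\<close>

lemma norm_integral_le_nn_integral:
  fixes f :: "'a \<Rightarrow> 'b::{banach, second_countable_topology}"
  shows "ennreal (norm (\<integral>x. f x \<partial>M)) \<le> (\<integral>\<^sup>+x. ennreal (norm (f x)) \<partial>M)"
  by (cases "integrable M f") (auto simp: integral_norm_bound_ennreal not_integrable_integral_eq)

lemma integrable_iexp_mult:
  fixes g :: "real^2 \<Rightarrow> complex"
  assumes "integrable lborel g" and [measurable]: "h \<in> borel_measurable borel"
  shows "integrable lborel (\<lambda>\<xi>. g \<xi> * iexp (h \<xi>))"
proof (rule Bochner_Integration.integrable_bound[OF assms(1)])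
  show "(\<lambda>\<xi>. g \<xi> * iexp (h \<xi>)) \<in> borel_measurable lborel" using assms(1) by measurable
qed (auto simp: norm_mult)

text \<open>On the unit ball 1 is at most exp (1/2) times \<open>gauss\<close>, so it suffices to
  bound the integral of |G|^2 against \<open>gauss\<close>. Expanding the square and integrating
  over x first leaves 2 pi times the quadratic form with kernel gauss (\<xi> - \<eta>), whose row
  mass is 2 pi. These are the factors of the constant.\<close>

lemma Bessel_ball:
  fixes g :: "real^2 \<Rightarrow> complex"
  assumes g: "integrable lborel g"
  shows "(\<integral>\<^sup>+x\<in>cball 0 1. ennreal ((cmod (\<integral>\<xi>. g \<xi> * iexp (\<xi> \<bullet> x) \<partial>lborel))\<^sup>2) \<partial>lborel)
      \<le> ennreal (exp (1/2) * (2 * pi)\<^sup>2) * (\<integral>\<^sup>+\<xi>. ennreal ((cmod (g \<xi>))\<^sup>2) \<partial>lborel)"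
proof -
  have [measurable]: "g \<in> borel_measurable borel" using g by auto
  define G where "G x = (\<integral>\<xi>. g \<xi> * iexp (\<xi> \<bullet> x) \<partial>lborel)" for x
  have [measurable]: "G \<in> borel_measurable borel" unfolding G_def by measurable
  define B where "B = (\<integral>\<xi>. norm (g \<xi>) \<partial>lborel)"
  have Gle: "norm (G x) \<le> B" for x
  proof -
    have "norm (G x) \<le> (\<integral>\<xi>. norm (g \<xi> * iexp (\<xi> \<bullet> x)) \<partial>lborel)"
      unfolding G_def by (rule integral_norm_bound)
    also have "\<dots> = B" by (simp add: B_def norm_mult)
    finally show ?thesis .
  qed
  then have B0: "B \<ge> 0" using norm_ge_zero order_trans by blast
  define N where "N = (\<integral>\<^sup>+\<xi>. ennreal ((cmod (g \<xi>))\<^sup>2) \<partial>lborel)"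
  have igg: "integrable lborel (\<lambda>x. complex_of_real (gauss x))" by simp
  have int1: "integrable (lborel \<Otimes>\<^sub>M lborel) (\<lambda>(x, \<eta>). iexp (\<xi> \<bullet> x) * cnj (g \<eta> * iexp (\<eta> \<bullet> x)) * complex_of_real (gauss x))" for \<xi>
  proof (rule lborel_pair.Fubini_integrable)
    have "integrable lborel (\<lambda>\<eta>. iexp (\<xi> \<bullet> x) * cnj (g \<eta> * iexp (\<eta> \<bullet> x)) * complex_of_real (gauss x))" for x
      by (intro integrable_mult_left integrable_mult_right integrable_cnj integrable_iexp_mult g) measurable
    then show "AE x in lborel. integrable lborel (\<lambda>\<eta>. (\<lambda>(x, \<eta>). iexp (\<xi> \<bullet> x) * cnj (g \<eta> * iexp (\<eta> \<bullet> x)) * complex_of_real (gauss x)) (x, \<eta>))"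
      by simp
    show "integrable lborel (\<lambda>x. \<integral>\<eta>. norm ((\<lambda>(x, \<eta>). iexp (\<xi> \<bullet> x) * cnj (g \<eta> * iexp (\<eta> \<bullet> x)) * complex_of_real (gauss x)) (x, \<eta>)) \<partial>lborel)"
      by (simp add: norm_mult)
  qed measurable
  \<comment> \<open>The x-integral sees two plane waves, that is one of frequency \<xi> - \<eta>,
    and the transform of the Gaussian turns it into the convolution kernel of the quadratic
    form.\<close>
  have inner: "(\<integral>x. iexp (\<xi> \<bullet> x) * cnj (G x) * complex_of_real (gauss x) \<partial>lborel)
      = complex_of_real (2 * pi) * (\<integral>\<eta>. cnj (g \<eta>) * complex_of_real (gauss (\<xi> - \<eta>)) \<partial>lborel)" for \<xi>
  proof -
    have "(\<integral>x. iexp (\<xi> \<bullet> x) * cnj (G x) * complex_of_real (gauss x) \<partial>lborel)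
       = (\<integral>x. \<integral>\<eta>. iexp (\<xi> \<bullet> x) * cnj (g \<eta> * iexp (\<eta> \<bullet> x)) * complex_of_real (gauss x) \<partial>lborel \<partial>lborel)"
      unfolding G_def Bochner_Integration.integral_cnj[symmetric]
      by (simp only: integral_mult_right_zero integral_mult_left_zero)
    also have "\<dots> = (\<integral>\<eta>. \<integral>x. iexp (\<xi> \<bullet> x) * cnj (g \<eta> * iexp (\<eta> \<bullet> x)) * complex_of_real (gauss x) \<partial>lborel \<partial>lborel)"
      by (rule lborel_pair.Fubini_integral[OF int1, symmetric])
    also have "\<dots> = (\<integral>\<eta>. cnj (g \<eta>) * complex_of_real (2 * pi * gauss (\<xi> - \<eta>)) \<partial>lborel)"
    proof (rule Bochner_Integration.integral_cong[OF refl])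
      fix \<eta>
      have "(\<integral>x. iexp (\<xi> \<bullet> x) * cnj (g \<eta> * iexp (\<eta> \<bullet> x)) * complex_of_real (gauss x) \<partial>lborel)
        = (\<integral>x. cnj (g \<eta>) * (iexp ((\<xi> - \<eta>) \<bullet> x) * complex_of_real (gauss x)) \<partial>lborel)"
        by (intro Bochner_Integration.integral_cong refl)
           (simp add: exp_cnj inner_diff_left algebra_simps exp_diff exp_minus divide_inverse)
      also have "\<dots> = cnj (g \<eta>) * complex_of_real (2 * pi * gauss (\<xi> - \<eta>))"
        by (simp only: integral_mult_right_zero integral_iexp_gauss)
      finally show "(\<integral>x. iexp (\<xi> \<bullet> x) * cnj (g \<eta> * iexp (\<eta> \<bullet> x)) * complex_of_real (gauss x) \<partial>lborel) = \<dots>" .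
    qed
    also have "\<dots> = complex_of_real (2 * pi) * (\<integral>\<eta>. cnj (g \<eta>) * complex_of_real (gauss (\<xi> - \<eta>)) \<partial>lborel)"
    proof -
      have "(\<integral>\<eta>. cnj (g \<eta>) * complex_of_real (2 * pi * gauss (\<xi> - \<eta>)) \<partial>lborel)
         = (\<integral>\<eta>. complex_of_real (2 * pi) * (cnj (g \<eta>) * complex_of_real (gauss (\<xi> - \<eta>))) \<partial>lborel)"
        by (intro Bochner_Integration.integral_cong refl) (simp add: mult_ac)
      also have "\<dots> = complex_of_real (2 * pi) * (\<integral>\<eta>. cnj (g \<eta>) * complex_of_real (gauss (\<xi> - \<eta>)) \<partial>lborel)"
        by (rule integral_mult_right_zero)
      finally show ?thesis .
    qed
    finally show ?thesis .
  qed
  \<comment> \<open>\<open>G\<close> is bounded by the integral of |g|, so the integrand is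
    dominated by a product of an integrable function of \<xi> and a multiple of \<open>gauss\<close>
    in x.\<close>
  have int2: "integrable (lborel \<Otimes>\<^sub>M lborel) (\<lambda>(x, \<xi>). (g \<xi> * iexp (\<xi> \<bullet> x)) * cnj (G x) * complex_of_real (gauss x))"
  proof (rule lborel_pair.Fubini_integrable)
    have "integrable lborel (\<lambda>x. B * (cmod (G x) * gauss x))"
    proof (rule integrable_mult_right, rule Bochner_Integration.integrable_bound[of lborel "\<lambda>x. B * gauss x"])
      show "AE x in lborel. norm (cmod (G x) * gauss x) \<le> norm (B * gauss x)"
        using Gle B0 by (auto simp: abs_mult intro!: mult_right_mono)
    qed auto
    then show "integrable lborel (\<lambda>x. \<integral>y. norm ((\<lambda>(x, \<xi>). (g \<xi> * iexp (\<xi> \<bullet> x)) * cnj (G x) * complex_of_real (gauss x)) (x, y)) \<partial>lborel)"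
      by (simp add: norm_mult B_def mult_ac)
    show "AE x in lborel. integrable lborel (\<lambda>y. (\<lambda>(x, \<xi>). (g \<xi> * iexp (\<xi> \<bullet> x)) * cnj (G x) * complex_of_real (gauss x)) (x, y))"
      using g by (auto intro!: integrable_mult_left integrable_iexp_mult)
  qed measurable
  have ig2: "integrable lborel (\<lambda>x. (cmod (G x))\<^sup>2 * gauss x)"
  proof (rule Bochner_Integration.integrable_bound[of lborel "\<lambda>x. B\<^sup>2 * gauss x"])
    show "AE x in lborel. norm ((cmod (G x))\<^sup>2 * gauss x) \<le> norm (B\<^sup>2 * gauss x)"
      using Gle by (auto simp: abs_mult intro!: mult_right_mono power_mono)
  qed auto
  have "complex_of_real (\<integral>x. (cmod (G x))\<^sup>2 * gauss x \<partial>lborel) = (\<integral>x. G x * cnj (G x) * complex_of_real (gauss x) \<partial>lborel)"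
    unfolding integral_complex_of_real[symmetric] of_real_mult complex_norm_square ..
  also have "\<dots> = (\<integral>x. \<integral>\<xi>. (g \<xi> * iexp (\<xi> \<bullet> x)) * cnj (G x) * complex_of_real (gauss x) \<partial>lborel \<partial>lborel)"
    by (subst G_def) (simp only: integral_mult_left_zero)
  also have "\<dots> = (\<integral>\<xi>. \<integral>x. (g \<xi> * iexp (\<xi> \<bullet> x)) * cnj (G x) * complex_of_real (gauss x) \<partial>lborel \<partial>lborel)"
    by (rule lborel_pair.Fubini_integral[OF int2, symmetric])
  also have "\<dots> = (\<integral>\<xi>. g \<xi> * (\<integral>x. iexp (\<xi> \<bullet> x) * cnj (G x) * complex_of_real (gauss x) \<partial>lborel) \<partial>lborel)"
    by (simp only: mult.assoc integral_mult_right_zero)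
  also have "\<dots> = complex_of_real (2 * pi) * (\<integral>\<xi>. g \<xi> * (\<integral>\<eta>. cnj (g \<eta>) * complex_of_real (gauss (\<xi> - \<eta>)) \<partial>lborel) \<partial>lborel)"
    unfolding inner mult.left_commute[of _ "complex_of_real (2 * pi)"] by (rule integral_mult_right_zero)
  finally have "(\<integral>x. (cmod (G x))\<^sup>2 * gauss x \<partial>lborel)
     = 2 * pi * cmod (\<integral>\<xi>. g \<xi> * (\<integral>\<eta>. cnj (g \<eta>) * complex_of_real (gauss (\<xi> - \<eta>)) \<partial>lborel) \<partial>lborel)"
    (is "?I = 2 * pi * cmod ?J")
  proof -
    assume "complex_of_real ?I = complex_of_real (2 * pi) * ?J"
    then have "cmod (complex_of_real ?I) = cmod (complex_of_real (2 * pi) * ?J)" by simp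
    moreover have "?I \<ge> 0" by simp
    ultimately show ?thesis by (simp add: norm_mult)
  qed
  \<comment> \<open>Schur's test for a symmetric kernel: |g \<xi>| |g \<eta>| is at most half the
    sum of the squares, and each half contributes pi \<open>N\<close>. The computation is in
    \<open>ennreal\<close> because \<open>N\<close> may be infinite.\<close>
  moreover have "ennreal (cmod ?J) \<le> ennreal (2 * pi) * N"
  proof -
    have "ennreal (cmod ?J) \<le> (\<integral>\<^sup>+\<xi>. ennreal (cmod (g \<xi> * (\<integral>\<eta>. cnj (g \<eta>) * complex_of_real (gauss (\<xi> - \<eta>)) \<partial>lborel))) \<partial>lborel)"
      by (rule norm_integral_le_nn_integral)
    also have "\<dots> \<le> (\<integral>\<^sup>+\<xi>. \<integral>\<^sup>+\<eta>. ennreal (((cmod (g \<xi>))\<^sup>2 / 2 + (cmod (g \<eta>))\<^sup>2 / 2) * gauss (\<xi> - \<eta>)) \<partial>lborel \<partial>lborel)"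
    proof (rule nn_integral_mono)
      fix \<xi>
      have "ennreal (cmod (g \<xi> * (\<integral>\<eta>. cnj (g \<eta>) * complex_of_real (gauss (\<xi> - \<eta>)) \<partial>lborel)))
        = ennreal (cmod (g \<xi>)) * ennreal (cmod (\<integral>\<eta>. cnj (g \<eta>) * complex_of_real (gauss (\<xi> - \<eta>)) \<partial>lborel))"
        by (simp add: norm_mult ennreal_mult)
      also have "\<dots> \<le> ennreal (cmod (g \<xi>)) * (\<integral>\<^sup>+\<eta>. ennreal (cmod (cnj (g \<eta>) * complex_of_real (gauss (\<xi> - \<eta>)))) \<partial>lborel)"
        by (intro mult_left_mono norm_integral_le_nn_integral) auto
      also have "\<dots> = (\<integral>\<^sup>+\<eta>. ennreal (cmod (g \<xi>) * cmod (g \<eta>) * gauss (\<xi> - \<eta>)) \<partial>lborel)"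
        by (subst nn_integral_cmult[symmetric]) (auto simp: norm_mult ennreal_mult mult_ac)
      also have "\<dots> \<le> (\<integral>\<^sup>+\<eta>. ennreal (((cmod (g \<xi>))\<^sup>2 / 2 + (cmod (g \<eta>))\<^sup>2 / 2) * gauss (\<xi> - \<eta>)) \<partial>lborel)"
      proof (intro nn_integral_mono ennreal_leI mult_right_mono)
        show "cmod (g \<xi>) * cmod (g \<eta>) \<le> (cmod (g \<xi>))\<^sup>2 / 2 + (cmod (g \<eta>))\<^sup>2 / 2" for \<eta>
          using sum_squares_bound[of "cmod (g \<xi>)" "cmod (g \<eta>)"] by simp
      qed auto
      finally show "ennreal (cmod (g \<xi> * (\<integral>\<eta>. cnj (g \<eta>) * complex_of_real (gauss (\<xi> - \<eta>)) \<partial>lborel))) \<le> \<dots>" .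
    qed
    also have "\<dots> = (\<integral>\<^sup>+\<xi>. \<integral>\<^sup>+\<eta>. ennreal ((cmod (g \<xi>))\<^sup>2 / 2) * ennreal (gauss (\<eta> - \<xi>)) \<partial>lborel \<partial>lborel)
       + (\<integral>\<^sup>+\<xi>. \<integral>\<^sup>+\<eta>. ennreal ((cmod (g \<eta>))\<^sup>2 / 2) * ennreal (gauss (\<xi> - \<eta>)) \<partial>lborel \<partial>lborel)"
    proof -
      have "ennreal (((cmod (g \<xi>))\<^sup>2 / 2 + (cmod (g \<eta>))\<^sup>2 / 2) * gauss (\<xi> - \<eta>))
        = ennreal ((cmod (g \<xi>))\<^sup>2 / 2) * ennreal (gauss (\<eta> - \<xi>)) + ennreal ((cmod (g \<eta>))\<^sup>2 / 2) * ennreal (gauss (\<xi> - \<eta>))" for \<xi> \<eta>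
        unfolding distrib_right gauss_minus_commute[of \<eta> \<xi>]
        by (subst ennreal_plus) (auto simp: ennreal_mult simp del: times_divide_eq_left)
      then have "(\<integral>\<^sup>+\<xi>. \<integral>\<^sup>+\<eta>. ennreal (((cmod (g \<xi>))\<^sup>2 / 2 + (cmod (g \<eta>))\<^sup>2 / 2) * gauss (\<xi> - \<eta>)) \<partial>lborel \<partial>lborel)
        = (\<integral>\<^sup>+\<xi>. (\<integral>\<^sup>+\<eta>. ennreal ((cmod (g \<xi>))\<^sup>2 / 2) * ennreal (gauss (\<eta> - \<xi>)) \<partial>lborel) + (\<integral>\<^sup>+\<eta>. ennreal ((cmod (g \<eta>))\<^sup>2 / 2) * ennreal (gauss (\<xi> - \<eta>)) \<partial>lborel) \<partial>lborel)"
        by (simp only:) (intro nn_integral_cong nn_integral_add; measurable)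
      also have "\<dots> = (\<integral>\<^sup>+\<xi>. \<integral>\<^sup>+\<eta>. ennreal ((cmod (g \<xi>))\<^sup>2 / 2) * ennreal (gauss (\<eta> - \<xi>)) \<partial>lborel \<partial>lborel)
       + (\<integral>\<^sup>+\<xi>. \<integral>\<^sup>+\<eta>. ennreal ((cmod (g \<eta>))\<^sup>2 / 2) * ennreal (gauss (\<xi> - \<eta>)) \<partial>lborel \<partial>lborel)"
        by (rule nn_integral_add; measurable)
      finally show ?thesis .
    qed
    also have "(\<integral>\<^sup>+\<xi>. \<integral>\<^sup>+\<eta>. ennreal ((cmod (g \<eta>))\<^sup>2 / 2) * ennreal (gauss (\<xi> - \<eta>)) \<partial>lborel \<partial>lborel)
       = (\<integral>\<^sup>+\<eta>. \<integral>\<^sup>+\<xi>. ennreal ((cmod (g \<eta>))\<^sup>2 / 2) * ennreal (gauss (\<xi> - \<eta>)) \<partial>lborel \<partial>lborel)"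
      by (rule lborel_pair.Fubini') simp
    also have "(\<integral>\<^sup>+\<xi>. \<integral>\<^sup>+\<eta>. ennreal ((cmod (g \<xi>))\<^sup>2 / 2) * ennreal (gauss (\<eta> - \<xi>)) \<partial>lborel \<partial>lborel) = ennreal pi * N"
    proof -
      have "(\<integral>\<^sup>+\<eta>. ennreal ((cmod (g \<xi>))\<^sup>2 / 2) * ennreal (gauss (\<eta> - \<xi>)) \<partial>lborel) = ennreal pi * ennreal ((cmod (g \<xi>))\<^sup>2)" for \<xi>
        by (subst nn_integral_cmult, measurable, subst nn_integral_gauss_shift, subst (1 2) ennreal_mult[symmetric]) auto
      then show ?thesis unfolding N_def by (simp only:) (rule nn_integral_cmult, measurable)
    qed
    finally show ?thesis
      by (simp add: distrib_right[symmetric] ennreal_plus[symmetric] del: ennreal_plus)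
  qed
  ultimately have I: "ennreal ?I \<le> ennreal (2 * pi) * (ennreal (2 * pi) * N)"
    by (simp add: ennreal_mult mult_left_mono del: ennreal_mult')
  have "(\<integral>\<^sup>+x\<in>cball 0 1. ennreal ((cmod (G x))\<^sup>2) \<partial>lborel) \<le> (\<integral>\<^sup>+x. ennreal (exp (1/2)) * ennreal ((cmod (G x))\<^sup>2 * gauss x) \<partial>lborel)"
  proof (rule nn_integral_mono)
    fix x
    have "(cmod (G x))\<^sup>2 \<le> exp (1/2) * ((cmod (G x))\<^sup>2 * gauss x)" if "norm x \<le> 1"
    proof -
      have "1 \<le> exp (1/2 - (norm x)\<^sup>2 / 2)" using that by (simp add: power_le_one)
      also have "\<dots> = exp (1/2) * gauss x" by (simp add: gauss_def flip: exp_add)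
      finally show ?thesis using mult_left_mono[of 1 "exp (1/2) * gauss x" "(cmod (G x))\<^sup>2"] by (simp add: mult_ac)
    qed
    then show "ennreal ((cmod (G x))\<^sup>2) * indicator (cball 0 1) x \<le> ennreal (exp (1/2)) * ennreal ((cmod (G x))\<^sup>2 * gauss x)"
      by (auto simp: indicator_def ennreal_mult[symmetric] intro!: ennreal_leI)
  qed
  also have "\<dots> = ennreal (exp (1/2)) * ennreal ?I"
    using ig2 by (subst nn_integral_cmult) (auto simp: nn_integral_eq_integral)
  also have "\<dots> \<le> ennreal (exp (1/2)) * (ennreal (2 * pi) * (ennreal (2 * pi) * N))"
    by (intro mult_left_mono I) auto
  also have "\<dots> = ennreal (exp (1/2) * (2 * pi)\<^sup>2) * N"
    by (simp add: ennreal_mult power2_eq_square mult_ac)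
  finally show ?thesis by (simp add: G_def N_def)
qed

text \<open>The transform without the customary factor 1/(2 pi)^2; that factor appears explicitly in
  the inversion formula and in \<open>spectral_cutoff\<close>.\<close>

definition ifourier :: "(real^2 \<Rightarrow> complex) \<Rightarrow> real^2 \<Rightarrow> complex" where
  "ifourier g x = (\<integral>\<xi>. g \<xi> * iexp (\<xi> \<bullet> x) \<partial>lborel)"

lemma fourier2_eq: "fourier2 f \<xi> = (\<integral>x. complex_of_real (f x) * iexp (- (\<xi> \<bullet> x)) \<partial>lborel)"
  by (simp add: fourier2_def)

lemma measurable_fourier2 [measurable]:
  assumes [measurable]: "f \<in> borel_measurable borel"
  shows "fourier2 f \<in> borel_measurable borel"
  unfolding fourier2_eq[abs_def] by measurable

lemma integrable_gauss_scaled: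
  assumes "\<delta> > 0" shows "integrable lborel (\<lambda>\<xi>. gauss (\<delta> *\<^sub>R \<xi>))"
proof -
  have "integrable lborel (\<lambda>\<xi>. gauss (0 + \<delta> *\<^sub>R \<xi>))"
  proof -
    have "integrable (density (distr lborel borel (\<lambda>x. 0 + \<delta> *\<^sub>R x)) (\<lambda>_. ennreal (\<bar>\<delta>\<bar>^DIM(real^2)))) gauss"
      using integrable_gauss lborel_affine[of \<delta> "0 :: real^2"] assms by simp
    then show ?thesis
      using assms by (subst (asm) integrable_density) (auto simp: integrable_distr_eq)
  qed
  then show ?thesis by simp
qed

text \<open>Fubini turns the Gaussian regularization of the inversion integral into a Gaussian average of \<open>f\<close>.\<close>

lemma ifourier_gauss_regularized:
  assumes f: "integrable lborel f" and \<delta>: "\<delta> > 0"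
  shows "(\<integral>\<xi>. fourier2 f \<xi> * iexp (\<xi> \<bullet> x) * complex_of_real (gauss (\<delta> *\<^sub>R \<xi>)) \<partial>lborel)
    = complex_of_real (2 * pi * (\<integral>w. f (x + \<delta> *\<^sub>R w) * gauss w \<partial>lborel))"
proof -
  have [measurable]: "f \<in> borel_measurable borel" using f by auto
  note igs = integrable_gauss_scaled[OF \<delta>]
  have int: "integrable (lborel \<Otimes>\<^sub>M lborel) (\<lambda>(\<xi>, y). complex_of_real (f y) * iexp (- (\<xi> \<bullet> y)) * iexp (\<xi> \<bullet> x) * complex_of_real (gauss (\<delta> *\<^sub>R \<xi>)))"
  proof (rule lborel_pair.Fubini_integrable)
    have "integrable lborel (\<lambda>y. complex_of_real (f y) * iexp (- (\<xi> \<bullet> y)))" for \<xi>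
      using f by (intro integrable_iexp_mult) auto
    then show "AE \<xi> in lborel. integrable lborel (\<lambda>y. (\<lambda>(\<xi>, y). complex_of_real (f y) * iexp (- (\<xi> \<bullet> y)) * iexp (\<xi> \<bullet> x) * complex_of_real (gauss (\<delta> *\<^sub>R \<xi>))) (\<xi>, y))"
      by (simp only: prod.case) (intro AE_I2 integrable_mult_left)
    show "integrable lborel (\<lambda>\<xi>. \<integral>y. norm ((\<lambda>(\<xi>, y). complex_of_real (f y) * iexp (- (\<xi> \<bullet> y)) * iexp (\<xi> \<bullet> x) * complex_of_real (gauss (\<delta> *\<^sub>R \<xi>))) (\<xi>, y)) \<partial>lborel)"
      using igs by (simp add: norm_mult)
  qed measurable
  have "(\<integral>\<xi>. fourier2 f \<xi> * iexp (\<xi> \<bullet> x) * complex_of_real (gauss (\<delta> *\<^sub>R \<xi>)) \<partial>lborel)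
    = (\<integral>\<xi>. \<integral>y. complex_of_real (f y) * iexp (- (\<xi> \<bullet> y)) * iexp (\<xi> \<bullet> x) * complex_of_real (gauss (\<delta> *\<^sub>R \<xi>)) \<partial>lborel \<partial>lborel)"
    unfolding fourier2_eq by (simp only: integral_mult_left_zero)
  also have "\<dots> = (\<integral>y. \<integral>\<xi>. complex_of_real (f y) * iexp (- (\<xi> \<bullet> y)) * iexp (\<xi> \<bullet> x) * complex_of_real (gauss (\<delta> *\<^sub>R \<xi>)) \<partial>lborel \<partial>lborel)"
    by (rule lborel_pair.Fubini_integral[OF int, symmetric])
  also have "\<dots> = (\<integral>y. complex_of_real (2 * pi / \<delta>\<^sup>2 * f y * gauss ((1/\<delta>) *\<^sub>R (x - y))) \<partial>lborel)"
  proof (rule Bochner_Integration.integral_cong[OF refl])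
    fix y
    have "(\<integral>\<xi>. complex_of_real (f y) * iexp (- (\<xi> \<bullet> y)) * iexp (\<xi> \<bullet> x) * complex_of_real (gauss (\<delta> *\<^sub>R \<xi>)) \<partial>lborel)
      = (\<integral>\<xi>. complex_of_real (f y) * (iexp ((x - y) \<bullet> \<xi>) * complex_of_real (gauss (\<delta> *\<^sub>R \<xi>))) \<partial>lborel)"
      by (intro Bochner_Integration.integral_cong refl)
        (simp add: mult_ac inner_commute inner_diff_left inner_diff_right right_diff_distrib exp_diff exp_minus divide_inverse)
    also have "\<dots> = complex_of_real (f y) * (\<integral>\<xi>. iexp ((x - y) \<bullet> \<xi>) * complex_of_real (gauss (\<delta> *\<^sub>R \<xi>)) \<partial>lborel)"
      by (rule integral_mult_right_zero)
    also have "(\<integral>\<xi>. iexp ((x - y) \<bullet> \<xi>) * complex_of_real (gauss (\<delta> *\<^sub>R \<xi>)) \<partial>lborel)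
      = \<bar>1/\<delta>\<bar> ^ DIM(real^2) *\<^sub>R (\<integral>\<xi>. iexp ((x - y) \<bullet> (0 + (1/\<delta>) *\<^sub>R \<xi>)) * complex_of_real (gauss (\<delta> *\<^sub>R (0 + (1/\<delta>) *\<^sub>R \<xi>))) \<partial>lborel)"
      by (rule lborel_integral_affine) (measurable, use \<delta> in simp)
    also have "(\<integral>\<xi>. iexp ((x - y) \<bullet> (0 + (1/\<delta>) *\<^sub>R \<xi>)) * complex_of_real (gauss (\<delta> *\<^sub>R (0 + (1/\<delta>) *\<^sub>R \<xi>))) \<partial>lborel)
      = (\<integral>\<xi>. iexp (((1/\<delta>) *\<^sub>R (x - y)) \<bullet> \<xi>) * complex_of_real (gauss \<xi>) \<partial>lborel)"
      using \<delta> by (intro Bochner_Integration.integral_cong refl) simp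
    also have "\<dots> = complex_of_real (2 * pi * gauss ((1/\<delta>) *\<^sub>R (x - y)))"
      by (rule integral_iexp_gauss)
    finally show "(\<integral>\<xi>. complex_of_real (f y) * iexp (- (\<xi> \<bullet> y)) * iexp (\<xi> \<bullet> x) * complex_of_real (gauss (\<delta> *\<^sub>R \<xi>)) \<partial>lborel)
      = complex_of_real (2 * pi / \<delta>\<^sup>2 * f y * gauss ((1/\<delta>) *\<^sub>R (x - y)))"
      using \<delta> by (simp add: scaleR_conv_of_real power_divide mult_ac)
  qed
  also have "\<dots> = complex_of_real (\<integral>y. 2 * pi / \<delta>\<^sup>2 * f y * gauss ((1/\<delta>) *\<^sub>R (x - y)) \<partial>lborel)"
    by (rule integral_complex_of_real)
  \<comment> \<open>The substitution y = x + \<delta> w makes the width of the Gaussian independent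
    of \<delta>, and its Jacobian \<delta>^2 cancels the prefactor. The parameter now sits only
    inside the argument of f, where continuity can be used.\<close>
  also have "(\<integral>y. 2 * pi / \<delta>\<^sup>2 * f y * gauss ((1/\<delta>) *\<^sub>R (x - y)) \<partial>lborel)
    = \<bar>\<delta>\<bar> ^ DIM(real^2) *\<^sub>R (\<integral>w. 2 * pi / \<delta>\<^sup>2 * f (x + \<delta> *\<^sub>R w) * gauss ((1/\<delta>) *\<^sub>R (x - (x + \<delta> *\<^sub>R w))) \<partial>lborel)"
    by (rule lborel_integral_affine) (measurable, use \<delta> in simp)
  also have "(\<integral>w. 2 * pi / \<delta>\<^sup>2 * f (x + \<delta> *\<^sub>R w) * gauss ((1/\<delta>) *\<^sub>R (x - (x + \<delta> *\<^sub>R w))) \<partial>lborel)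
    = (\<integral>w. 2 * pi / \<delta>\<^sup>2 * (f (x + \<delta> *\<^sub>R w) * gauss w) \<partial>lborel)"
    using \<delta> by (intro Bochner_Integration.integral_cong refl) (simp add: mult_ac)
  also have "\<dots> = 2 * pi / \<delta>\<^sup>2 * (\<integral>w. f (x + \<delta> *\<^sub>R w) * gauss w \<partial>lborel)"
    by (rule integral_mult_right_zero)
  finally show ?thesis using \<delta> by simp
qed

text \<open>Let \<delta> tend to 0 in the regularized formula. The frequency side is dominated by
  the modulus of the transform, the space side by a multiple of \<open>gauss\<close>. Since
  \<open>gauss\<close> has mass 2 pi, the space side tends to (2 pi)^2 f x.\<close>

lemma fourier_inversion:
  assumes cont: "continuous_on UNIV f" and bnd: "\<And>x. \<bar>f x\<bar> \<le> B" and f: "integrable lborel f"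
    and F: "integrable lborel (fourier2 f)"
  shows "complex_of_real ((2 * pi)\<^sup>2 * f x) = ifourier (fourier2 f) x"
proof -
  have [measurable]: "f \<in> borel_measurable borel" using f by auto
  define \<delta> where "\<delta> n = 1 / real (Suc n)" for n
  have \<delta>: "\<delta> n > 0" "\<delta> \<longlonglongrightarrow> 0" for n
    unfolding \<delta>_def using LIMSEQ_inverse_real_of_nat by (auto simp: inverse_eq_divide)
  have g1: "(\<lambda>n. gauss (\<delta> n *\<^sub>R \<xi>)) \<longlonglongrightarrow> 1" for \<xi>
  proof -
    have "(\<lambda>n. gauss (\<delta> n *\<^sub>R \<xi>)) \<longlonglongrightarrow> gauss (0 *\<^sub>R \<xi>)"
      by (rule continuous_on_tendsto_compose[OF continuous_on_gauss[OF continuous_on_id, of UNIV] tendsto_scaleR[OF \<delta>(2) tendsto_const]]) auto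
    then show ?thesis by (simp add: gauss_def)
  qed
  have "(\<lambda>n. \<integral>\<xi>. fourier2 f \<xi> * iexp (\<xi> \<bullet> x) * complex_of_real (gauss (\<delta> n *\<^sub>R \<xi>)) \<partial>lborel)
     \<longlonglongrightarrow> (\<integral>\<xi>. fourier2 f \<xi> * iexp (\<xi> \<bullet> x) \<partial>lborel)"
  proof (rule integral_dominated_convergence[where w="\<lambda>\<xi>. norm (fourier2 f \<xi>)"])
    show "AE \<xi> in lborel. (\<lambda>n. fourier2 f \<xi> * iexp (\<xi> \<bullet> x) * complex_of_real (gauss (\<delta> n *\<^sub>R \<xi>))) \<longlonglongrightarrow> fourier2 f \<xi> * iexp (\<xi> \<bullet> x)"
      using tendsto_mult[OF tendsto_const tendsto_of_real[OF g1]] by fastforce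
    show "AE \<xi> in lborel. norm (fourier2 f \<xi> * iexp (\<xi> \<bullet> x) * complex_of_real (gauss (\<delta> n *\<^sub>R \<xi>))) \<le> norm (fourier2 f \<xi>)" for n
      by (auto simp: norm_mult gauss_le_1 mult_left_le)
  qed (use F in auto)
  moreover have "(\<lambda>n. complex_of_real (2 * pi * (\<integral>w. f (x + \<delta> n *\<^sub>R w) * gauss w \<partial>lborel)))
     \<longlonglongrightarrow> complex_of_real (2 * pi * (\<integral>w. f x * gauss w \<partial>lborel))"
  proof (intro tendsto_of_real tendsto_mult tendsto_const integral_dominated_convergence[where w="\<lambda>w. B * gauss w"] AE_I2)
    fix w
    have "(\<lambda>n. f (x + \<delta> n *\<^sub>R w)) \<longlonglongrightarrow> f (x + 0 *\<^sub>R w)"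
      by (rule continuous_on_tendsto_compose[OF cont tendsto_add[OF tendsto_const tendsto_scaleR[OF \<delta>(2) tendsto_const]]]) auto
    then show "(\<lambda>n. f (x + \<delta> n *\<^sub>R w)) \<longlonglongrightarrow> f x" by simp
    show "norm (f (x + \<delta> n *\<^sub>R w) * gauss w) \<le> B * gauss w" for n
      using bnd by (auto simp: abs_mult intro!: mult_right_mono)
  qed auto
  ultimately have "(\<integral>\<xi>. fourier2 f \<xi> * iexp (\<xi> \<bullet> x) \<partial>lborel) = complex_of_real (2 * pi * (\<integral>w. f x * gauss w \<partial>lborel))"
    unfolding ifourier_gauss_regularized[OF f \<delta>(1)] by (rule LIMSEQ_unique)
  then show ?thesis
    by (simp add: ifourier_def integral_gauss power2_eq_square mult_ac)
qed

section \<open>Integrability of the Sobolev weight\<close>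

lemma nn_integral_weight_1d:
  assumes "\<beta> > 1"
  shows "(\<integral>\<^sup>+t. ennreal ((1 + t\<^sup>2) powr (- \<beta> / 2)) \<partial>lborel) < \<infinity>"
proof -
  have "(\<integral>\<^sup>+t. ennreal ((1 + t\<^sup>2) powr (- \<beta> / 2)) \<partial>lborel) \<le> 2 * (\<integral>\<^sup>+t\<in>{0..}. ennreal ((1 + t\<^sup>2) powr (- \<beta> / 2)) \<partial>lborel)"
    by (rule nn_integral_even) auto
  \<comment> \<open>The weight is at most 1 up to t = 1 and at most t^(-\<beta>) from there on; the
    latter is integrable at infinity exactly because \<beta> > 1.\<close>
  also have "(\<integral>\<^sup>+t\<in>{0..}. ennreal ((1 + t\<^sup>2) powr (- \<beta> / 2)) \<partial>lborel)
    \<le> (\<integral>\<^sup>+t. indicator {0..1} t + ennreal (t powr (- \<beta>)) * indicator {1..} t \<partial>lborel)"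
  proof (intro nn_integral_mono)
    fix t :: real
    have 1: "(1 + t\<^sup>2) powr (- \<beta> / 2) \<le> 1"
    proof -
      have "1 + t\<^sup>2 \<noteq> 0" by (simp add: add_nonneg_eq_0_iff)
      then show ?thesis using powr_mono[of "- \<beta> / 2" 0 "1 + t\<^sup>2"] assms by simp
    qed
    have 2: "(1 + t\<^sup>2) powr (- \<beta> / 2) \<le> t powr (- \<beta>)" if "t \<ge> 1"
    proof -
      have "(1 + t\<^sup>2) powr (- \<beta> / 2) \<le> (t\<^sup>2) powr (- \<beta> / 2)"
        using that assms by (intro powr_mono2') auto
      also have "(t\<^sup>2) powr (- \<beta> / 2) = t powr (- \<beta>)"
        using that by (simp add: powr_powr flip: powr_numeral)
      finally show ?thesis .
    qed
    show "ennreal ((1 + t\<^sup>2) powr (- \<beta> / 2)) * indicator {0..} t \<le> indicator {0..1} t + ennreal (t powr (- \<beta>)) * indicator {1..} t"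
    proof (cases "t \<ge> 1")
      case True
      then have "ennreal ((1 + t\<^sup>2) powr (- \<beta> / 2)) \<le> ennreal (t powr (- \<beta>)) * indicator {1..} t"
        using ennreal_leI[OF 2[OF True]] by simp
      also have "\<dots> \<le> indicator {0..1} t + ennreal (t powr (- \<beta>)) * indicator {1..} t"
        by (rule add_increasing) auto
      finally show ?thesis using True by simp
    next
      case False
      then show ?thesis using 1 by (auto simp: indicator_def ennreal_le_1)
    qed
  qed
  also have "\<dots> = 1 + (\<integral>\<^sup>+t\<in>{1..}. ennreal (t powr (- \<beta>)) \<partial>lborel)"
    by (subst nn_integral_add) auto
  also have "(\<integral>\<^sup>+t\<in>{1..}. ennreal (t powr (- \<beta>)) \<partial>lborel) = ennreal (- (1 powr (- \<beta> + 1)) / (- \<beta> + 1))"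
    using assms by (intro nn_integral_powr_tail) auto
  finally have "(\<integral>\<^sup>+t. ennreal ((1 + t\<^sup>2) powr (- \<beta> / 2)) \<partial>lborel) \<le> 2 * (1 + ennreal (- (1 powr (- \<beta> + 1)) / (- \<beta> + 1)))"
    by (simp add: mult_left_mono)
  also have "\<dots> < \<infinity>" by (simp add: ennreal_mult_less_top)
  finally show ?thesis .
qed

text \<open>In the plane \<open>(1 + |\<xi>|\<^sup>2)\<^sup>2\<close> dominates the product of the two one-dimensional weights.\<close>

lemma nn_integral_weight_2d:
  assumes "\<beta> > 1"
  shows "(\<integral>\<^sup>+\<xi>. ennreal ((1 + (norm (\<xi> :: real^2))\<^sup>2) powr (- \<beta>)) \<partial>lborel) < \<infinity>"
proof -
  let ?w = "\<lambda>t::real. (1 + t\<^sup>2) powr (- \<beta> / 2)"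
  have le: "(1 + (norm \<xi>)\<^sup>2) powr (- \<beta>) \<le> ?w (\<xi>$1) * ?w (\<xi>$2)" for \<xi> :: "real^2"
  proof -
    have "(1 + (norm \<xi>)\<^sup>2) powr (- \<beta>) = (1 + (norm \<xi>)\<^sup>2) powr (- \<beta> / 2) * (1 + (norm \<xi>)\<^sup>2) powr (- \<beta> / 2)"
      by (simp flip: powr_add)
    also have "\<dots> \<le> ?w (\<xi>$1) * ?w (\<xi>$2)"
      using assms by (intro mult_mono powr_mono2') (auto simp: norm2_sq add_pos_nonneg)
    finally show ?thesis .
  qed
  have "(\<integral>\<^sup>+\<xi>. ennreal ((1 + (norm (\<xi> :: real^2))\<^sup>2) powr (- \<beta>)) \<partial>lborel)
    \<le> (\<integral>\<^sup>+\<xi>. ennreal (?w ((\<xi> :: real^2)$1)) * ennreal (?w (\<xi>$2)) \<partial>lborel)"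
    using le by (intro nn_integral_mono) (auto simp flip: ennreal_mult intro!: ennreal_leI)
  also have "\<dots> = (\<integral>\<^sup>+p. ennreal (?w (fst p)) * ennreal (?w (snd p)) \<partial>(lborel \<Otimes>\<^sub>M lborel))"
    by (subst lborel_eq_distr_vector2, subst nn_integral_distr) auto
  also have "\<dots> = (\<integral>\<^sup>+x. \<integral>\<^sup>+y. ennreal (?w x) * ennreal (?w y) \<partial>lborel \<partial>lborel)"
    by (subst lborel.nn_integral_fst[symmetric]) auto
  also have "\<dots> = (\<integral>\<^sup>+x. ennreal (?w x) \<partial>lborel) * (\<integral>\<^sup>+x. ennreal (?w x) \<partial>lborel)"
    by (simp add: nn_integral_cmult nn_integral_multc)
  also have "\<dots> < \<infinity>"
    using nn_integral_weight_1d[OF assms] by (simp add: ennreal_mult_less_top)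
  finally show ?thesis .
qed


section \<open>Inversion and uniform bounds over the Sobolev class\<close>

lemma H_classD:
  assumes "f \<in> H_class \<beta> L"
  shows "continuous_on UNIV f" and "\<And>x. x \<notin> cball 0 1 \<Longrightarrow> f x = 0"
    and "(\<integral>\<^sup>+ \<xi>. ennreal ((1 + (norm \<xi>)\<^sup>2) powr \<beta> * (cmod (fourier2 f \<xi>))\<^sup>2) \<partial>lborel) \<le> ennreal L"
    and "f \<in> borel_measurable borel"
  using assms by (auto simp: H_class_def borel_measurable_continuous_onI)

text \<open>A qualitative bound that may depend on f. It feeds the inversion formula, from which the
  uniform bound \<open>H_class_sup_le\<close> is then derived.\<close>

lemma H_class_bounded:
  assumes "f \<in> H_class \<beta> L"
  obtains B where "\<And>x. \<bar>f x\<bar> \<le> B"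
proof -
  have "compact (f ` cball 0 1)"
    using continuous_on_subset[OF H_classD(1)[OF assms]] by (intro compact_continuous_image) auto
  then obtain B where B: "\<forall>x\<in>cball 0 1. norm (f x) \<le> B"
    by (auto dest!: compact_imp_bounded simp: bounded_iff)
  have "\<bar>f x\<bar> \<le> max B 0" for x
  proof (cases "x \<in> cball 0 1")
    case True
    then have "\<bar>f x\<bar> \<le> B" using B by auto
    then show ?thesis by simp
  qed (simp add: H_classD(2)[OF assms])
  then show ?thesis by (rule that)
qed

lemma H_class_integrable:
  assumes "f \<in> H_class \<beta> L" shows "integrable lborel f"
proof -
  have "integrable lborel (\<lambda>x. indicator (cball 0 1) x *\<^sub>R f x)"
    using continuous_on_subset[OF H_classD(1)[OF assms]] by (intro borel_integrable_compact) auto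
  also have "(\<lambda>x. indicator (cball 0 1) x *\<^sub>R f x) = f"
    using H_classD(2)[OF assms] by (auto simp: indicator_def fun_eq_iff)
  finally show ?thesis .
qed

text \<open>By \<open>nn_integral_weight_2d\<close> the integral is finite for \<beta> > 1, where
  \<open>enn2real\<close> therefore loses nothing; an infinite value would become 0.\<close>

definition weight_mass :: "real \<Rightarrow> real" where
  "weight_mass \<beta> = enn2real (\<integral>\<^sup>+\<xi>. ennreal ((1 + (norm (\<xi> :: real^2))\<^sup>2) powr (- \<beta>)) \<partial>lborel)"

text \<open>The weight is split in place of the Cauchy-Schwarz inequality: with w = (1 +
  |\<xi>|^2)^(\<beta>/2) and c the modulus of the transform, c = (w c) (1/w) is at most (w c)^2 +
  1/w^2. The first term integrates to at most L, the second to
  \<open>weight_mass \<beta>\<close>.\<close>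

lemma
  assumes \<beta>: "\<beta> > 1" and L: "L > 0" and f: "f \<in> H_class \<beta> L"
  shows integrable_fourier2: "integrable lborel (fourier2 f)"
    and integral_fourier2_le: "(\<integral>\<xi>. cmod (fourier2 f \<xi>) \<partial>lborel) \<le> L + weight_mass \<beta>"
proof -
  have [measurable]: "f \<in> borel_measurable borel" by (rule H_classD(4)[OF f])
  have W: "(\<integral>\<^sup>+\<xi>. ennreal ((1 + (norm (\<xi> :: real^2))\<^sup>2) powr (- \<beta>)) \<partial>lborel) = ennreal (weight_mass \<beta>)"
    using nn_integral_weight_2d[OF \<beta>] by (simp add: weight_mass_def)
  have W0: "weight_mass \<beta> \<ge> 0" by (simp add: weight_mass_def)
  have "(\<integral>\<^sup>+\<xi>. ennreal (cmod (fourier2 f \<xi>)) \<partial>lborel)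
     \<le> (\<integral>\<^sup>+\<xi>. ennreal ((1 + (norm \<xi>)\<^sup>2) powr \<beta> * (cmod (fourier2 f \<xi>))\<^sup>2) + ennreal ((1 + (norm \<xi>)\<^sup>2) powr (- \<beta>)) \<partial>lborel)"
  proof (rule nn_integral_mono)
    fix \<xi> :: "real^2"
    define w where "w = (1 + (norm \<xi>)\<^sup>2) powr (\<beta> / 2)"
    define c where "c = cmod (fourier2 f \<xi>)"
    have pos: "1 + (norm \<xi>)\<^sup>2 > 0" by (simp add: add_pos_nonneg)
    then have w: "w > 0" by (simp add: w_def)
    have w2: "(1 + (norm \<xi>)\<^sup>2) powr \<beta> = w * w"
      unfolding w_def powr_add[symmetric] by simp
    have w2': "(1 + (norm \<xi>)\<^sup>2) powr (- \<beta>) = 1 / w * (1 / w)"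
      unfolding powr_minus w2 by (simp add: divide_inverse)
    have "2 * (w * c) * (1 / w) \<le> (w * c)\<^sup>2 + (1 / w)\<^sup>2" by (rule sum_squares_bound)
    moreover have "2 * (w * c) * (1 / w) = 2 * c" using w by simp
    moreover have "(w * c)\<^sup>2 = w * w * c\<^sup>2" by (simp add: power2_eq_square)
    ultimately have "2 * c \<le> w * w * c\<^sup>2 + 1 / w * (1 / w)" by (simp add: power2_eq_square[of "1 / w"])
    moreover have "c \<ge> 0" by (simp add: c_def)
    ultimately have *: "c \<le> w * w * c\<^sup>2 + 1 / w * (1 / w)" by linarith
    show "ennreal (cmod (fourier2 f \<xi>)) \<le> ennreal ((1 + (norm \<xi>)\<^sup>2) powr \<beta> * (cmod (fourier2 f \<xi>))\<^sup>2) + ennreal ((1 + (norm \<xi>)\<^sup>2) powr (- \<beta>))"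
      unfolding w2 w2' c_def[symmetric] using w ennreal_leI[OF *] by simp
  qed
  also have "\<dots> \<le> ennreal L + ennreal (weight_mass \<beta>)"
    using H_classD(3)[OF f] by (subst nn_integral_add) (auto simp: W intro!: add_mono)
  also have "\<dots> = ennreal (L + weight_mass \<beta>)" using L W0 by simp
  finally have le: "(\<integral>\<^sup>+\<xi>. ennreal (cmod (fourier2 f \<xi>)) \<partial>lborel) \<le> ennreal (L + weight_mass \<beta>)" .
  show int: "integrable lborel (fourier2 f)"
    by (rule integrableI_bounded) (use le in \<open>auto simp: less_top[symmetric] top_unique\<close>)
  show "(\<integral>\<xi>. cmod (fourier2 f \<xi>) \<partial>lborel) \<le> L + weight_mass \<beta>"
  proof -
    have "ennreal (\<integral>\<xi>. cmod (fourier2 f \<xi>) \<partial>lborel) \<le> ennreal (L + weight_mass \<beta>)"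
      using le nn_integral_eq_integral[OF integrable_norm[OF int]] by simp
    then show ?thesis using L W0 by (simp del: ennreal_plus)
  qed
qed

lemma H_class_inversion:
  assumes \<beta>: "\<beta> > 1" and L: "L > 0" and f: "f \<in> H_class \<beta> L"
  shows "complex_of_real ((2 * pi)\<^sup>2 * f x) = ifourier (fourier2 f) x"
proof -
  obtain B where "\<And>x. \<bar>f x\<bar> \<le> B" using H_class_bounded[OF f] by metis
  then show ?thesis
    by (intro fourier_inversion[OF H_classD(1)[OF f] _ H_class_integrable[OF f] integrable_fourier2[OF assms]])
qed

text \<open>By inversion f is bounded by the integral of its transform. The bound depends on \<beta>
  and L alone, which makes the variance estimate uniform in f; the factor (2 pi)^2 >= 1 is given
  away.\<close>

lemma H_class_sup_le:
  assumes \<beta>: "\<beta> > 1" and L: "L > 0" and f: "f \<in> H_class \<beta> L"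
  shows "\<bar>f x\<bar> \<le> L + weight_mass \<beta>"
proof -
  have "(2 * pi)\<^sup>2 * \<bar>f x\<bar> = cmod (complex_of_real ((2 * pi)\<^sup>2 * f x))" by (simp add: norm_mult abs_mult norm_power)
  also have "\<dots> \<le> (\<integral>\<xi>. norm (fourier2 f \<xi> * iexp (\<xi> \<bullet> x)) \<partial>lborel)"
    unfolding H_class_inversion[OF assms] ifourier_def by (rule integral_norm_bound)
  also have "\<dots> = (\<integral>\<xi>. cmod (fourier2 f \<xi>) \<partial>lborel)" by (simp add: norm_mult)
  also have "\<dots> \<le> L + weight_mass \<beta>" by (rule integral_fourier2_le[OF assms])
  finally have "(2 * pi)\<^sup>2 * \<bar>f x\<bar> \<le> L + weight_mass \<beta>" .
  moreover have "1 * \<bar>f x\<bar> \<le> (2 * pi)\<^sup>2 * \<bar>f x\<bar>"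
    using pi_gt3 by (intro mult_right_mono one_le_power) auto
  ultimately show ?thesis by simp
qed

text \<open>\<open>Re\<close> keeps the cutoff real by construction. Comparison with f is safe since
  f is real and a real part is at most the modulus.\<close>

definition spectral_cutoff :: "real \<Rightarrow> (real^2 \<Rightarrow> real) \<Rightarrow> real^2 \<Rightarrow> real" where
  "spectral_cutoff R f x = Re (ifourier (\<lambda>\<xi>. indicator (cball 0 R) \<xi> * fourier2 f \<xi>) x) / (2 * pi)\<^sup>2"

text \<open>The error comes from the frequencies above R only. There the Sobolev weight is at least
  R^(2\<beta>), so their energy is at most L R^(-2\<beta>), and \<open>Bessel_ball\<close> transfers
  this to the unit ball. The factor 1/(2 pi)^2 of inversion is bounded by 1.\<close>

lemma spectral_cutoff_bias:
  assumes \<beta>: "\<beta> > 1" and L: "L > 0" and f: "f \<in> H_class \<beta> L" and R: "R > 0"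
  shows "(\<integral>\<^sup>+x\<in>cball 0 1. ennreal ((spectral_cutoff R f x - f x)\<^sup>2) \<partial>lborel) \<le> ennreal (exp (1/2) * (2 * pi)\<^sup>2 * (L * R powr (- 2 * \<beta>)))"
proof -
  have [measurable]: "f \<in> borel_measurable borel" by (rule H_classD(4)[OF f])
  define g where "g \<xi> = indicator (- cball 0 R) \<xi> * fourier2 f \<xi>" for \<xi>
  have [measurable]: "g \<in> borel_measurable borel" unfolding g_def by measurable
  note F = integrable_fourier2[OF \<beta> L f]
  have ind: "integrable lborel (\<lambda>\<xi>. indicator A \<xi> * fourier2 f \<xi>)" if [measurable]: "A \<in> sets borel" for A
    by (rule Bochner_Integration.integrable_bound[OF F]) (auto simp: indicator_def)
  then have g: "integrable lborel g" by (simp add: g_def[abs_def])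
  have diff: "ifourier (fourier2 f) x - ifourier (\<lambda>\<xi>. indicator (cball 0 R) \<xi> * fourier2 f \<xi>) x = ifourier g x" for x
    unfolding ifourier_def using F ind[of "cball 0 R"]
    by (subst Bochner_Integration.integral_diff[symmetric])
       (auto intro!: integrable_iexp_mult Bochner_Integration.integral_cong simp: g_def indicator_def)
  have le: "(spectral_cutoff R f x - f x)\<^sup>2 \<le> (cmod (ifourier g x))\<^sup>2" for x
  proof -
    have "(2 * pi)\<^sup>2 * f x = Re (ifourier (fourier2 f) x)"
      unfolding H_class_inversion[OF \<beta> L f, symmetric] by (simp only: Re_complex_of_real)
    then have "(2 * pi)\<^sup>2 * (f x - spectral_cutoff R f x) = Re (ifourier g x)"
      unfolding diff[symmetric] spectral_cutoff_def by (simp add: right_diff_distrib)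
    then have "(2 * pi)\<^sup>2 * \<bar>f x - spectral_cutoff R f x\<bar> \<le> cmod (ifourier g x)"
      using abs_Re_le_cmod[of "ifourier g x"] by (metis abs_mult abs_power2)
    moreover have "1 * \<bar>f x - spectral_cutoff R f x\<bar> \<le> (2 * pi)\<^sup>2 * \<bar>f x - spectral_cutoff R f x\<bar>"
      using pi_gt3 by (intro mult_right_mono one_le_power) auto
    ultimately have "\<bar>spectral_cutoff R f x - f x\<bar> \<le> cmod (ifourier g x)" by (simp add: abs_minus_commute)
    then have "\<bar>spectral_cutoff R f x - f x\<bar>\<^sup>2 \<le> (cmod (ifourier g x))\<^sup>2" by (rule power_mono) auto
    then show ?thesis by simp
  qed
  have "(\<integral>\<^sup>+\<xi>. ennreal ((cmod (g \<xi>))\<^sup>2) \<partial>lborel)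
     \<le> (\<integral>\<^sup>+\<xi>. ennreal (R powr (- 2 * \<beta>)) * ennreal ((1 + (norm \<xi>)\<^sup>2) powr \<beta> * (cmod (fourier2 f \<xi>))\<^sup>2) \<partial>lborel)"
  proof (rule nn_integral_mono)
    fix \<xi> :: "real^2"
    have "(cmod (g \<xi>))\<^sup>2 \<le> R powr (- 2 * \<beta>) * ((1 + (norm \<xi>)\<^sup>2) powr \<beta> * (cmod (fourier2 f \<xi>))\<^sup>2)"
    proof (cases "norm \<xi> > R")
      case True
      have "1 = R powr (- 2 * \<beta>) * (R\<^sup>2) powr \<beta>"
        using R by (simp add: powr_powr flip: powr_numeral powr_add)
      also have "\<dots> \<le> R powr (- 2 * \<beta>) * (1 + (norm \<xi>)\<^sup>2) powr \<beta>"
      proof (intro mult_left_mono powr_mono2)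
        have "R\<^sup>2 \<le> (norm \<xi>)\<^sup>2" using True R by (intro power_mono) auto
        then show "R\<^sup>2 \<le> 1 + (norm \<xi>)\<^sup>2" by simp
      qed (use \<beta> in auto)
      finally have "1 * (cmod (fourier2 f \<xi>))\<^sup>2 \<le> R powr (- 2 * \<beta>) * (1 + (norm \<xi>)\<^sup>2) powr \<beta> * (cmod (fourier2 f \<xi>))\<^sup>2"
        by (rule mult_right_mono) auto
      then show ?thesis using True by (simp add: g_def mult.assoc)
    qed (simp add: g_def)
    then show "ennreal ((cmod (g \<xi>))\<^sup>2) \<le> ennreal (R powr (- 2 * \<beta>)) * ennreal ((1 + (norm \<xi>)\<^sup>2) powr \<beta> * (cmod (fourier2 f \<xi>))\<^sup>2)"
      by (subst ennreal_mult[symmetric]) (auto intro!: ennreal_leI)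
  qed
  also have "\<dots> = ennreal (R powr (- 2 * \<beta>)) * (\<integral>\<^sup>+\<xi>. ennreal ((1 + (norm \<xi>)\<^sup>2) powr \<beta> * (cmod (fourier2 f \<xi>))\<^sup>2) \<partial>lborel)"
    by (rule nn_integral_cmult) measurable
  also have "\<dots> \<le> ennreal (R powr (- 2 * \<beta>)) * ennreal L"
    by (intro mult_left_mono H_classD(3)[OF f]) auto
  finally have N: "(\<integral>\<^sup>+\<xi>. ennreal ((cmod (g \<xi>))\<^sup>2) \<partial>lborel) \<le> ennreal (R powr (- 2 * \<beta>)) * ennreal L" .
  have "(\<integral>\<^sup>+x\<in>cball 0 1. ennreal ((spectral_cutoff R f x - f x)\<^sup>2) \<partial>lborel)
     \<le> (\<integral>\<^sup>+x\<in>cball 0 1. ennreal ((cmod (ifourier g x))\<^sup>2) \<partial>lborel)"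
    using le by (intro nn_integral_mono) (auto simp: indicator_def intro!: ennreal_leI)
  also have "\<dots> \<le> ennreal (exp (1/2) * (2 * pi)\<^sup>2) * (\<integral>\<^sup>+\<xi>. ennreal ((cmod (g \<xi>))\<^sup>2) \<partial>lborel)"
    unfolding ifourier_def by (rule Bessel_ball[OF g])
  also have "\<dots> \<le> ennreal (exp (1/2) * (2 * pi)\<^sup>2) * (ennreal (R powr (- 2 * \<beta>)) * ennreal L)"
    by (intro mult_left_mono N) auto
  also have "\<dots> = ennreal (exp (1/2) * (2 * pi)\<^sup>2 * (L * R powr (- 2 * \<beta>)))"
    using L by (simp add: ennreal_mult[symmetric] mult_ac)
  finally show ?thesis .
qed

section \<open>Mean of the estimator\<close>

lemma set_integral_swap_compact:
  fixes h :: "'a::euclidean_space \<Rightarrow> 'b::euclidean_space \<Rightarrow> real"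
  assumes S: "compact S" and T: "compact T" and h: "continuous_on (S \<times> T) (\<lambda>p. h (fst p) (snd p))"
  shows "(LINT x:S|lborel. LINT y:T|lborel. h x y) = (LINT y:T|lborel. LINT x:S|lborel. h x y)"
proof -
  have "integrable lborel (\<lambda>p. indicator (S \<times> T) p *\<^sub>R h (fst p) (snd p))"
    using S T h by (intro borel_integrable_compact compact_Times)
  then have int: "integrable (lborel \<Otimes>\<^sub>M lborel) (\<lambda>(x, y). indicator S x * (indicator T y * h x y))"
    by (simp add: lborel_prod indicator_times split_beta' mult.assoc)
  have "(LINT x:S|lborel. LINT y:T|lborel. h x y) = (LINT x|lborel. LINT y|lborel. indicator S x * (indicator T y * h x y))"
    by (simp add: set_lebesgue_integral_def)
  also have "\<dots> = (LINT y|lborel. LINT x|lborel. indicator S x * (indicator T y * h x y))"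
    by (rule lborel_pair.Fubini_integral[OF int, symmetric])
  also have "\<dots> = (LINT y:T|lborel. LINT x:S|lborel. h x y)"
    by (simp only: set_lebesgue_integral_def real_scaleR_def mult.left_commute[of "indicator S _" "indicator T _"] integral_mult_right_zero)
  finally show ?thesis .
qed

lemma unit_inner: "norm \<theta> = 1 \<Longrightarrow> \<theta> \<bullet> \<theta> = 1"
  by (simp add: norm_eq_sqrt_inner)

lemma norm_rotation: "norm \<theta> = 1 \<Longrightarrow> (norm (s *\<^sub>R \<theta> + t *\<^sub>R perp \<theta>))\<^sup>2 = s\<^sup>2 + t\<^sup>2"
  by (subst power2_norm_eq_inner) (simp add: inner_add_left inner_add_right unit_inner power2_eq_square)

lemma exp_radon_unit:
  assumes "norm \<theta> = 1"
  shows "exp_radon \<mu> f \<theta> s = (\<integral>t. exp (\<mu> * t) * f (s *\<^sub>R \<theta> + t *\<^sub>R perp \<theta>) \<partial>lborel)"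
  by (simp add: exp_radon_def Let_def inner_add_left unit_inner[OF assms])

lemma H_class_rotation_zero:
  assumes f: "f \<in> H_class \<beta> L" and \<theta>: "norm \<theta> = 1" and st: "\<bar>s\<bar> > 1 \<or> \<bar>t\<bar> > 1"
  shows "f (s *\<^sub>R \<theta> + t *\<^sub>R perp \<theta>) = 0"
proof -
  have "1 < s\<^sup>2 + t\<^sup>2"
  proof -
    have "1 < s\<^sup>2 \<or> 1 < t\<^sup>2" using st abs_square_le_1[of s] abs_square_le_1[of t] by linarith
    then show ?thesis using zero_le_power2[of s] zero_le_power2[of t] by linarith
  qed
  then have "norm (s *\<^sub>R \<theta> + t *\<^sub>R perp \<theta>) > 1"
    unfolding norm_rotation[OF \<theta>, symmetric] by (metis norm_ge_zero not_le power_le_one)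
  then show ?thesis using H_classD(2)[OF f] by simp
qed

lemma exp_radon_eq_0:
  assumes "f \<in> H_class \<beta> L" "norm \<theta> = 1" "\<bar>s\<bar> > 1"
  shows "exp_radon \<mu> f \<theta> s = 0"
  using H_class_rotation_zero[OF assms(1,2)] assms(3) by (simp add: exp_radon_unit[OF assms(2)])

text \<open>A line meets the support only at parameters |t| <= 1: an interval of length 2, on which
  the exponential weight is at most exp |\<mu>|.\<close>

lemma abs_exp_radon_le:
  assumes f: "f \<in> H_class \<beta> L" and \<theta>: "norm \<theta> = 1" and B: "\<And>x. \<bar>f x\<bar> \<le> B"
  shows "\<bar>exp_radon \<mu> f \<theta> s\<bar> \<le> 2 * exp \<bar>\<mu>\<bar> * B"
proof -
  let ?g = "\<lambda>t::real. indicator {-1..1} t * (exp \<bar>\<mu>\<bar> * B) :: real"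
  have le: "norm (exp (\<mu> * t) * f (s *\<^sub>R \<theta> + t *\<^sub>R perp \<theta>)) \<le> ?g t" for t :: real
  proof (cases "\<bar>t\<bar> \<le> 1")
    case True
    have "\<mu> * t \<le> \<bar>\<mu>\<bar> * \<bar>t\<bar>" by (simp flip: abs_mult)
    also have "\<dots> \<le> \<bar>\<mu>\<bar> * 1" using True by (intro mult_left_mono) auto
    finally have "exp (\<mu> * t) * \<bar>f (s *\<^sub>R \<theta> + t *\<^sub>R perp \<theta>)\<bar> \<le> exp \<bar>\<mu>\<bar> * B"
      using B by (intro mult_mono) auto
    then show ?thesis using True by (auto simp: abs_mult indicator_def)
  next
    case False
    then show ?thesis using H_class_rotation_zero[OF f \<theta>, of s t] by (auto simp: indicator_def)
  qed
  have "norm (exp_radon \<mu> f \<theta> s) \<le> (\<integral>t. norm (exp (\<mu> * t) * f (s *\<^sub>R \<theta> + t *\<^sub>R perp \<theta>)) \<partial>lborel)"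
    unfolding exp_radon_unit[OF \<theta>] by (rule integral_norm_bound)
  also have "\<dots> \<le> (\<integral>t. ?g t \<partial>lborel)"
    using le order_trans[OF norm_ge_zero le] by (intro Bochner_Integration.integral_mono') auto
  finally show ?thesis by simp
qed

text \<open>The angular coordinate system \<open>y = s \<theta> + t \<theta>\<^sup>\<bottom>\<close> turns backprojection of \<open>exp_radon\<close> into a
  convolution of \<open>f\<close>.\<close>

lemma line_backprojection:
  assumes f: "f \<in> H_class \<beta> L" and \<theta>: "norm \<theta> = 1"
  shows "(LINT s:{-1..1}|lborel. exp (- \<mu> * (x \<bullet> perp \<theta>)) * kernel \<mu> \<rho> (x \<bullet> \<theta> - s) * exp_radon \<mu> f \<theta> s)
    = (LINT y:cball 0 1|lborel. exp (- \<mu> * ((x - y) \<bullet> perp \<theta>)) * kernel \<mu> \<rho> ((x - y) \<bullet> \<theta>) * f y)"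
proof -
  define H where "H y = indicator (cball 0 1) y * (exp (- \<mu> * ((x - y) \<bullet> perp \<theta>)) * kernel \<mu> \<rho> ((x - y) \<bullet> \<theta>) * f y)" for y
  have [measurable]: "f \<in> borel_measurable borel" by (rule H_classD(4)[OF f])
  have "continuous_on (cball 0 1) (\<lambda>y. exp (- \<mu> * ((x - y) \<bullet> perp \<theta>)) * kernel \<mu> \<rho> ((x - y) \<bullet> \<theta>) * f y)"
    using continuous_on_subset[OF H_classD(1)[OF f] subset_UNIV]
    by (intro continuous_intros continuous_on_compose2[OF continuous_on_kernel]) auto
  from borel_integrable_compact[OF _ this] have H: "integrable lborel H"
    by (simp add: H_def[abs_def])
  then have [measurable]: "H \<in> borel_measurable borel" using borel_measurable_integrable by force
  \<comment> \<open>For y = s \<theta> + t \<theta>-perp the weight of x - y splits into the weight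
    of x and exp (\<mu> t), which is precisely the weight inside \<open>exp_radon\<close>. This is
    why the estimator uses the opposite exponent.\<close>
  have H_rot: "H (s *\<^sub>R \<theta> + t *\<^sub>R perp \<theta>) = exp (- \<mu> * (x \<bullet> perp \<theta>)) * kernel \<mu> \<rho> (x \<bullet> \<theta> - s) * (exp (\<mu> * t) * f (s *\<^sub>R \<theta> + t *\<^sub>R perp \<theta>))" for s t
  proof -
    have "H y = exp (- \<mu> * ((x - y) \<bullet> perp \<theta>)) * kernel \<mu> \<rho> ((x - y) \<bullet> \<theta>) * f y" for y
      using H_classD(2)[OF f, of y] by (auto simp: H_def indicator_def)
    then show ?thesis
      by (simp add: inner_diff_left inner_add_left unit_inner[OF \<theta>] right_diff_distrib exp_diff exp_minus divide_inverse)
  qed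
  have [measurable]: "(\<lambda>p. fst p *\<^sub>R \<theta> + snd p *\<^sub>R perp \<theta>) \<in> borel_measurable (lborel \<Otimes>\<^sub>M lborel)"
    by measurable
  have intp: "integrable (lborel \<Otimes>\<^sub>M lborel) (\<lambda>p. H (fst p *\<^sub>R \<theta> + snd p *\<^sub>R perp \<theta>))"
    using H by (subst (asm) lborel_eq_distr_rotation[OF \<theta>], subst (asm) integrable_distr_eq) auto
  have "(LINT y|lborel. H y) = (LINT p|(lborel \<Otimes>\<^sub>M lborel). H (fst p *\<^sub>R \<theta> + snd p *\<^sub>R perp \<theta>))"
    by (subst lborel_eq_distr_rotation[OF \<theta>], subst integral_distr) auto
  also have "\<dots> = (LINT s|lborel. LINT t|lborel. H (s *\<^sub>R \<theta> + t *\<^sub>R perp \<theta>))"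
    by (subst lborel_pair.integral_fst'[OF intp, symmetric]) simp
  also have "\<dots> = (LINT s|lborel. exp (- \<mu> * (x \<bullet> perp \<theta>)) * kernel \<mu> \<rho> (x \<bullet> \<theta> - s) * exp_radon \<mu> f \<theta> s)"
    unfolding H_rot exp_radon_unit[OF \<theta>] by (simp only: integral_mult_right_zero)
  \<comment> \<open>Lines at distance greater than 1 from the origin miss the support, so
    restricting the offset as in the design loses no mass.\<close>
  also have "\<dots> = (LINT s:{-1..1}|lborel. exp (- \<mu> * (x \<bullet> perp \<theta>)) * kernel \<mu> \<rho> (x \<bullet> \<theta> - s) * exp_radon \<mu> f \<theta> s)"
    unfolding set_lebesgue_integral_def
  proof (intro Bochner_Integration.integral_cong refl)
    fix s :: real
    show "exp (- \<mu> * (x \<bullet> perp \<theta>)) * kernel \<mu> \<rho> (x \<bullet> \<theta> - s) * exp_radon \<mu> f \<theta> s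
      = indicator {-1..1} s *\<^sub>R (exp (- \<mu> * (x \<bullet> perp \<theta>)) * kernel \<mu> \<rho> (x \<bullet> \<theta> - s) * exp_radon \<mu> f \<theta> s)"
      using exp_radon_eq_0[OF f \<theta>, of s \<mu>] by (cases "\<bar>s\<bar> \<le> 1") (simp_all add: indicator_def abs_le_iff)
  qed
  finally show ?thesis by (simp add: set_lebesgue_integral_def H_def)
qed

lemma continuous_on_kernel_compose [continuous_intros]:
  "continuous_on A h \<Longrightarrow> continuous_on A (\<lambda>x. kernel \<mu> \<rho> (h x))"
  by (rule continuous_on_compose2[OF continuous_on_kernel]) auto

text \<open>For fixed y the angular integral is an integral of plane waves over the disc of
  frequencies; for a fixed frequency the y-integral is then the Fourier transform of f. All
  integrands are continuous on compact products, so the orders may be exchanged. The constant is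
  (1/pi) (2 pi)^2 = 4 pi, which is also the total mass of angle times offset.\<close>

lemma circle_backprojection:
  assumes f: "f \<in> H_class \<beta> L" and \<beta>: "\<beta> > 1" and L: "L > 0" and \<mu>: "\<mu> \<noteq> 0" and \<rho>: "\<rho> > 0"
  shows "(LINT t:{0..2*pi}|lborel. LINT s:{-1..1}|lborel.
      exp (- \<mu> * (x \<bullet> perp (vector [cos t, sin t]))) * kernel \<mu> \<rho> (x \<bullet> vector [cos t, sin t] - s)
        * exp_radon \<mu> f (vector [cos t, sin t]) s) = 4 * pi * spectral_cutoff (1/\<rho>) f x"
proof -
  have [measurable]: "f \<in> borel_measurable borel" by (rule H_classD(4)[OF f])
  note [continuous_intros] = continuous_on_compose2[OF H_classD(1)[OF f] _ subset_UNIV]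
  let ?c = "\<lambda>t. vector [cos t, sin t] :: real^2"
  have "(LINT t:{0..2*pi}|lborel. LINT s:{-1..1}|lborel. exp (- \<mu> * (x \<bullet> perp (?c t))) * kernel \<mu> \<rho> (x \<bullet> ?c t - s) * exp_radon \<mu> f (?c t) s)
    = (LINT t:{0..2*pi}|lborel. LINT y:cball 0 1|lborel. exp (- \<mu> * ((x - y) \<bullet> perp (?c t))) * kernel \<mu> \<rho> ((x - y) \<bullet> ?c t) * f y)"
    by (subst line_backprojection[OF f]) auto
  also have "\<dots> = (LINT y:cball 0 1|lborel. LINT t:{0..2*pi}|lborel. exp (- \<mu> * ((x - y) \<bullet> perp (?c t))) * kernel \<mu> \<rho> ((x - y) \<bullet> ?c t) * f y)"
    by (intro set_integral_swap_compact continuous_intros) auto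
  also have "\<dots> = (LINT y:cball 0 1|lborel. 1/pi * (LINT \<xi>:cball 0 (1/\<rho>)|lborel. cos (\<xi> \<bullet> (x - y)) * f y))"
    by (simp only: set_integral_mult_left circle_integral_kernel[OF \<mu> \<rho>]) (simp only: mult.assoc)
  also have "\<dots> = 1/pi * (LINT y:cball 0 1|lborel. LINT \<xi>:cball 0 (1/\<rho>)|lborel. cos (\<xi> \<bullet> (x - y)) * f y)"
    by (rule set_integral_mult_right)
  also have "(LINT y:cball 0 1|lborel. LINT \<xi>:cball 0 (1/\<rho>)|lborel. cos (\<xi> \<bullet> (x - y)) * f y)
    = (LINT \<xi>:cball 0 (1/\<rho>)|lborel. LINT y:cball 0 1|lborel. cos (\<xi> \<bullet> (x - y)) * f y)"
    by (intro set_integral_swap_compact continuous_intros) auto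
  also have "\<dots> = (LINT \<xi>|lborel. Re (indicator (cball 0 (1/\<rho>)) \<xi> * fourier2 f \<xi> * iexp (\<xi> \<bullet> x)))"
    unfolding set_lebesgue_integral_def
  proof (intro Bochner_Integration.integral_cong refl)
    fix \<xi> :: "real^2"
    have int: "integrable lborel (\<lambda>y. complex_of_real (f y) * iexp (- (\<xi> \<bullet> y)) * iexp (\<xi> \<bullet> x))"
      using H_class_integrable[OF f] by (intro integrable_mult_left integrable_iexp_mult) auto
    have "(LINT y|lborel. indicator (cball 0 1) y *\<^sub>R (cos (\<xi> \<bullet> (x - y)) * f y))
       = (LINT y|lborel. Re (complex_of_real (f y) * iexp (- (\<xi> \<bullet> y)) * iexp (\<xi> \<bullet> x)))"
    proof (intro Bochner_Integration.integral_cong refl)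
      fix y
      have "iexp (- (\<xi> \<bullet> y)) * iexp (\<xi> \<bullet> x) = cis (\<xi> \<bullet> (x - y))"
        by (simp add: cis_conv_exp exp_add[symmetric] inner_diff_right algebra_simps)
      then have "Re (complex_of_real (f y) * iexp (- (\<xi> \<bullet> y)) * iexp (\<xi> \<bullet> x)) = f y * cos (\<xi> \<bullet> (x - y))"
        by (simp only: mult.assoc) simp
      then show "indicator (cball 0 1) y *\<^sub>R (cos (\<xi> \<bullet> (x - y)) * f y) = Re (complex_of_real (f y) * iexp (- (\<xi> \<bullet> y)) * iexp (\<xi> \<bullet> x))"
        using H_classD(2)[OF f, of y] by (auto simp: indicator_def)
    qed
    also have "\<dots> = Re (LINT y|lborel. complex_of_real (f y) * iexp (- (\<xi> \<bullet> y)) * iexp (\<xi> \<bullet> x))"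
      by (rule integral_Re[OF int])
    also have "(LINT y|lborel. complex_of_real (f y) * iexp (- (\<xi> \<bullet> y)) * iexp (\<xi> \<bullet> x)) = fourier2 f \<xi> * iexp (\<xi> \<bullet> x)"
      unfolding fourier2_eq by (rule integral_mult_left_zero)
    finally show "indicator (cball 0 (1/\<rho>)) \<xi> *\<^sub>R (LINT y|lborel. indicator (cball 0 1) y *\<^sub>R (cos (\<xi> \<bullet> (x - y)) * f y))
      = Re (indicator (cball 0 (1/\<rho>)) \<xi> * fourier2 f \<xi> * iexp (\<xi> \<bullet> x))"
      by (simp only: indicator_def of_bool_def if_distrib) simp
  qed
  also have "\<dots> = Re (ifourier (\<lambda>\<xi>. indicator (cball 0 (1/\<rho>)) \<xi> * fourier2 f \<xi>) x)"
    unfolding ifourier_def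
  proof (intro integral_Re integrable_iexp_mult)
    show "integrable lborel (\<lambda>\<xi>. indicator (cball 0 (1/\<rho>)) \<xi> * fourier2 f \<xi>)"
      by (rule Bochner_Integration.integrable_bound[OF integrable_fourier2[OF \<beta> L f]]) (auto simp: indicator_def)
  qed auto
  also have "1/pi * \<dots> = 4 * pi * spectral_cutoff (1/\<rho>) f x"
    by (simp add: spectral_cutoff_def power2_eq_square field_simps)
  finally show ?thesis .
qed

section \<open>Integration against the uniform law of the design\<close>

lemma uniform_measure_lborel_eq:
  assumes A: "A \<in> sets borel" "emeasure lborel A = ennreal m" "m > 0"
  shows "uniform_measure lborel A = density lborel (\<lambda>x. ennreal (indicator A x / m))"
  unfolding uniform_measure_def A(2)
  by (intro density_cong) (use A in \<open>auto simp: indicator_def divide_ennreal simp flip: ennreal_1\<close>)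

lemma integral_uniform_measure_lborel:
  fixes f :: "'a::euclidean_space \<Rightarrow> real"
  assumes A: "A \<in> sets borel" "emeasure lborel A = ennreal m" "m > 0" and [measurable]: "f \<in> borel_measurable borel"
  shows "(\<integral>x. f x \<partial>uniform_measure lborel A) = (LINT x:A|lborel. f x) / m"
proof -
  have [measurable]: "A \<in> sets borel" by fact
  have "(\<integral>x. f x \<partial>uniform_measure lborel A) = (\<integral>x. (indicator A x / m) *\<^sub>R f x \<partial>lborel)"
    unfolding uniform_measure_lborel_eq[OF A] using A(3) by (subst integral_density) auto
  also have "\<dots> = (\<integral>x. indicator A x * f x / m \<partial>lborel)"
    by (intro Bochner_Integration.integral_cong) auto
  finally show ?thesis by (simp add: set_lebesgue_integral_def)
qed

lemma prob_space_uniform_angle: "prob_space (uniform_measure lborel {0..<2*pi})"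
  using pi_gt_zero by (intro prob_space_uniform_measure) (auto simp: ennreal_eq_0_iff not_le simp del: pi_gt_zero)

lemma prob_space_uniform_offset: "prob_space (uniform_measure lborel {-1..1::real})"
  by (rule prob_space_uniform_measure) auto

lemma sets_uniform_circle [simp, measurable_cong]: "sets uniform_circle = sets borel"
  by (simp add: uniform_circle_def)

lemma prob_space_uniform_circle: "prob_space uniform_circle"
  unfolding uniform_circle_def by (intro prob_space.prob_space_distr prob_space_uniform_angle) measurable

lemma sets_uniform_Z [simp, measurable_cong]: "sets uniform_Z = sets (borel \<Otimes>\<^sub>M borel)"
  unfolding uniform_Z_def by (intro sets_pair_measure_cong) auto

lemma prob_space_uniform_Z: "prob_space uniform_Z"
proof -
  interpret A: prob_space uniform_circle by (rule prob_space_uniform_circle)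
  interpret B: prob_space "uniform_measure lborel {-1..1::real}" by (rule prob_space_uniform_offset)
  interpret pair_prob_space uniform_circle "uniform_measure lborel {-1..1::real}" ..
  show ?thesis unfolding uniform_Z_def by unfold_locales
qed

text \<open>The law is a measure on the whole plane times the line, so unit length of the direction
  is an almost sure statement. The bound on \<open>exp_radon\<close> can be invoked only through
  it.\<close>

lemma AE_uniform_Z_unit: "AE p in uniform_Z. norm (fst p) = 1"
proof -
  interpret A: prob_space uniform_circle by (rule prob_space_uniform_circle)
  interpret B: prob_space "uniform_measure lborel {-1..1::real}" by (rule prob_space_uniform_offset)
  interpret P: pair_prob_space uniform_circle "uniform_measure lborel {-1..1::real}" ..
  have "AE \<theta> in uniform_circle. norm \<theta> = 1"
    unfolding uniform_circle_def by (subst AE_distr_iff) auto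
  then show ?thesis
    unfolding uniform_Z_def
  proof (intro P.AE_pair_measure)
    let ?N = "uniform_circle \<Otimes>\<^sub>M uniform_measure lborel {-1..1::real}"
    have "(\<lambda>p. norm (fst p)) \<in> borel_measurable ?N" by measurable
    from measurable_sets[OF this, of "{1}"]
    show "{p \<in> space ?N. norm (fst p) = 1} \<in> sets ?N" by (simp add: vimage_def Int_def conj_commute)
  qed auto
qed

lemma nn_integral_uniform_Z:
  assumes [measurable]: "h \<in> borel_measurable (borel \<Otimes>\<^sub>M borel)"
  shows "(\<integral>\<^sup>+p. h p \<partial>uniform_Z) = (\<integral>\<^sup>+t. (\<integral>\<^sup>+s. h (vector [cos t, sin t], s) \<partial>uniform_measure lborel {-1..1}) \<partial>uniform_measure lborel {0..<2*pi})"
proof -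
  interpret B: prob_space "uniform_measure lborel {-1..1::real}" by (rule prob_space_uniform_offset)
  show ?thesis
    unfolding uniform_Z_def
    by (subst B.nn_integral_fst[symmetric]) (auto simp: uniform_circle_def nn_integral_distr)
qed

lemma integral_uniform_Z:
  fixes h :: "(real^2) \<times> real \<Rightarrow> real"
  assumes h: "integrable uniform_Z h"
  shows "(\<integral>p. h p \<partial>uniform_Z) = (LINT t:{0..2*pi}|lborel. LINT s:{-1..1}|lborel. h (vector [cos t, sin t], s)) / (4 * pi)"
proof -
  interpret A: prob_space uniform_circle by (rule prob_space_uniform_circle)
  interpret B: prob_space "uniform_measure lborel {-1..1::real}" by (rule prob_space_uniform_offset)
  interpret P: pair_prob_space uniform_circle "uniform_measure lborel {-1..1::real}" ..
  have [measurable]: "h \<in> borel_measurable (borel \<Otimes>\<^sub>M borel)"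
    using borel_measurable_integrable[OF h] by simp
  let ?c = "\<lambda>t. vector [cos t, sin t] :: real^2"
  have "(\<integral>p. h p \<partial>uniform_Z) = (\<integral>\<theta>. \<integral>s. h (\<theta>, s) \<partial>uniform_measure lborel {-1..1} \<partial>uniform_circle)"
    using h unfolding uniform_Z_def by (rule P.integral_fst'[symmetric])
  also have "\<dots> = (\<integral>t. \<integral>s. h (?c t, s) \<partial>uniform_measure lborel {-1..1} \<partial>uniform_measure lborel {0..<2*pi})"
    unfolding uniform_circle_def by (subst integral_distr) auto
  also have "\<dots> = (\<integral>t. (LINT s:{-1..1}|lborel. h (?c t, s)) / 2 \<partial>uniform_measure lborel {0..<2*pi})"
    by (subst integral_uniform_measure_lborel[where m=2]) auto
  also have "\<dots> = (LINT t:{0..<2*pi}|lborel. (LINT s:{-1..1}|lborel. h (?c t, s)) / 2) / (2 * pi)"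
    unfolding set_lebesgue_integral_def by (subst integral_uniform_measure_lborel[where m="2*pi"]) (auto simp: set_lebesgue_integral_def)
  \<comment> \<open>The endpoint is a null set. The closed interval is the form in which the
    compactness arguments for the angle are stated.\<close>
  also have "(LINT t:{0..<2*pi}|lborel. (LINT s:{-1..1}|lborel. h (?c t, s)) / 2) = (LINT t:{0..2*pi}|lborel. (LINT s:{-1..1}|lborel. h (?c t, s)) / 2)"
    unfolding set_lebesgue_integral_def
    using AE_lborel_singleton[of "2*pi"] by (intro integral_cong_AE) (auto simp: indicator_def)
  also have "\<dots> = (LINT t:{0..2*pi}|lborel. (LINT s:{-1..1}|lborel. h (?c t, s))) / 2"
    by (rule set_integral_divide_zero)
  finally show ?thesis by simp
qed

section \<open>Risk of the estimator\<close>

context prob_space begin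

text \<open>Of the n^2 products in the square only the n diagonal ones survive. Orthogonality rather
  than independence is assumed, so that centred design terms and products of design weights with
  errors are both covered.\<close>

lemma second_moment_average_le:
  fixes X :: "nat \<Rightarrow> 'a \<Rightarrow> real"
  assumes n: "n \<ge> 1"
    and int: "\<And>i j. integrable M (\<lambda>\<omega>. X i \<omega> * X j \<omega>)"
    and orth: "\<And>i j. i \<noteq> j \<Longrightarrow> (\<integral>\<omega>. X i \<omega> * X j \<omega> \<partial>M) = 0"
    and V: "\<And>i. (\<integral>\<omega>. X i \<omega> * X i \<omega> \<partial>M) \<le> V"
  shows "(\<integral>\<^sup>+\<omega>. ennreal ((1 / real n * (\<Sum>i<n. X i \<omega>))\<^sup>2) \<partial>M) \<le> ennreal (V / real n)"
proof -
  have eq: "(1 / real n * (\<Sum>i<n. X i \<omega>))\<^sup>2 = (\<Sum>i<n. \<Sum>j<n. X i \<omega> * X j \<omega>) / (real n)\<^sup>2" for \<omega>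
    by (simp add: power2_eq_square sum_product[symmetric])
  have i: "integrable M (\<lambda>\<omega>. (1 / real n * (\<Sum>i<n. X i \<omega>))\<^sup>2)"
    unfolding eq using int by (intro integrable_divide_zero Bochner_Integration.integrable_sum impI)
  have "(\<integral>\<omega>. (1 / real n * (\<Sum>i<n. X i \<omega>))\<^sup>2 \<partial>M) = (\<Sum>i<n. \<Sum>j<n. (\<integral>\<omega>. X i \<omega> * X j \<omega> \<partial>M)) / (real n)\<^sup>2"
    unfolding eq by (simp add: int Bochner_Integration.integral_sum)
  also have "(\<Sum>i<n. \<Sum>j<n. (\<integral>\<omega>. X i \<omega> * X j \<omega> \<partial>M)) = (\<Sum>i<n. \<Sum>j<n. if j = i then (\<integral>\<omega>. X i \<omega> * X i \<omega> \<partial>M) else 0)"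
    by (intro sum.cong refl) (auto simp: orth)
  also have "\<dots> = (\<Sum>i<n. (\<integral>\<omega>. X i \<omega> * X i \<omega> \<partial>M))"
    by (intro sum.cong refl) (simp add: sum.delta)
  also have "\<dots> \<le> (\<Sum>i<n. V)" by (intro sum_mono V)
  also have "(\<Sum>i<n. V) = real n * V" by simp
  finally have "(\<integral>\<omega>. (1 / real n * (\<Sum>i<n. X i \<omega>))\<^sup>2 \<partial>M) \<le> real n * V / (real n)\<^sup>2"
    using n by (simp add: divide_right_mono)
  also have "\<dots> = V / real n" using n by (simp add: power2_eq_square)
  finally show ?thesis
    using i by (subst nn_integral_eq_integral) (auto intro!: ennreal_leI)
qed

lemma indep_vars_product_expectation:
  fixes X :: "'i \<Rightarrow> 'a \<Rightarrow> real"
  assumes "indep_vars (\<lambda>_. borel) X UNIV" "\<And>i. integrable M (X i)" "i \<noteq> j"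
  shows "integrable M (\<lambda>\<omega>. X i \<omega> * X j \<omega>)" "(\<integral>\<omega>. X i \<omega> * X j \<omega> \<partial>M) = (\<integral>\<omega>. X i \<omega> \<partial>M) * (\<integral>\<omega>. X j \<omega> \<partial>M)"
proof -
  have "indep_vars (\<lambda>_. borel) X {i, j}" by (rule indep_vars_subset[OF assms(1)]) auto
  from indep_vars_lebesgue_integral[OF _ this assms(2)] indep_vars_integrable[OF _ this assms(2)] assms(3)
  show "integrable M (\<lambda>\<omega>. X i \<omega> * X j \<omega>)" "(\<integral>\<omega>. X i \<omega> * X j \<omega> \<partial>M) = (\<integral>\<omega>. X i \<omega> \<partial>M) * (\<integral>\<omega>. X j \<omega> \<partial>M)"
    by auto
qed

text \<open>Independence of design and noise is given through the sigma-algebras that the two whole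
  sequences generate. Variables measurable with respect to these generate smaller ones and inherit
  independence.\<close>

lemma indep_set_imp_indep_var:
  assumes ind: "indep_set (sets N1) (sets N2)" and sp: "space N1 = space M" "space N2 = space M"
    and U: "U \<in> N1 \<rightarrow>\<^sub>M K1" and W: "W \<in> N2 \<rightarrow>\<^sub>M K2"
  shows "indep_var K1 U K2 W"
proof -
  have sub: "sets N1 \<subseteq> events" "sets N2 \<subseteq> events" using ind by (auto simp: indep_sets2_eq)
  have 1: "sigma_sets (space M) {U -` A \<inter> space M |A. A \<in> sets K1} \<subseteq> sets N1"
  proof -
    have "{U -` A \<inter> space M |A. A \<in> sets K1} \<subseteq> sets N1" using measurable_sets[OF U] sp by auto
    from sets.sigma_sets_subset[OF this] show ?thesis by (simp only: sp)
  qed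
  have 2: "sigma_sets (space M) {W -` A \<inter> space M |A. A \<in> sets K2} \<subseteq> sets N2"
  proof -
    have "{W -` A \<inter> space M |A. A \<in> sets K2} \<subseteq> sets N2" using measurable_sets[OF W] sp by auto
    from sets.sigma_sets_subset[OF this] show ?thesis by (simp only: sp)
  qed
  have "random_variable K1 U" "random_variable K2 W"
    using U W sub sp by (auto simp: measurable_def)
  then show ?thesis
    unfolding indep_var_eq indep_sets2_eq using ind 1 2 sub unfolding indep_sets2_eq by blast
qed

end

section \<open>Moments of a single summand, and the risk at a point\<close>

lemma measurable_exp_radon [measurable]:
  assumes [measurable]: "f \<in> borel_measurable borel"
  shows "(\<lambda>p. exp_radon \<mu> f (fst p) (snd p)) \<in> borel_measurable (borel \<Otimes>\<^sub>M borel)"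
  unfolding exp_radon_def Let_def by measurable

text \<open>The coefficient of one observation in \<open>estimator\<close>, as a function of its
  design point.\<close>

definition backproj :: "real \<Rightarrow> real \<Rightarrow> real^2 \<Rightarrow> (real^2) \<times> real \<Rightarrow> real" where
  "backproj \<mu> \<rho> x p = exp (- \<mu> * (x \<bullet> perp (fst p))) * kernel \<mu> \<rho> (x \<bullet> fst p - snd p)"

lemma measurable_backproj [measurable]: "backproj \<mu> \<rho> x \<in> borel_measurable (borel \<Otimes>\<^sub>M borel)"
  unfolding backproj_def by measurable

lemma backproj_sq_le:
  assumes "norm \<theta> = 1" "norm x \<le> 1"
  shows "(backproj \<mu> \<rho> x (\<theta>, s))\<^sup>2 \<le> exp (2 * \<bar>\<mu>\<bar>) * (kernel \<mu> \<rho> (x \<bullet> \<theta> - s))\<^sup>2"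
proof -
  have "\<bar>x \<bullet> perp \<theta>\<bar> \<le> 1"
    using Cauchy_Schwarz_ineq2[of x "perp \<theta>"] assms by simp
  then have "- \<mu> * (x \<bullet> perp \<theta>) \<le> \<bar>\<mu>\<bar>"
    using mult_left_le[of "\<bar>x \<bullet> perp \<theta>\<bar>" "\<bar>\<mu>\<bar>"] abs_ge_self[of "- \<mu> * (x \<bullet> perp \<theta>)"] by (simp add: abs_mult)
  then have "exp (2 * (- \<mu> * (x \<bullet> perp \<theta>))) \<le> exp (2 * \<bar>\<mu>\<bar>)" by simp
  moreover have "(backproj \<mu> \<rho> x (\<theta>, s))\<^sup>2 = exp (2 * (- \<mu> * (x \<bullet> perp \<theta>))) * (kernel \<mu> \<rho> (x \<bullet> \<theta> - s))\<^sup>2"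
    unfolding exp_double by (simp add: backproj_def power_mult_distrib)
  ultimately show ?thesis by (simp add: mult_right_mono)
qed

text \<open>Here the condition |\<mu>| < 1/\<rho> enters: it keeps the upper limit of the kernel
  integral comparable to 1/\<rho>. The true factor sqrt 2 is rounded up to 2.\<close>

lemma kernel_scale_le:
  assumes "\<rho> > 0" "\<bar>\<mu>\<bar> < 1 / \<rho>"
  shows "sqrt (1 / \<rho>\<^sup>2 + \<mu>\<^sup>2) \<le> 2 / \<rho>"
proof (rule real_le_lsqrt)
  have e: "1 / \<rho>\<^sup>2 = (1 / \<rho>)\<^sup>2" "(2 / \<rho>)\<^sup>2 = 4 * (1 / \<rho>)\<^sup>2" by (simp_all add: power_divide)
  have "\<mu>\<^sup>2 \<le> (1 / \<rho>)\<^sup>2" using assms power_mono[of "\<bar>\<mu>\<bar>" "1/\<rho>" 2] by simp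
  then show "1 / \<rho>\<^sup>2 + \<mu>\<^sup>2 \<le> (2 / \<rho>)\<^sup>2" unfolding e using zero_le_power2[of "1 / \<rho>"] by linarith
qed (use assms in auto)

text \<open>For each direction the offset integral is extended to the whole line and translated, so
  x disappears. The constant 16 is 4 (2/\<rho>)^3 = 32 / \<rho>^3 halved by the density 1/2 of the
  offset.\<close>

lemma backproj_second_moment:
  assumes \<rho>: "\<rho> > 0" and \<mu>: "\<bar>\<mu>\<bar> < 1 / \<rho>" and x: "norm x \<le> 1"
  shows "(\<integral>\<^sup>+p. ennreal ((backproj \<mu> \<rho> x p)\<^sup>2) \<partial>uniform_Z) \<le> ennreal (16 * exp (2 * \<bar>\<mu>\<bar>) / \<rho> ^ 3)"
proof -
  let ?c = "\<lambda>t. vector [cos t, sin t] :: real^2"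
  let ?U = "uniform_measure lborel {-1..1::real}"
  define b where "b = sqrt (1 / \<rho>\<^sup>2 + \<mu>\<^sup>2)"
  have "b ^ 3 \<le> (2 / \<rho>) ^ 3" unfolding b_def by (intro power_mono kernel_scale_le[OF \<rho> \<mu>]) auto
  then have b: "b ^ 3 \<le> 8 / \<rho> ^ 3" by (simp add: power_divide)
  have inner: "(\<integral>\<^sup>+s. ennreal ((backproj \<mu> \<rho> x (?c t, s))\<^sup>2) \<partial>?U) \<le> ennreal (16 * exp (2 * \<bar>\<mu>\<bar>) / \<rho> ^ 3)" for t
  proof -
    have "(\<integral>\<^sup>+s. ennreal ((backproj \<mu> \<rho> x (?c t, s))\<^sup>2) \<partial>?U) = (\<integral>\<^sup>+s\<in>{-1..1}. ennreal ((backproj \<mu> \<rho> x (?c t, s))\<^sup>2) \<partial>lborel) / 2"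
      by (subst nn_integral_uniform_measure) auto
    also have "(\<integral>\<^sup>+s\<in>{-1..1}. ennreal ((backproj \<mu> \<rho> x (?c t, s))\<^sup>2) \<partial>lborel)
      \<le> (\<integral>\<^sup>+s. ennreal (exp (2 * \<bar>\<mu>\<bar>)) * ennreal ((kernel \<mu> \<rho> (x \<bullet> ?c t - s))\<^sup>2) \<partial>lborel)"
      using backproj_sq_le[OF _ x, of "?c t" \<mu> \<rho>]
      by (intro nn_integral_mono) (auto simp: indicator_def simp flip: ennreal_mult intro!: ennreal_leI)
    also have "\<dots> = ennreal (exp (2 * \<bar>\<mu>\<bar>)) * (\<integral>\<^sup>+s. ennreal ((kernel \<mu> \<rho> (x \<bullet> ?c t - s))\<^sup>2) \<partial>lborel)"
      by (rule nn_integral_cmult) measurable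
    also have "(\<integral>\<^sup>+s. ennreal ((kernel \<mu> \<rho> (x \<bullet> ?c t - s))\<^sup>2) \<partial>lborel) = (\<integral>\<^sup>+u. ennreal ((kernel \<mu> \<rho> u)\<^sup>2) \<partial>lborel)"
      using nn_integral_real_affine[of "\<lambda>u. ennreal ((kernel \<mu> \<rho> u)\<^sup>2)" "-1" "x \<bullet> ?c t"] by simp
    also have "\<dots> \<le> ennreal (4 * (8 / \<rho> ^ 3))"
    proof -
      have "ennreal (4 * b ^ 3) \<le> ennreal (4 * (8 / \<rho> ^ 3))" using b by (intro ennreal_leI mult_left_mono) auto
      with nn_integral_kernel_sq_le[OF \<rho>, of \<mu>] show ?thesis unfolding b_def by (rule order_trans)
    qed
    finally have "(\<integral>\<^sup>+s. ennreal ((backproj \<mu> \<rho> x (?c t, s))\<^sup>2) \<partial>?U) \<le> ennreal (exp (2 * \<bar>\<mu>\<bar>)) * ennreal (4 * (8 / \<rho> ^ 3)) / 2"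
      by (simp add: divide_right_mono_ennreal mult_left_mono)
    also have "\<dots> = ennreal (16 * exp (2 * \<bar>\<mu>\<bar>) / \<rho> ^ 3)"
    proof -
      have "ennreal (exp (2 * \<bar>\<mu>\<bar>)) * ennreal (4 * (8 / \<rho> ^ 3)) / ennreal 2 = ennreal (exp (2 * \<bar>\<mu>\<bar>) * (4 * (8 / \<rho> ^ 3)) / 2)"
        using \<rho> by (subst ennreal_mult[symmetric], simp, simp, subst divide_ennreal) auto
      also have "exp (2 * \<bar>\<mu>\<bar>) * (4 * (8 / \<rho> ^ 3)) / 2 = 16 * exp (2 * \<bar>\<mu>\<bar>) / \<rho> ^ 3" by simp
      finally show ?thesis by simp
    qed
    finally show ?thesis .
  qed
  interpret A: prob_space "uniform_measure lborel {0..<2*pi}" by (rule prob_space_uniform_angle)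
  have "(\<integral>\<^sup>+p. ennreal ((backproj \<mu> \<rho> x p)\<^sup>2) \<partial>uniform_Z)
    = (\<integral>\<^sup>+t. \<integral>\<^sup>+s. ennreal ((backproj \<mu> \<rho> x (?c t, s))\<^sup>2) \<partial>?U \<partial>uniform_measure lborel {0..<2*pi})"
    by (rule nn_integral_uniform_Z) measurable
  also have "\<dots> \<le> (\<integral>\<^sup>+t. ennreal (16 * exp (2 * \<bar>\<mu>\<bar>) / \<rho> ^ 3) \<partial>uniform_measure lborel {0..<2*pi})"
    by (intro nn_integral_mono inner)
  also have "\<dots> = ennreal (16 * exp (2 * \<bar>\<mu>\<bar>) / \<rho> ^ 3)"
    using A.emeasure_space_1 by simp
  finally show ?thesis .
qed

lemma backproj_mean:
  assumes f: "f \<in> H_class \<beta> L" and \<beta>: "\<beta> > 1" and L: "L > 0" and \<mu>: "\<mu> \<noteq> 0" and \<rho>: "\<rho> > 0"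
    and int: "integrable uniform_Z (\<lambda>p. backproj \<mu> \<rho> x p * exp_radon \<mu> f (fst p) (snd p))"
  shows "(\<integral>p. backproj \<mu> \<rho> x p * exp_radon \<mu> f (fst p) (snd p) \<partial>uniform_Z) = spectral_cutoff (1/\<rho>) f x"
  using circle_backprojection[OF f \<beta> L \<mu> \<rho>, of x] unfolding integral_uniform_Z[OF int]
  by (simp add: backproj_def)

text \<open>Bias, design fluctuation and noise are separated by \<open>(a + b + c)\<^sup>2 \<le> 3 (a\<^sup>2 + b\<^sup>2 + c\<^sup>2)\<close>, so that
  no cross terms between design and noise have to be evaluated.\<close>

lemma estimator_pointwise_risk:
  fixes M :: "'a measure"
    and \<theta> :: "nat \<Rightarrow> 'a \<Rightarrow> real^2" and s \<epsilon> :: "nat \<Rightarrow> 'a \<Rightarrow> real"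
    and \<mu> \<beta> L \<sigma> \<rho> :: real
  assumes "prob_space M"
    and \<mu>0: "\<mu> \<noteq> 0" and \<beta>: "\<beta> > 1" and L: "L > 0" and \<rho>: "\<rho> > 0" and \<mu>: "\<bar>\<mu>\<bar> < 1 / \<rho>"
    and design_indep: "prob_space.indep_vars M (\<lambda>_. borel \<Otimes>\<^sub>M borel) (\<lambda>i \<omega>. (\<theta> i \<omega>, s i \<omega>)) UNIV"
    and design_unif: "\<And>i. distr M (borel \<Otimes>\<^sub>M borel) (\<lambda>\<omega>. (\<theta> i \<omega>, s i \<omega>)) = uniform_Z"
    and error_indep: "prob_space.indep_vars M (\<lambda>_. borel) \<epsilon> UNIV"
    and error_mean: "\<And>i. integrable M (\<epsilon> i)" "\<And>i. prob_space.expectation M (\<epsilon> i) = 0"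
    and error_var: "\<And>i. integrable M (\<lambda>\<omega>. (\<epsilon> i \<omega>)\<^sup>2)" "\<And>i. prob_space.variance M (\<epsilon> i) = \<sigma>\<^sup>2"
    and design_error_indep: "prob_space.indep_set M
          (sets (vimage_algebra (space M) (\<lambda>\<omega> i. (\<theta> i \<omega>, s i \<omega>))
                   (PiM UNIV (\<lambda>_. borel \<Otimes>\<^sub>M borel))))
          (sets (vimage_algebra (space M) (\<lambda>\<omega> i. \<epsilon> i \<omega>) (PiM UNIV (\<lambda>_. borel))))"
    and f: "f \<in> H_class \<beta> L" and x: "norm x \<le> 1" and n: "n \<ge> 1"
    and T: "\<And>\<theta> s. norm \<theta> = 1 \<Longrightarrow> \<bar>exp_radon \<mu> f \<theta> s\<bar> \<le> T"
  shows "(\<integral>\<^sup>+\<omega>. ennreal (\<bar>estimator \<mu> \<rho> n (\<lambda>i. \<theta> i \<omega>) (\<lambda>i. s i \<omega>)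
                 (\<lambda>i. exp_radon \<mu> f (\<theta> i \<omega>) (s i \<omega>) + \<epsilon> i \<omega>) x - f x\<bar>\<^sup>2) \<partial>M)
     \<le> ennreal (3 * (spectral_cutoff (1/\<rho>) f x - f x)\<^sup>2)
       + ennreal (3 * ((T\<^sup>2 + \<sigma>\<^sup>2) * (16 * exp (2 * \<bar>\<mu>\<bar>) / \<rho> ^ 3) / real n))"
proof -
  interpret prob_space M by fact
  interpret Z: prob_space uniform_Z by (rule prob_space_uniform_Z)
  define D where "D i \<omega> = (\<theta> i \<omega>, s i \<omega>)" for i \<omega>
  have [measurable]: "f \<in> borel_measurable borel" by (rule H_classD(4)[OF f])
  have D [measurable]: "D i \<in> M \<rightarrow>\<^sub>M (borel \<Otimes>\<^sub>M borel)" for i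
    using design_indep unfolding indep_vars_def D_def[abs_def] by auto
  have eps [measurable]: "\<epsilon> i \<in> borel_measurable M" for i
    using error_indep unfolding indep_vars_def by auto
  have distrD: "distr M (borel \<Otimes>\<^sub>M borel) (D i) = uniform_Z" for i
    using design_unif by (simp add: D_def[abs_def])
  define a where "a = backproj \<mu> \<rho> x"
  define w where "w p = a p * exp_radon \<mu> f (fst p) (snd p)" for p
  have [measurable]: "a \<in> borel_measurable (borel \<Otimes>\<^sub>M borel)" unfolding a_def by measurable
  have [measurable]: "w \<in> borel_measurable (borel \<Otimes>\<^sub>M borel)" unfolding w_def by measurable
  define V where "V = 16 * exp (2 * \<bar>\<mu>\<bar>) / \<rho> ^ 3"
  have V0: "V \<ge> 0" using \<rho> by (simp add: V_def)
  have a2n: "(\<integral>\<^sup>+p. ennreal ((a p)\<^sup>2) \<partial>uniform_Z) \<le> ennreal V"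
    unfolding a_def V_def by (rule backproj_second_moment[OF \<rho> \<mu> x])
  have a2: "integrable uniform_Z (\<lambda>p. (a p)\<^sup>2)"
    by (rule integrableI_bounded) (use a2n in \<open>auto simp: less_top[symmetric] top_unique\<close>)
  have a2V: "(\<integral>p. (a p)\<^sup>2 \<partial>uniform_Z) \<le> V"
    using a2n V0 by (subst (asm) nn_integral_eq_integral[OF a2]) auto
  have w_le: "AE p in uniform_Z. (w p)\<^sup>2 \<le> T\<^sup>2 * (a p)\<^sup>2"
    using AE_uniform_Z_unit
  proof eventually_elim
    case (elim p)
    from T[OF elim, of "snd p"] have "(exp_radon \<mu> f (fst p) (snd p))\<^sup>2 \<le> T\<^sup>2"
      using power_mono[of "\<bar>exp_radon \<mu> f (fst p) (snd p)\<bar>" T 2] by simp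
    from mult_right_mono[OF this, of "(a p)\<^sup>2"] show ?case
      by (simp add: w_def power_mult_distrib mult.commute)
  qed
  have w2: "integrable uniform_Z (\<lambda>p. (w p)\<^sup>2)"
    by (rule Bochner_Integration.integrable_bound[OF integrable_mult_right[OF a2, of "T\<^sup>2"]]) (use w_le in auto)
  \<comment> \<open>On a probability space square integrability gives integrability; this is the
    route to the mean, which is then identified as the spectral cutoff.\<close>
  have w1: "integrable uniform_Z w"
    by (rule Z.square_integrable_imp_integrable[OF _ w2]) simp
  define m where "m = (\<integral>p. w p \<partial>uniform_Z)"
  have m: "m = spectral_cutoff (1/\<rho>) f x"
    unfolding m_def w_def a_def using w1
    by (intro backproj_mean[OF f \<beta> L \<mu>0 \<rho>]) (simp add: w_def[abs_def] a_def)
  have w2T: "(\<integral>p. (w p)\<^sup>2 \<partial>uniform_Z) \<le> T\<^sup>2 * V"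
  proof -
    have "(\<integral>p. (w p)\<^sup>2 \<partial>uniform_Z) \<le> (\<integral>p. T\<^sup>2 * (a p)\<^sup>2 \<partial>uniform_Z)"
      by (intro integral_mono_AE w2 integrable_mult_right a2 w_le)
    also have "\<dots> = T\<^sup>2 * (\<integral>p. (a p)\<^sup>2 \<partial>uniform_Z)" by simp
    also have "\<dots> \<le> T\<^sup>2 * V" by (intro mult_left_mono a2V) auto
    finally show ?thesis .
  qed
  have pull: "integrable M (\<lambda>\<omega>. h (D i \<omega>))" "(\<integral>\<omega>. h (D i \<omega>) \<partial>M) = (\<integral>p. h p \<partial>uniform_Z)"
    if "integrable uniform_Z h" for h :: "(real^2) \<times> real \<Rightarrow> real" and i
  proof -
    have [measurable]: "h \<in> borel_measurable (borel \<Otimes>\<^sub>M borel)"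
      using borel_measurable_integrable[OF that] by simp
    show "integrable M (\<lambda>\<omega>. h (D i \<omega>))" "(\<integral>\<omega>. h (D i \<omega>) \<partial>M) = (\<integral>p. h p \<partial>uniform_Z)"
      using that unfolding distrD[of i, symmetric] by (simp_all add: integrable_distr_eq integral_distr)
  qed

  \<comment> \<open>The fluctuation caused by the random design alone, centred at the cutoff
    \<open>m\<close>; the noise is treated separately in \<open>Y\<close>.\<close>
  define X where "X i \<omega> = w (D i \<omega>) - m" for i \<omega>
  have "indep_vars (\<lambda>_. borel) (\<lambda>i \<omega>. w (D i \<omega>) - m) UNIV"
    by (rule indep_vars_compose2[OF design_indep[folded D_def]]) measurable
  then have Xind: "indep_vars (\<lambda>_. borel) X UNIV" by (simp add: X_def[abs_def])
  have Xint: "integrable M (X i)" for i unfolding X_def[abs_def] by (intro Bochner_Integration.integrable_diff pull w1) simp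
  have X0: "(\<integral>\<omega>. X i \<omega> \<partial>M) = 0" for i
    using pull[OF w1, of i] by (simp add: X_def m_def prob_space)
  have X2: "integrable M (\<lambda>\<omega>. X i \<omega> * X i \<omega>)" "(\<integral>\<omega>. X i \<omega> * X i \<omega> \<partial>M) \<le> T\<^sup>2 * V" for i
  proof -
    have eq: "X i \<omega> * X i \<omega> = (w (D i \<omega>))\<^sup>2 - 2 * m * w (D i \<omega>) + m\<^sup>2" for \<omega>
      by (simp add: X_def power2_eq_square algebra_simps)
    have int: "integrable M (\<lambda>\<omega>. (w (D i \<omega>))\<^sup>2)" "integrable M (\<lambda>\<omega>. 2 * m * w (D i \<omega>))"
      using pull(1)[OF w2, of i] pull(1)[OF w1, of i] by auto
    then show "integrable M (\<lambda>\<omega>. X i \<omega> * X i \<omega>)" unfolding eq by auto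
    have "(\<integral>\<omega>. X i \<omega> * X i \<omega> \<partial>M) = (\<integral>p. (w p)\<^sup>2 \<partial>uniform_Z) - 2 * m * m + m\<^sup>2"
      unfolding eq using int pull(2)[OF w2, of i] pull(2)[OF w1, of i] by (simp add: prob_space m_def)
    \<comment> \<open>A variance is at most the second moment: the discarded amount is m^2.\<close>
    also have "\<dots> \<le> (\<integral>p. (w p)\<^sup>2 \<partial>uniform_Z)" by (simp add: power2_eq_square)
    finally show "(\<integral>\<omega>. X i \<omega> * X i \<omega> \<partial>M) \<le> T\<^sup>2 * V" using w2T by simp
  qed
  have design_part: "(\<integral>\<^sup>+\<omega>. ennreal ((1 / real n * (\<Sum>i<n. X i \<omega>))\<^sup>2) \<partial>M) \<le> ennreal (T\<^sup>2 * V / real n)"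
  proof (rule second_moment_average_le[OF n])
    show "integrable M (\<lambda>\<omega>. X i \<omega> * X j \<omega>)" for i j
      using X2(1) indep_vars_product_expectation(1)[OF Xind Xint] by (cases "i = j") auto
    show "(\<integral>\<omega>. X i \<omega> * X j \<omega> \<partial>M) = 0" if "i \<noteq> j" for i j
      using indep_vars_product_expectation(2)[OF Xind Xint that] by (simp add: X0)
  qed (rule X2(2))

  define Y where "Y i \<omega> = a (D i \<omega>) * \<epsilon> i \<omega>" for i \<omega>
  have ia2: "integrable M (\<lambda>\<omega>. a (D i \<omega>) * a (D i \<omega>))" for i
    using pull(1)[OF a2, of i] by (simp add: power2_eq_square)
  have ie2: "integrable M (\<lambda>\<omega>. \<epsilon> i \<omega> * \<epsilon> i \<omega>)" for i
    using error_var(1)[of i] by (simp add: power2_eq_square)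
  \<comment> \<open>A comparison with the two squares covers equal and distinct indices
    alike.\<close>
  have iaa: "integrable M (\<lambda>\<omega>. a (D i \<omega>) * a (D j \<omega>))" for i j
  proof (rule Bochner_Integration.integrable_bound[OF Bochner_Integration.integrable_add[OF ia2[of i] ia2[of j]]])
    show "AE \<omega> in M. norm (a (D i \<omega>) * a (D j \<omega>)) \<le> norm (a (D i \<omega>) * a (D i \<omega>) + a (D j \<omega>) * a (D j \<omega>))"
    proof (rule AE_I2)
      fix \<omega>
      have "2 * \<bar>a (D i \<omega>)\<bar> * \<bar>a (D j \<omega>)\<bar> \<le> \<bar>a (D i \<omega>)\<bar>\<^sup>2 + \<bar>a (D j \<omega>)\<bar>\<^sup>2" by (rule sum_squares_bound)
      moreover have "0 \<le> \<bar>a (D i \<omega>)\<bar> * \<bar>a (D j \<omega>)\<bar>" by simp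
      ultimately have "\<bar>a (D i \<omega>)\<bar> * \<bar>a (D j \<omega>)\<bar> \<le> \<bar>a (D i \<omega>)\<bar>\<^sup>2 + \<bar>a (D j \<omega>)\<bar>\<^sup>2" by linarith
      then show "norm (a (D i \<omega>) * a (D j \<omega>)) \<le> norm (a (D i \<omega>) * a (D i \<omega>) + a (D j \<omega>) * a (D j \<omega>))"
        by (simp add: abs_mult power2_eq_square)
    qed
  qed measurable
  have iee: "integrable M (\<lambda>\<omega>. \<epsilon> i \<omega> * \<epsilon> j \<omega>)" "i \<noteq> j \<Longrightarrow> (\<integral>\<omega>. \<epsilon> i \<omega> * \<epsilon> j \<omega> \<partial>M) = 0" for i j
    using ie2 indep_vars_product_expectation[OF error_indep error_mean(1), of i j] error_mean(2)
    by (cases "i = j"; auto)+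
  \<comment> \<open>The product of two weights depends on the design sequence and the product of two
    errors on the error sequence, so the expectation factors for all i and j. Off the diagonal the
    error factor is 0, whatever the weights do; on the diagonal it is the variance, the errors being
    centred.\<close>
  have cross: "integrable M (\<lambda>\<omega>. (a (D i \<omega>) * a (D j \<omega>)) * (\<epsilon> i \<omega> * \<epsilon> j \<omega>))"
     "(\<integral>\<omega>. (a (D i \<omega>) * a (D j \<omega>)) * (\<epsilon> i \<omega> * \<epsilon> j \<omega>) \<partial>M) = (\<integral>\<omega>. a (D i \<omega>) * a (D j \<omega>) \<partial>M) * (\<integral>\<omega>. \<epsilon> i \<omega> * \<epsilon> j \<omega> \<partial>M)" for i j
  proof -
    let ?ND = "vimage_algebra (space M) (\<lambda>\<omega> i. (\<theta> i \<omega>, s i \<omega>)) (PiM UNIV (\<lambda>_. borel \<Otimes>\<^sub>M borel))"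
    let ?NE = "vimage_algebra (space M) (\<lambda>\<omega> i. \<epsilon> i \<omega>) (PiM UNIV (\<lambda>_. borel))"
    have "(\<lambda>\<omega> i. (\<theta> i \<omega>, s i \<omega>)) \<in> ?ND \<rightarrow>\<^sub>M PiM UNIV (\<lambda>_. borel \<Otimes>\<^sub>M borel)"
      by (rule measurable_vimage_algebra1) (auto simp: space_PiM space_pair_measure)
    from measurable_compose[OF this, of "\<lambda>d. a (d i) * a (d j)" borel]
    have U: "(\<lambda>\<omega>. a (D i \<omega>) * a (D j \<omega>)) \<in> ?ND \<rightarrow>\<^sub>M borel" unfolding D_def by measurable
    have "(\<lambda>\<omega> i. \<epsilon> i \<omega>) \<in> ?NE \<rightarrow>\<^sub>M PiM UNIV (\<lambda>_. borel)"
      by (rule measurable_vimage_algebra1) (auto simp: space_PiM)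
    from measurable_compose[OF this, of "\<lambda>e. e i * e j" borel]
    have W: "(\<lambda>\<omega>. \<epsilon> i \<omega> * \<epsilon> j \<omega>) \<in> ?NE \<rightarrow>\<^sub>M borel" by measurable
    have "indep_var borel (\<lambda>\<omega>. a (D i \<omega>) * a (D j \<omega>)) borel (\<lambda>\<omega>. \<epsilon> i \<omega> * \<epsilon> j \<omega>)"
      by (rule indep_set_imp_indep_var[OF design_error_indep _ _ U W]) simp_all
    from indep_var_integrable[OF this iaa iee(1)] indep_var_lebesgue_integral[OF this iaa iee(1)]
    show "integrable M (\<lambda>\<omega>. (a (D i \<omega>) * a (D j \<omega>)) * (\<epsilon> i \<omega> * \<epsilon> j \<omega>))"
     "(\<integral>\<omega>. (a (D i \<omega>) * a (D j \<omega>)) * (\<epsilon> i \<omega> * \<epsilon> j \<omega>) \<partial>M) = (\<integral>\<omega>. a (D i \<omega>) * a (D j \<omega>) \<partial>M) * (\<integral>\<omega>. \<epsilon> i \<omega> * \<epsilon> j \<omega> \<partial>M)"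
      by auto
  qed
  have YY: "Y i \<omega> * Y j \<omega> = (a (D i \<omega>) * a (D j \<omega>)) * (\<epsilon> i \<omega> * \<epsilon> j \<omega>)" for i j \<omega>
    by (simp add: Y_def mult_ac)
  have noise_part: "(\<integral>\<^sup>+\<omega>. ennreal ((1 / real n * (\<Sum>i<n. Y i \<omega>))\<^sup>2) \<partial>M) \<le> ennreal (\<sigma>\<^sup>2 * V / real n)"
  proof (rule second_moment_average_le[OF n])
    show "integrable M (\<lambda>\<omega>. Y i \<omega> * Y j \<omega>)" for i j unfolding YY by (rule cross)
    show "(\<integral>\<omega>. Y i \<omega> * Y j \<omega> \<partial>M) = 0" if "i \<noteq> j" for i j unfolding YY cross(2) iee(2)[OF that] by simp
    show "(\<integral>\<omega>. Y i \<omega> * Y i \<omega> \<partial>M) \<le> \<sigma>\<^sup>2 * V" for i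
    proof -
      have "(\<integral>\<omega>. \<epsilon> i \<omega> * \<epsilon> i \<omega> \<partial>M) = \<sigma>\<^sup>2"
        using error_var(2)[of i] error_mean(2)[of i] by (simp add: power2_eq_square)
      moreover have "(\<integral>\<omega>. a (D i \<omega>) * a (D i \<omega>) \<partial>M) \<le> V"
        using pull(2)[OF a2, of i] a2V by (simp add: power2_eq_square)
      then have "(\<integral>\<omega>. a (D i \<omega>) * a (D i \<omega>) \<partial>M) * \<sigma>\<^sup>2 \<le> V * \<sigma>\<^sup>2" by (rule mult_right_mono) simp
      ultimately show ?thesis
        unfolding YY cross(2) by (simp only: mult.commute[of V])
    qed
  qed

  define A where "A \<omega> = 1 / real n * (\<Sum>i<n. X i \<omega>)" for \<omega>
  define N where "N \<omega> = 1 / real n * (\<Sum>i<n. Y i \<omega>)" for \<omega>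
  have [measurable]: "X i \<in> borel_measurable M" "Y i \<in> borel_measurable M" for i
    unfolding X_def[abs_def] Y_def[abs_def] by measurable
  have [measurable]: "A \<in> borel_measurable M" "N \<in> borel_measurable M"
    unfolding A_def N_def by measurable
  \<comment> \<open>Bias, design fluctuation and noise, in this order.\<close>
  have est: "estimator \<mu> \<rho> n (\<lambda>i. \<theta> i \<omega>) (\<lambda>i. s i \<omega>) (\<lambda>i. exp_radon \<mu> f (\<theta> i \<omega>) (s i \<omega>) + \<epsilon> i \<omega>) x - f x
      = (m - f x) + A \<omega> + N \<omega>" for \<omega>
  proof -
    have "(\<Sum>i<n. exp (- \<mu> * (x \<bullet> perp (\<theta> i \<omega>))) * kernel \<mu> \<rho> (x \<bullet> \<theta> i \<omega> - s i \<omega>) * (exp_radon \<mu> f (\<theta> i \<omega>) (s i \<omega>) + \<epsilon> i \<omega>))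
      = (\<Sum>i<n. m + X i \<omega> + Y i \<omega>)"
      by (intro sum.cong refl) (simp add: X_def Y_def w_def a_def backproj_def D_def distrib_left)
    also have "\<dots> = real n * m + (\<Sum>i<n. X i \<omega>) + (\<Sum>i<n. Y i \<omega>)"
      by (simp add: sum.distrib)
    finally show ?thesis
      using n by (simp add: estimator_def A_def N_def field_simps)
  qed
  have sq: "\<bar>u + v + z\<bar>\<^sup>2 \<le> 3 * u\<^sup>2 + (3 * v\<^sup>2 + 3 * z\<^sup>2)" for u v z :: real
    using sum_squares_bound[of u v] sum_squares_bound[of u z] sum_squares_bound[of v z]
    by (simp add: power2_eq_square algebra_simps)
  have "(\<integral>\<^sup>+\<omega>. ennreal (\<bar>estimator \<mu> \<rho> n (\<lambda>i. \<theta> i \<omega>) (\<lambda>i. s i \<omega>)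
                 (\<lambda>i. exp_radon \<mu> f (\<theta> i \<omega>) (s i \<omega>) + \<epsilon> i \<omega>) x - f x\<bar>\<^sup>2) \<partial>M)
    \<le> (\<integral>\<^sup>+\<omega>. ennreal (3 * (m - f x)\<^sup>2) + (ennreal 3 * ennreal ((A \<omega>)\<^sup>2) + ennreal 3 * ennreal ((N \<omega>)\<^sup>2)) \<partial>M)"
    unfolding est using ennreal_leI[OF sq] by (intro nn_integral_mono) (simp add: ennreal_mult)
  also have "\<dots> = ennreal (3 * (m - f x)\<^sup>2) + (ennreal 3 * (\<integral>\<^sup>+\<omega>. ennreal ((A \<omega>)\<^sup>2) \<partial>M) + ennreal 3 * (\<integral>\<^sup>+\<omega>. ennreal ((N \<omega>)\<^sup>2) \<partial>M))"
    by (simp add: nn_integral_add nn_integral_cmult emeasure_space_1 del: ennreal_numeral)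
  also have "\<dots> \<le> ennreal (3 * (m - f x)\<^sup>2) + (ennreal 3 * ennreal (T\<^sup>2 * V / real n) + ennreal 3 * ennreal (\<sigma>\<^sup>2 * V / real n))"
    using design_part noise_part unfolding A_def N_def by (intro add_mono mult_left_mono) auto
  also have "ennreal 3 * ennreal (T\<^sup>2 * V / real n) + ennreal 3 * ennreal (\<sigma>\<^sup>2 * V / real n) = ennreal (3 * ((T\<^sup>2 + \<sigma>\<^sup>2) * V / real n))"
    using V0 by (simp add: ennreal_mult[symmetric] ennreal_plus[symmetric] algebra_simps add_divide_distrib del: ennreal_plus ennreal_numeral)
  finally show ?thesis by (simp add: m V_def)
qed

section \<open>Choice of the bandwidth and integration over the ball\<close>

lemma sets_borel_cball [measurable]: "cball a r \<in> sets borel"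
  by (simp add: borel_closed)

lemma measurable_spectral_cutoff [measurable]:
  assumes [measurable]: "f \<in> borel_measurable borel"
  shows "spectral_cutoff R f \<in> borel_measurable borel"
  unfolding spectral_cutoff_def[abs_def] ifourier_def by measurable

lemma rate_sq: "(rate \<beta> n)\<^sup>2 = real n powr (- 2 * \<beta> / (2 * \<beta> + 3))"
  by (simp add: rate_def power2_eq_square flip: powr_add)

lemma bandwidth_bias_rate:
  assumes "\<alpha> > 0" "n \<ge> 1"
  shows "(1 / bandwidth \<alpha> \<beta> n) powr (- 2 * \<beta>) = \<alpha> powr (2 * \<beta>) * (rate \<beta> n)\<^sup>2"
proof -
  have "(1 / bandwidth \<alpha> \<beta> n) powr (- 2 * \<beta>) = bandwidth \<alpha> \<beta> n powr (2 * \<beta>)"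
    using assms by (simp add: bandwidth_def powr_minus_divide powr_divide)
  also have "\<dots> = \<alpha> powr (2 * \<beta>) * (rate \<beta> n)\<^sup>2"
    using assms by (simp add: bandwidth_def powr_mult powr_powr rate_sq)
  finally show ?thesis .
qed

text \<open>With q = 1/(2\<beta>+3) the balance of bias and variance is the identity 1 - 3 q = 2
  \<beta> q: both sides of it are the exponent of n in n \<rho>^3, and the negative of the exponent
  in the squared rate.\<close>

lemma bandwidth_variance_rate:
  assumes "\<alpha> > 0" "n \<ge> 1" "\<beta> > 0"
  shows "1 / (bandwidth \<alpha> \<beta> n ^ 3 * real n) = (rate \<beta> n)\<^sup>2 / \<alpha> ^ 3"
proof -
  define q where "q = 1 / (2 * \<beta> + 3)"
  have q: "q * (2 * \<beta> + 3) = 1" using assms by (simp add: q_def)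
  have n0: "real n > 0" using assms by simp
  have "bandwidth \<alpha> \<beta> n ^ 3 * real n = \<alpha> ^ 3 * (real n powr (- q * 3) * real n powr 1)"
    using n0 by (simp add: bandwidth_def q_def power_mult_distrib powr_powr flip: powr_numeral)
  also have "real n powr (- q * 3) * real n powr 1 = real n powr (1 - 3 * q)"
    unfolding powr_add[symmetric] by (simp add: mult.commute)
  also have "1 - 3 * q = 2 * \<beta> * q" using q by (simp add: algebra_simps)
  finally have "1 / (bandwidth \<alpha> \<beta> n ^ 3 * real n) = real n powr (- (2 * \<beta> * q)) / \<alpha> ^ 3"
    by (simp add: powr_minus divide_inverse)
  then show ?thesis by (simp add: rate_sq q_def)
qed

theorem theorem4:
  fixes M :: "'a measure"
    and \<theta> :: "nat \<Rightarrow> 'a \<Rightarrow> real^2" and s \<epsilon> :: "nat \<Rightarrow> 'a \<Rightarrow> real"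
    and \<mu> \<beta> L \<sigma> \<alpha>\<^sub>2 :: real
  assumes "prob_space M"
    and "\<mu> \<noteq> 0" and "\<beta> > 1" and "L > 0" and "\<sigma> > 0" and "\<alpha>\<^sub>2 > 0"
    and design_indep: "prob_space.indep_vars M (\<lambda>_. borel \<Otimes>\<^sub>M borel) (\<lambda>i \<omega>. (\<theta> i \<omega>, s i \<omega>)) UNIV"
    and design_unif: "\<And>i. distr M (borel \<Otimes>\<^sub>M borel) (\<lambda>\<omega>. (\<theta> i \<omega>, s i \<omega>)) = uniform_Z"
    and error_indep: "prob_space.indep_vars M (\<lambda>_. borel) \<epsilon> UNIV"
    and error_ident: "\<And>i j. distr M borel (\<epsilon> i) = distr M borel (\<epsilon> j)"
    and error_mean: "\<And>i. integrable M (\<epsilon> i)" "\<And>i. prob_space.expectation M (\<epsilon> i) = 0"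
    and error_var: "\<And>i. integrable M (\<lambda>\<omega>. (\<epsilon> i \<omega>)\<^sup>2)" "\<And>i. prob_space.variance M (\<epsilon> i) = \<sigma>\<^sup>2"
    and design_error_indep: "prob_space.indep_set M
          (sets (vimage_algebra (space M) (\<lambda>\<omega> i. (\<theta> i \<omega>, s i \<omega>))
                   (PiM UNIV (\<lambda>_. borel \<Otimes>\<^sub>M borel))))
          (sets (vimage_algebra (space M) (\<lambda>\<omega> i. \<epsilon> i \<omega>) (PiM UNIV (\<lambda>_. borel))))"
  shows "\<exists>C\<^sub>1::real. 0 < C\<^sub>1 \<and>
    (\<forall>n::nat. n \<ge> 1 \<longrightarrow> \<bar>\<mu>\<bar> < 1 / bandwidth \<alpha>\<^sub>2 \<beta> n \<longrightarrow>
      (SUP f \<in> H_class \<beta> L.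
         ennreal (1 / (rate \<beta> n)\<^sup>2) *
         MISE M
           (\<lambda>\<omega>. estimator \<mu> (bandwidth \<alpha>\<^sub>2 \<beta> n) n (\<lambda>i. \<theta> i \<omega>) (\<lambda>i. s i \<omega>)
                 (\<lambda>i. exp_radon \<mu> f (\<theta> i \<omega>) (s i \<omega>) + \<epsilon> i \<omega>))
           f)
      \<le> ennreal C\<^sub>1)"
proof -
  interpret prob_space M by fact
  \<comment> \<open>\<open>W\<close> bounds every f in the class and \<open>T\<close> every value of
    \<open>exp_radon\<close> at a unit direction. In \<open>Cb\<close> and \<open>Cv\<close> the
    leading 3 comes from squaring a sum of three terms, and the powers of
    \<open>\<alpha>\<^sub>2\<close> from inserting the bandwidth. None of them depends on n or
    f.\<close>
  define W where "W = L + weight_mass \<beta>"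
  define T where "T = 2 * exp \<bar>\<mu>\<bar> * W"
  define m where "m = measure lborel (cball 0 1 :: (real^2) set)"
  define Cb where "Cb = 3 * (exp (1/2) * (2 * pi)\<^sup>2 * L * \<alpha>\<^sub>2 powr (2 * \<beta>))"
  define Cv where "Cv = 3 * ((T\<^sup>2 + \<sigma>\<^sup>2) * (16 * exp (2 * \<bar>\<mu>\<bar>))) / \<alpha>\<^sub>2 ^ 3"
  have Cb0: "Cb > 0" using \<open>L > 0\<close> \<open>\<alpha>\<^sub>2 > 0\<close> by (simp add: Cb_def)
  have Cv0: "Cv \<ge> 0" using \<open>\<alpha>\<^sub>2 > 0\<close> by (simp add: Cv_def)
  have m0: "m \<ge> 0" by (simp add: m_def)
  have em: "emeasure lborel (cball 0 1 :: (real^2) set) = ennreal m"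
    unfolding m_def by (intro emeasure_eq_ennreal_measure) (use emeasure_lborel_cball_finite[of "0 :: real^2" 1] in auto)
  show ?thesis
  proof (intro exI conjI allI impI SUP_least)
    show "0 < Cb + Cv * m" using Cb0 Cv0 m0 by (simp add: add_pos_nonneg)
    fix n :: nat and f
    assume n: "n \<ge> 1" and \<mu>: "\<bar>\<mu>\<bar> < 1 / bandwidth \<alpha>\<^sub>2 \<beta> n" and f: "f \<in> H_class \<beta> L"
    define \<rho> where "\<rho> = bandwidth \<alpha>\<^sub>2 \<beta> n"
    define r where "r = (rate \<beta> n)\<^sup>2"
    have \<rho>: "\<rho> > 0" using n \<open>\<alpha>\<^sub>2 > 0\<close> by (simp add: \<rho>_def bandwidth_def)
    have r: "r > 0" using n by (simp add: r_def rate_sq)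
    have \<mu>': "\<bar>\<mu>\<bar> < 1 / \<rho>" using \<mu> by (simp add: \<rho>_def)
    have [measurable]: "f \<in> borel_measurable borel" by (rule H_classD(4)[OF f])
    have DM [measurable]: "(\<lambda>\<omega>. (\<theta> i \<omega>, s i \<omega>)) \<in> M \<rightarrow>\<^sub>M (borel \<Otimes>\<^sub>M borel)" for i
      using design_indep unfolding indep_vars_def by auto
    have [measurable]: "\<theta> i \<in> borel_measurable M" "s i \<in> borel_measurable M" for i
      using measurable_compose[OF DM measurable_fst]
        measurable_compose[OF DM measurable_snd] by simp_all
    have [measurable]: "\<epsilon> i \<in> borel_measurable M" for i
      using error_indep unfolding indep_vars_def by auto
    have [measurable]: "(\<lambda>\<omega>. exp_radon \<mu> f (\<theta> i \<omega>) (s i \<omega>)) \<in> borel_measurable M" for i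
      using measurable_compose[OF DM measurable_exp_radon[of f \<mu>]] by simp
    define G where "G \<omega> x = estimator \<mu> \<rho> n (\<lambda>i. \<theta> i \<omega>) (\<lambda>i. s i \<omega>) (\<lambda>i. exp_radon \<mu> f (\<theta> i \<omega>) (s i \<omega>) + \<epsilon> i \<omega>) x" for \<omega> x
    have [measurable]: "(\<lambda>p. G (fst p) (snd p)) \<in> borel_measurable (M \<Otimes>\<^sub>M lborel)"
      unfolding G_def estimator_def by measurable
    interpret prod_M: pair_sigma_finite M "lborel :: (real^2) measure" ..
    \<comment> \<open>Tonelli moves the integral over the ball outside the expectation, so that the
      risk can be bounded at each x; joint measurability of \<open>G\<close> was prepared for
      this.\<close>
    have "MISE M G f = (\<integral>\<^sup>+x. \<integral>\<^sup>+\<omega>. ennreal (\<bar>G \<omega> x - f x\<bar>\<^sup>2) * indicator (cball 0 1) x \<partial>M \<partial>lborel)"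
      unfolding MISE_def by (rule prod_M.Fubini'[symmetric]) (simp add: split_beta')
    also have "\<dots> \<le> (\<integral>\<^sup>+x. ennreal 3 * (ennreal ((spectral_cutoff (1/\<rho>) f x - f x)\<^sup>2) * indicator (cball 0 1) x) + ennreal (Cv * r) * indicator (cball 0 1) x \<partial>lborel)"
    proof (rule nn_integral_mono)
      fix x :: "real^2"
      have T: "\<bar>exp_radon \<mu> f \<theta> s\<bar> \<le> T" if "norm \<theta> = 1" for \<theta> s
        unfolding T_def W_def by (rule abs_exp_radon_le[OF f that H_class_sup_le[OF \<open>\<beta> > 1\<close> \<open>L > 0\<close> f]])
      have eq: "1 / (\<rho> ^ 3 * real n) = r / \<alpha>\<^sub>2 ^ 3"
        unfolding \<rho>_def r_def using n \<open>\<alpha>\<^sub>2 > 0\<close> \<open>\<beta> > 1\<close> by (intro bandwidth_variance_rate) auto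
      have "3 * ((T\<^sup>2 + \<sigma>\<^sup>2) * (16 * exp (2 * \<bar>\<mu>\<bar>) / \<rho> ^ 3) / real n) = 3 * ((T\<^sup>2 + \<sigma>\<^sup>2) * (16 * exp (2 * \<bar>\<mu>\<bar>))) * (r / \<alpha>\<^sub>2 ^ 3)"
        by (simp add: eq[symmetric])
      also have "\<dots> = Cv * r" by (simp add: Cv_def)
      finally have V: "3 * ((T\<^sup>2 + \<sigma>\<^sup>2) * (16 * exp (2 * \<bar>\<mu>\<bar>) / \<rho> ^ 3) / real n) = Cv * r" .
      have "(\<integral>\<^sup>+\<omega>. ennreal (\<bar>G \<omega> x - f x\<bar>\<^sup>2) \<partial>M) \<le> ennreal (3 * (spectral_cutoff (1/\<rho>) f x - f x)\<^sup>2) + ennreal (Cv * r)" if "norm x \<le> 1"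
        unfolding G_def V[symmetric]
        by (rule estimator_pointwise_risk[OF \<open>prob_space M\<close> \<open>\<mu> \<noteq> 0\<close> \<open>\<beta> > 1\<close> \<open>L > 0\<close> \<rho> \<mu>' design_indep design_unif
            error_indep error_mean error_var design_error_indep f that n T])
      then show "(\<integral>\<^sup>+\<omega>. ennreal (\<bar>G \<omega> x - f x\<bar>\<^sup>2) * indicator (cball 0 1) x \<partial>M)
        \<le> ennreal 3 * (ennreal ((spectral_cutoff (1/\<rho>) f x - f x)\<^sup>2) * indicator (cball 0 1) x) + ennreal (Cv * r) * indicator (cball 0 1) x"
        by (auto simp: indicator_def ennreal_mult simp del: ennreal_numeral)
    qed
    also have "\<dots> = ennreal 3 * (\<integral>\<^sup>+x\<in>cball 0 1. ennreal ((spectral_cutoff (1/\<rho>) f x - f x)\<^sup>2) \<partial>lborel) + ennreal (Cv * r) * ennreal m"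
      unfolding em[symmetric] by (subst nn_integral_add) (auto simp: nn_integral_cmult simp del: ennreal_numeral)
    also have "\<dots> \<le> ennreal 3 * ennreal (exp (1/2) * (2 * pi)\<^sup>2 * (L * (1/\<rho>) powr (- 2 * \<beta>))) + ennreal (Cv * r) * ennreal m"
      using \<rho> by (intro add_mono mult_left_mono spectral_cutoff_bias[OF \<open>\<beta> > 1\<close> \<open>L > 0\<close> f]) auto
    also have "(1/\<rho>) powr (- 2 * \<beta>) = \<alpha>\<^sub>2 powr (2 * \<beta>) * r"
      unfolding \<rho>_def r_def by (rule bandwidth_bias_rate[OF \<open>\<alpha>\<^sub>2 > 0\<close> n])
    also have "ennreal 3 * ennreal (exp (1/2) * (2 * pi)\<^sup>2 * (L * (\<alpha>\<^sub>2 powr (2 * \<beta>) * r))) + ennreal (Cv * r) * ennreal m = ennreal ((Cb + Cv * m) * r)"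
    proof -
      have "ennreal 3 * ennreal (exp (1/2) * (2 * pi)\<^sup>2 * (L * (\<alpha>\<^sub>2 powr (2 * \<beta>) * r))) = ennreal (Cb * r)"
        using \<open>L > 0\<close> r by (subst ennreal_mult[symmetric]) (auto simp: Cb_def mult_ac)
      moreover have "ennreal (Cv * r) * ennreal m = ennreal (Cv * m * r)"
        using Cv0 r m0 by (subst ennreal_mult[symmetric]) (auto simp: mult_ac)
      ultimately show ?thesis using Cb0 Cv0 m0 r by (simp add: distrib_right)
    qed
    finally have "MISE M G f \<le> ennreal ((Cb + Cv * m) * r)" .
    then have "ennreal (1 / r) * MISE M G f \<le> ennreal (1 / r) * ennreal ((Cb + Cv * m) * r)"
      by (rule mult_left_mono) simp
    also have "\<dots> = ennreal (Cb + Cv * m)"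
      using r Cb0 Cv0 m0 by (subst ennreal_mult[symmetric]) auto
    finally show "ennreal (1 / (rate \<beta> n)\<^sup>2) *
         MISE M
           (\<lambda>\<omega>. estimator \<mu> (bandwidth \<alpha>\<^sub>2 \<beta> n) n (\<lambda>i. \<theta> i \<omega>) (\<lambda>i. s i \<omega>)
                 (\<lambda>i. exp_radon \<mu> f (\<theta> i \<omega>) (s i \<omega>) + \<epsilon> i \<omega>))
           f \<le> ennreal (Cb + Cv * m)"
      unfolding G_def[abs_def] r_def \<rho>_def .
  qed
qed

end
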